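(* Let $\Sigma$ be a disk with $n$ punctures, and let $L$ be a link in $\Sigma\times I$. Then there is a spectral sequence with $E_1$ page isomorphic to $\widetilde{\mathrm{APS}}(L)$ that converges to $\mathrm{MKh}(L)$ (with flattened gradings).
   Context: Setting. All links are oriented and considered up to ambient isotopy. $I=[0,1]$ and $\Sigma=\mathbb D^2\setminus\{p_1,\dots,p_n\}$ is an oriented disk with $n$ punctures. A diagram $D\subset\Sigma$ of a link $L\subset\Sigma\times I$ is a generic projection of $L$ to $\Sigma$ with crossing data; it is also a diagram in $\mathbb R^2$ via $\Sigma\hookrightarrow\mathbb R^2$. Khovanov complex over $\mathbb Q$. Order the crossings $c_1,\dots,c_N$ of $D$. The $0$-resolution (resp. $1$-resolution) of a crossing joins the two regions swept out when the overstrand is rotated counterclockwise (resp. clockwise) until it meets the understrand. For $S\in\{0,1\}^N$, $D(S)$ is the collection of circles obtained by replacing each $c_i$ by its $S_i$-resolution. Let $V=\mathbb Q\langle v_+,v_-\rangle$, with quantum degrees $+1,-1$. If $D(S)$ has $k$ circles put $\mathrm{CKh}(D(S))=V^{\otimes k}$; its generators are enhanced states $\{(C_i,s_i)\}_i$, labelings of the circles $C_i$ by signs $s_i\in\{+,-\}$. With $n_\pm$ the numbers of positive/negative crossings, $\mathrm{wr}(D)=n_+-n_-$, $|S|=\sum_iS_i$, $$\mathrm{CKh}(D)=\bigoplus_{S}\mathrm{CKh}(D(S))[|S|-n_-]\{|S|-n_-+\mathrm{wr}(D)\},$$ where $[\cdot]$ and $\{\cdot\}$ are shifts of the homological and quantum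 gradings, $M[i]_m=M_{m-i}$, $M\{i\}_m=M_{m-i}$. If $S'$ is obtained from $S$ by changing one $0$ (in position $j$) to $1$, then $\partial_{S,S'}$ is the merge map ($v_+\otimes v_+\mapsto v_+$, $v_+\otimes v_-,\,v_-\otimes v_+\mapsto v_-$, $v_-\otimes v_-\mapsto 0$) or the split map ($v_+\mapsto v_+\otimes v_-+v_-\otimes v_+$, $v_-\mapsto v_-\otimes v_-$) on the affected factors and the identity on the others; $\partial=\sum(-1)^{\sum_{i<j}S_i}\partial_{S,S'}$. For a filtration $\mathcal F$ of a complex $C$ by a poset, $\mathrm{gr}(C)=\bigoplus_a\mathcal F_aC/\sum_{b<a}\mathcal F_bC$ with the induced differential. $\mathrm{MKh}$. For an enhanced state $x=\{(C_i,s_i)\}_i$ set $g^\Sigma(x)=\sum_is_i[C_i]\in H_1(\Sigma;\mathbb Z)$, circles oriented counterclockwise. Identify $H_1(\Sigma;\mathbb Z)\cong\mathbb Z^n$ via the basis of positively oriented loops around the punctures, with the product partial order. $\mathcal F^\Sigma_a$ is the span of generators $x$ with $g^\Sigma(x)\le a$, and $\mathrm{MKh}(L)=H^*(\mathrm{gr}(\mathrm{CKh}(D),\partial,\mathcal F^\Sigma))$. $\widetilde{\mathrm{APS}}$. $C(\Sigma)$ is the set of homotopy classes of unoriented non-trivial simple closed curves in $\Sigma$, and $\mathbb ZC(\Sigma)$ the free abelian group on it. For an enhanced state put $\Phi(x)=\sum_is_i[C_i]\in\mathbb ZC(\Sigma)$, where trivial circles contribute $0$. Let $\epsilon:\mathbb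 ZC(\Sigma)\to\mathbb Z$ be the sum of coefficients, and let $\alpha\trianglelefteq\beta$ iff $\alpha=\beta$ or $\epsilon(\alpha)<\epsilon(\beta)$. $\mathcal F^\Phi_\alpha$ is the span of generators $x$ with $\Phi(x)\trianglelefteq\alpha$; $\partial$ preserves this filtration, and $\widetilde{\mathrm{APS}}(L)=H^*(\mathrm{gr}^\Phi(\mathrm{CKh}(D)))$. Flattened gradings. Write also $\epsilon:\mathbb Z^n\cong H_1(\Sigma;\mathbb Z)\to\mathbb Z$ for the sum of coordinates. Flattening means replacing the gradings $\Phi$ and $g^\Sigma$ by the $\mathbb Z$-gradings $\epsilon\circ\Phi$ and $\epsilon\circ g^\Sigma$, and the corresponding filtrations by the induced $\mathbb Z$-filtrations of $\mathrm{CKh}(D)$. "Converges to $H$" means that the $E_\infty$ page is isomorphic to the associated graded module of a finite filtration of $H$. *)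

theory Defs
  imports "HOL-Complex_Analysis.Complex_Analysis" "HOL-Library.Poly_Mapping"
begin

section \<open>Rational vector spaces and their subquotients\<close>

class rat_vector = ab_group_add +
  fixes scaleQ :: "rat \<Rightarrow> 'a \<Rightarrow> 'a"
  assumes scaleQ_add_right: "scaleQ c (x + y) = scaleQ c x + scaleQ c y"
    and scaleQ_add_left: "scaleQ (b + c) x = scaleQ b x + scaleQ c x"
    and scaleQ_scaleQ: "scaleQ b (scaleQ c x) = scaleQ (b * c) x"
    and scaleQ_one: "scaleQ 1 x = x"

global_interpretation Q: vector_space "scaleQ :: rat \<Rightarrow> 'a \<Rightarrow> 'a::rat_vector"
  by unfold_locales (rule scaleQ_add_right scaleQ_add_left scaleQ_scaleQ scaleQ_one)+

instantiation rat :: rat_vector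
begin
definition scaleQ_rat :: "rat \<Rightarrow> rat \<Rightarrow> rat" where "scaleQ_rat = (*)"
instance by standard (simp_all add: scaleQ_rat_def algebra_simps)
end

instantiation poly_mapping :: (type, rat_vector) rat_vector
begin
definition scaleQ_poly_mapping :: "rat \<Rightarrow> ('a \<Rightarrow>\<^sub>0 'b) \<Rightarrow> 'a \<Rightarrow>\<^sub>0 'b"
  where "scaleQ_poly_mapping c = Poly_Mapping.map (scaleQ c)"

lemma lookup_scaleQ: "Poly_Mapping.lookup (scaleQ c f) k = scaleQ c (Poly_Mapping.lookup f k)"
  for f :: "'a \<Rightarrow>\<^sub>0 'b"
  by (simp add: scaleQ_poly_mapping_def Poly_Mapping.map.rep_eq when_def)

instance
  by standard
    (auto intro!: poly_mapping_eqI
      simp: lookup_scaleQ lookup_add scaleQ_add_right scaleQ_add_left scaleQ_scaleQ scaleQ_one)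
end

text \<open>
  A pair \<open>(Z, B)\<close> of subspaces \<open>B \<subseteq> Z\<close> stands for the quotient space \<open>Z / B\<close>. Every linear map
  \<open>Z / B \<rightarrow> Z' / B'\<close> is induced by a linear map of the ambient spaces, so maps of
  subquotients are given by such representatives.
\<close>

type_synonym 'v subquo = "'v set \<times> 'v set"

definition subquo :: "'v::rat_vector subquo \<Rightarrow> bool" where
  "subquo X \<longleftrightarrow> Q.subspace (fst X) \<and> Q.subspace (snd X) \<and> snd X \<subseteq> fst X"

definition induces_map ::
    "('v::rat_vector \<Rightarrow> 'w::rat_vector) \<Rightarrow> 'v subquo \<Rightarrow> 'w subquo \<Rightarrow> bool" where
  "induces_map f X Y \<longleftrightarrow>
     Vector_Spaces.linear scaleQ scaleQ f \<and> f ` fst X \<subseteq> fst Y \<and> f ` snd X \<subseteq> snd Y"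

definition zero_map :: "('v \<Rightarrow> 'w) \<Rightarrow> 'v subquo \<Rightarrow> 'w subquo \<Rightarrow> bool" where
  "zero_map f X Y \<longleftrightarrow> f ` fst X \<subseteq> snd Y"

definition isomorphic :: "'v::rat_vector subquo \<Rightarrow> 'w::rat_vector subquo \<Rightarrow> bool" where
  "isomorphic X Y \<longleftrightarrow> subquo X \<and> subquo Y \<and>
     (\<exists>f. induces_map f X Y \<and>
          (\<forall>x\<in>fst X. f x \<in> snd Y \<longrightarrow> x \<in> snd X) \<and>
          (\<forall>y\<in>fst Y. \<exists>x\<in>fst X. y - f x \<in> snd Y))"

text \<open>
  Homology at the middle term of the maps \<open>X \<rightarrow> Y \<rightarrow> W\<close> of quotient spaces induced by \<open>d\<close> and
  \<open>d'\<close>: the kernel is \<open>{y \<in> fst Y. d' y \<in> snd W} / snd Y\<close> and the image is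
  \<open>(d ` fst X + snd Y) / snd Y\<close>.
\<close>

definition homology ::
    "('u \<Rightarrow> 'v) \<Rightarrow> ('v \<Rightarrow> 'w) \<Rightarrow> 'u subquo \<Rightarrow> 'v::plus subquo \<Rightarrow> 'w subquo \<Rightarrow> 'v subquo" where
  "homology d d' X Y W =
     ({y \<in> fst Y. d' y \<in> snd W}, {d x + b | x b. x \<in> fst X \<and> b \<in> snd Y})"

definition direct_sum :: "('k \<Rightarrow> 'v::zero subquo) \<Rightarrow> ('k \<Rightarrow>\<^sub>0 'v) subquo" where
  "direct_sum X =
     ({f. \<forall>k. Poly_Mapping.lookup f k \<in> fst (X k)},
      {f. \<forall>k. Poly_Mapping.lookup f k \<in> snd (X k)})"


section \<open>Spectral sequences\<close>

text \<open>
  \<open>E r p h q k\<close> is the part of the \<open>r\<close>-th page (\<open>r \<ge> 1\<close>) in filtration degree \<open>p\<close>, homological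
  degree \<open>h\<close>, and internal degrees \<open>q\<close> and \<open>k\<close>, which all differentials preserve. Filtrations are
  increasing and differentials raise the homological degree, so the differential of the \<open>r\<close>-th
  page has bidegree \<open>(-r, 1)\<close> in \<open>(p, h)\<close>.
\<close>

type_synonym 'v pages = "nat \<Rightarrow> int \<Rightarrow> int \<Rightarrow> int \<Rightarrow> int \<Rightarrow> 'v subquo"
type_synonym 'v differentials = "nat \<Rightarrow> int \<Rightarrow> int \<Rightarrow> int \<Rightarrow> int \<Rightarrow> 'v \<Rightarrow> 'v"

definition spectral_sequence :: "'v::rat_vector pages \<Rightarrow> 'v differentials \<Rightarrow> bool" where
  "spectral_sequence E d \<longleftrightarrow> (\<forall>r\<ge>1. \<forall>p h q k.
     subquo (E r p h q k) \<and>
     induces_map (d r p h q k) (E r p h q k) (E r (p - int r) (h + 1) q k) \<and>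
     zero_map (d r (p - int r) (h + 1) q k \<circ> d r p h q k)
       (E r p h q k) (E r (p - 2 * int r) (h + 2) q k) \<and>
     isomorphic (E (Suc r) p h q k)
       (homology (d r (p + int r) (h - 1) q k) (d r p h q k)
          (E r (p + int r) (h - 1) q k) (E r p h q k) (E r (p - int r) (h + 1) q k)))"

text \<open>
  From page \<open>R\<close> on, the term in degree \<open>(p, h, q, k)\<close> no longer changes, so that \<open>E R p h q k\<close>
  is the term of the infinity page.
\<close>

definition stable_from ::
    "'v::rat_vector pages \<Rightarrow> 'v differentials \<Rightarrow> nat \<Rightarrow> int \<Rightarrow> int \<Rightarrow> int \<Rightarrow> int \<Rightarrow> bool" where
  "stable_from E d R p h q k \<longleftrightarrow> (\<forall>r\<ge>R.
     zero_map (d r p h q k) (E r p h q k) (E r (p - int r) (h + 1) q k) \<and>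
     zero_map (d r (p + int r) (h - 1) q k) (E r (p + int r) (h - 1) q k) (E r p h q k))"

definition finite_filtration ::
    "(int \<Rightarrow> int \<Rightarrow> int \<Rightarrow> int \<Rightarrow> 'v::rat_vector set) \<Rightarrow> (int \<Rightarrow> int \<Rightarrow> int \<Rightarrow> 'v subquo) \<Rightarrow> bool" where
  "finite_filtration G H \<longleftrightarrow>
     (\<forall>p h q k. Q.subspace (G p h q k) \<and>
        snd (H h q k) \<subseteq> G p h q k \<and> G p h q k \<subseteq> fst (H h q k) \<and>
        G p h q k \<subseteq> G (p + 1) h q k) \<and>
     (\<exists>lo hi. \<forall>h q k. G lo h q k = snd (H h q k) \<and> G hi h q k = fst (H h q k))"

definition converges_to ::
    "'v::rat_vector pages \<Rightarrow> 'v differentials \<Rightarrow> (int \<Rightarrow> int \<Rightarrow> int \<Rightarrow> 'v subquo) \<Rightarrow> bool" where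
  "converges_to E d H \<longleftrightarrow> (\<exists>G. finite_filtration G H \<and>
     (\<forall>p h q k. \<exists>R\<ge>1. stable_from E d R p h q k \<and>
        isomorphic (E R p h q k) (G p h q k, G (p - 1) h q k)))"


section \<open>Links in the thickened punctured disk and their diagrams\<close>

text \<open>
  The disk is the closed unit disk of the complex plane with its standard orientation;
  the list \<open>P\<close> consists of the punctures.
\<close>

definition punctured_disk :: "complex list \<Rightarrow> complex set" where
  "punctured_disk P = cball 0 1 - set P"

text \<open>
  An oriented link is a list of pairwise disjoint embedded circles, each parametrized by the unit
  circle with its counterclockwise orientation. The real coordinate is the height.
\<close>

type_synonym link = "(complex \<Rightarrow> complex \<times> real) list"

definition link_set :: "link \<Rightarrow> (complex \<times> real) set" where
  "link_set L = (\<Union>l\<in>set L. l ` sphere 0 1)"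

definition is_link :: "complex list \<Rightarrow> link \<Rightarrow> bool" where
  "is_link P L \<longleftrightarrow>
     (\<forall>l\<in>set L. continuous_on (sphere 0 1) l \<and> inj_on l (sphere 0 1)) \<and>
     disjoint_family_on (\<lambda>i. (L ! i) ` sphere 0 1) {..<length L} \<and>
     link_set L \<subseteq> punctured_disk P \<times> {0..1}"

text \<open>
  A diagram of \<open>L\<close> is the projection \<open>fst ` link_set L\<close>, whose multiple points are
  transverse double points. Transversality is witnessed by a chart at each crossing: an orientation
  preserving embedding \<open>\<phi>\<close> of the closed unit disk into the punctured disk
  in which the projection is the union of the real diameter (the overstrand, directed from \<open>-1\<close> to
  \<open>1\<close>) and the imaginary diameter (the understrand). The list \<open>X\<close> of these charts, in the
  chosen order of the crossings, is the datum that describes the diagram; the crossing itself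
  is \<open>\<phi> 0\<close>.
\<close>

definition crossing_chart :: "complex list \<Rightarrow> (complex \<Rightarrow> complex) \<Rightarrow> bool" where
  "crossing_chart P \<phi> \<longleftrightarrow>
     continuous_on (cball 0 1) \<phi> \<and> inj_on \<phi> (cball 0 1) \<and>
     \<phi> ` cball 0 1 \<subseteq> punctured_disk P \<and>
     winding_number (\<phi> \<circ> circlepath 0 1) (\<phi> 0) = 1"

text \<open>
  \<open>T\<close> is an arc of the link projecting homeomorphically onto the \<open>\<phi>\<close>-image of the diameter
  from \<open>-v\<close> to \<open>v\<close>, in the direction of the orientation of the link.
\<close>

definition strand ::
    "link \<Rightarrow> (complex \<Rightarrow> complex) \<Rightarrow> complex \<Rightarrow> (complex \<times> real) set \<Rightarrow> bool" where
  "strand L \<phi> v T \<longleftrightarrow> (\<exists>l\<in>set L. \<exists>a b. a < b \<and>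
     T = (\<lambda>t. l (cis t)) ` {a..b} \<and>
     bij_betw (\<lambda>t. fst (l (cis t))) {a..b} (\<phi> ` closed_segment (-v) v) \<and>
     fst (l (cis a)) = \<phi> (-v) \<and> fst (l (cis b)) = \<phi> v)"

text \<open>
  The understrand is directed from \<open>-w\<close> to \<open>w\<close>. As the overstrand is directed along \<open>1\<close>,
  the crossing is positive for \<open>w = \<i>\<close> and negative for \<open>w = -\<i>\<close>.
\<close>

definition crossing :: "link \<Rightarrow> (complex \<Rightarrow> complex) \<Rightarrow> complex \<Rightarrow> bool" where
  "crossing L \<phi> w \<longleftrightarrow> (\<exists>T U. strand L \<phi> 1 T \<and> strand L \<phi> w U \<and>
     {x \<in> link_set L. fst x \<in> \<phi> ` cball 0 1} = T \<union> U \<and>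
     (\<forall>s t. (\<phi> 0, s) \<in> T \<longrightarrow> (\<phi> 0, t) \<in> U \<longrightarrow> t < s))"

definition is_diagram ::
    "complex list \<Rightarrow> link \<Rightarrow> (complex \<Rightarrow> complex) list \<Rightarrow> bool" where
  "is_diagram P L X \<longleftrightarrow>
     (\<forall>\<phi>\<in>set X. crossing_chart P \<phi> \<and> (crossing L \<phi> \<i> \<or> crossing L \<phi> (-\<i>))) \<and>
     disjoint_family_on (\<lambda>i. (X ! i) ` cball 0 1) {..<length X} \<and>
     inj_on fst {x \<in> link_set L. fst x \<notin> (\<Union>\<phi>\<in>set X. \<phi> ` ball 0 1)}"

definition n_pos :: "link \<Rightarrow> (complex \<Rightarrow> complex) list \<Rightarrow> nat" where
  "n_pos L X = card {i. i < length X \<and> crossing L (X ! i) \<i>}"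

definition n_neg :: "link \<Rightarrow> (complex \<Rightarrow> complex) list \<Rightarrow> nat" where
  "n_neg L X = card {i. i < length X \<and> crossing L (X ! i) (-\<i>)}"

definition writhe :: "link \<Rightarrow> (complex \<Rightarrow> complex) list \<Rightarrow> int" where
  "writhe L X = int (n_pos L X) - int (n_neg L X)"


section \<open>Resolutions and the Khovanov complex\<close>

text \<open>
  In a chart, rotating the overstrand (the real diameter) counterclockwise sweeps out the first
  and third quadrants. The 0-resolution joins these two quadrants and the 1-resolution the other
  two; \<open>smoothing b\<close> is the 1-resolution if \<open>b\<close> holds and the 0-resolution otherwise.
\<close>

definition smoothing :: "bool \<Rightarrow> complex set" where
  "smoothing b =
     (if b then closed_segment 1 \<i> \<union> closed_segment (-1) (-\<i>)
      else closed_segment 1 (-\<i>) \<union> closed_segment \<i> (-1))"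

text \<open>A vertex of the cube is encoded by the set \<open>S\<close> of (indices of) 1-resolved crossings.\<close>

definition resolution :: "link \<Rightarrow> (complex \<Rightarrow> complex) list \<Rightarrow> nat set \<Rightarrow> complex set" where
  "resolution L X S =
     (fst ` link_set L - (\<Union>i<length X. (X ! i) ` ball 0 1)) \<union>
     (\<Union>i<length X. (X ! i) ` smoothing (i \<in> S))"

definition circles :: "link \<Rightarrow> (complex \<Rightarrow> complex) list \<Rightarrow> nat set \<Rightarrow> complex set set" where
  "circles L X S = components (resolution L X S)"

text \<open>
  The enhanced state \<open>(S, A)\<close> labels the circles in \<open>A\<close> by \<open>+\<close> and the remaining circles of the
  resolution \<open>S\<close> by \<open>-\<close>. The complex is the rational vector space with basis the enhanced states.
\<close>

type_synonym state = "nat set \<times> complex set set"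
type_synonym chain = "state \<Rightarrow>\<^sub>0 rat"

definition states :: "link \<Rightarrow> (complex \<Rightarrow> complex) list \<Rightarrow> state set" where
  "states L X = {(S, A). S \<subseteq> {..<length X} \<and> A \<subseteq> circles L X S}"

definition label :: "complex set set \<Rightarrow> complex set \<Rightarrow> int" where
  "label A C = (if C \<in> A then 1 else -1)"

definition hdeg :: "link \<Rightarrow> (complex \<Rightarrow> complex) list \<Rightarrow> state \<Rightarrow> int" where
  "hdeg L X = (\<lambda>(S, A). int (card S) - int (n_neg L X))"

definition qdeg :: "link \<Rightarrow> (complex \<Rightarrow> complex) list \<Rightarrow> state \<Rightarrow> int" where
  "qdeg L X = (\<lambda>(S, A).
     (\<Sum>C\<in>circles L X S. label A C) + int (card S) - int (n_neg L X) + writhe L X)"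

text \<open>
  In both of the following relations \<open>K\<close> and \<open>K'\<close> are the collections of circles before and after
  the resolution of one crossing is changed; the circles not affected are those in
  \<open>K \<inter> K'\<close>. The relations say that the labeling \<open>A'\<close> of \<open>K'\<close> occurs (with coefficient 1)
  in the image of the labeling \<open>A\<close> of \<open>K\<close> on the affected factors.
\<close>

definition merge_term ::
    "complex set set \<Rightarrow> complex set set \<Rightarrow> complex set set \<Rightarrow> complex set set \<Rightarrow> bool" where
  "merge_term K K' A A' \<longleftrightarrow> (\<exists>U V W. U \<noteq> V \<and> K - K' = {U, V} \<and> K' - K = {W} \<and>
     (U \<in> A \<and> V \<in> A \<and> W \<in> A' \<or>
      U \<in> A \<and> V \<notin> A \<and> W \<notin> A' \<or>
      U \<notin> A \<and> V \<in> A \<and> W \<notin> A'))"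

definition split_term ::
    "complex set set \<Rightarrow> complex set set \<Rightarrow> complex set set \<Rightarrow> complex set set \<Rightarrow> bool" where
  "split_term K K' A A' \<longleftrightarrow> (\<exists>U V W. V \<noteq> W \<and> K - K' = {U} \<and> K' - K = {V, W} \<and>
     (U \<in> A \<and> V \<in> A' \<and> W \<notin> A' \<or>
      U \<in> A \<and> V \<notin> A' \<and> W \<in> A' \<or>
      U \<notin> A \<and> V \<notin> A' \<and> W \<notin> A'))"

definition edge_coeff ::
    "complex set set \<Rightarrow> complex set set \<Rightarrow> complex set set \<Rightarrow> complex set set \<Rightarrow> rat" where
  "edge_coeff K K' A A' =
     (if A \<inter> (K \<inter> K') = A' \<inter> (K \<inter> K') \<and> (merge_term K K' A A' \<or> split_term K K' A A')
      then 1 else 0)"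

definition boundary_state :: "link \<Rightarrow> (complex \<Rightarrow> complex) list \<Rightarrow> state \<Rightarrow> chain" where
  "boundary_state L X = (\<lambda>(S, A).
     \<Sum>j\<in>{..<length X} - S. \<Sum>A'\<in>Pow (circles L X (insert j S)).
       Poly_Mapping.single (insert j S, A')
         ((-1) ^ card {i \<in> S. i < j} *
          edge_coeff (circles L X S) (circles L X (insert j S)) A A'))"

definition boundary :: "link \<Rightarrow> (complex \<Rightarrow> complex) list \<Rightarrow> chain \<Rightarrow> chain" where
  "boundary L X c =
     (\<Sum>x\<in>Poly_Mapping.keys c. scaleQ (Poly_Mapping.lookup c x) (boundary_state L X x))"


section \<open>Filtrations of the complex\<close>

definition filtration ::
    "link \<Rightarrow> (complex \<Rightarrow> complex) list \<Rightarrow> (state \<Rightarrow> 'i::order) \<Rightarrow> int \<Rightarrow> int \<Rightarrow> 'i \<Rightarrow> chain set" where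
  "filtration L X deg h q a =
     Q.span ((\<lambda>x. Poly_Mapping.single x 1) `
       {x \<in> states L X. hdeg L X x = h \<and> qdeg L X x = q \<and> deg x \<le> a})"

definition gr ::
    "link \<Rightarrow> (complex \<Rightarrow> complex) list \<Rightarrow> (state \<Rightarrow> 'i::order) \<Rightarrow> int \<Rightarrow> int \<Rightarrow> 'i \<Rightarrow> chain subquo" where
  "gr L X deg h q a =
     (filtration L X deg h q a, Q.span (\<Union>b\<in>{..<a}. filtration L X deg h q b))"

definition gr_homology ::
    "link \<Rightarrow> (complex \<Rightarrow> complex) list \<Rightarrow> (state \<Rightarrow> 'i::order) \<Rightarrow> int \<Rightarrow> int \<Rightarrow> 'i \<Rightarrow> chain subquo" where
  "gr_homology L X deg h q a =
     homology (boundary L X) (boundary L X)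
       (gr L X deg (h - 1) q a) (gr L X deg h q a) (gr L X deg (h + 1) q a)"


section \<open>The homology class and the homotopy class of a circle\<close>

definition parametrizes :: "(real \<Rightarrow> complex) \<Rightarrow> complex set \<Rightarrow> bool" where
  "parametrizes c C \<longleftrightarrow> simple_path c \<and> pathfinish c = pathstart c \<and> path_image c = C"

definition ccw_param :: "complex set \<Rightarrow> real \<Rightarrow> complex" where
  "ccw_param C = (SOME c. parametrizes c C \<and> (\<forall>z\<in>inside C. winding_number c z = 1))"

text \<open>
  The class of the counterclockwise circle \<open>C\<close> in the first homology of the punctured disk. In the
  basis of positively oriented loops around the punctures, the coordinates of the class of a
  closed curve are its winding numbers around the punctures. The coordinate vector is
  extended by 0 beyond the number of punctures.
\<close>

definition homology_class :: "complex list \<Rightarrow> complex set \<Rightarrow> nat \<Rightarrow> int" where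
  "homology_class P C i =
     (if i < length P then \<lfloor>Re (winding_number (ccw_param C) (P ! i))\<rfloor> else 0)"

lemma homology_class_sphere:
  assumes "distinct P" "i < length P" "0 < r" "cball (P ! i) r \<inter> set P = {P ! i}"
  shows "homology_class P (sphere (P ! i) r) = (\<lambda>j. if j = i then 1 else 0)"
proof -
  define C where "C = sphere (P ! i) r"
  have ins: "inside C = ball (P ! i) r"
    unfolding C_def using \<open>0 < r\<close> inside_frontier_eq_interior [of "cball (P ! i) r"] by simp
  have "parametrizes (circlepath (P ! i) r) C"
    using \<open>0 < r\<close> by (simp add: parametrizes_def simple_path_circlepath C_def)
  moreover have "\<forall>z\<in>inside C. winding_number (circlepath (P ! i) r) z = 1"
    unfolding ins by (simp add: winding_number_circlepath dist_norm norm_minus_commute)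
  ultimately have "\<exists>c. parametrizes c C \<and> (\<forall>z\<in>inside C. winding_number c z = 1)"
    by blast
  then have "parametrizes (ccw_param C) C \<and>
      (\<forall>z\<in>inside C. winding_number (ccw_param C) z = 1)"
    unfolding ccw_param_def by (rule someI_ex)
  then have c: "simple_path (ccw_param C)" "pathfinish (ccw_param C) = pathstart (ccw_param C)"
      "path_image (ccw_param C) = C"
    and w: "\<And>z. z \<in> ball (P ! i) r \<Longrightarrow> winding_number (ccw_param C) z = 1"
    unfolding ins by (auto simp: parametrizes_def)
  have 0: "winding_number (ccw_param C) (P ! j) = 0" if "j < length P" "j \<noteq> i" for j
  proof (rule winding_number_zero_outside)
    show "P ! j \<notin> cball (P ! i) r"
    proof
      assume "P ! j \<in> cball (P ! i) r"
      then have "P ! j \<in> {P ! i}"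
        unfolding assms(4) [symmetric] using that by simp
      then show False
        using that assms(1,2) by (simp add: nth_eq_iff_index_eq)
    qed
    show "path_image (ccw_param C) \<subseteq> cball (P ! i) r"
      using c(3) by (simp add: C_def sphere_cball)
  qed (simp_all add: c simple_path_imp_path)
  show ?thesis
    using w [of "P ! i"] 0 assms(2,3)
    unfolding homology_class_def C_def [symmetric] by (simp add: fun_eq_iff)
qed

text \<open>
  The free homotopy class, in the punctured disk, of the unoriented curve \<open>C\<close>, as a set of
  parametrized simple closed curves; \<open>c'\<close> ranges over the parametrizations of \<open>C\<close> in both
  directions.
\<close>

definition homotopy_class :: "complex list \<Rightarrow> complex set \<Rightarrow> (real \<Rightarrow> complex) set" where
  "homotopy_class P C =
     {c. parametrizes c (path_image c) \<and>
         (\<exists>c'. parametrizes c' C \<and> homotopic_loops (punctured_disk P) c c')}"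

definition trivial_circle :: "complex list \<Rightarrow> complex set \<Rightarrow> bool" where
  "trivial_circle P C \<longleftrightarrow>
     (\<exists>c a. parametrizes c C \<and> homotopic_loops (punctured_disk P) c (linepath a a))"

definition g_Sigma ::
    "complex list \<Rightarrow> link \<Rightarrow> (complex \<Rightarrow> complex) list \<Rightarrow> state \<Rightarrow> nat \<Rightarrow> int" where
  "g_Sigma P L X = (\<lambda>(S, A) i. \<Sum>C\<in>circles L X S. label A C * homology_class P C i)"

definition Phi ::
    "complex list \<Rightarrow> link \<Rightarrow> (complex \<Rightarrow> complex) list \<Rightarrow> state \<Rightarrow> (real \<Rightarrow> complex) set \<Rightarrow>\<^sub>0 int" where
  "Phi P L X = (\<lambda>(S, A). \<Sum>C\<in>{C \<in> circles L X S. \<not> trivial_circle P C}.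
     Poly_Mapping.single (homotopy_class P C) (label A C))"


section \<open>The two homology theories with flattened gradings\<close>

definition coord_sum :: "complex list \<Rightarrow> (nat \<Rightarrow> int) \<Rightarrow> int" where
  "coord_sum P a = (\<Sum>i<length P. a i)"

definition coeff_sum :: "('c \<Rightarrow>\<^sub>0 int) \<Rightarrow> int" where
  "coeff_sum \<alpha> = (\<Sum>c\<in>Poly_Mapping.keys \<alpha>. Poly_Mapping.lookup \<alpha> c)"

text \<open>The arguments are the homological degree, the quantum degree and the flattened degree.\<close>

definition MKh_flat ::
    "complex list \<Rightarrow> link \<Rightarrow> (complex \<Rightarrow> complex) list \<Rightarrow> int \<Rightarrow> int \<Rightarrow> int \<Rightarrow> chain subquo" where
  "MKh_flat P L X = gr_homology L X (coord_sum P \<circ> g_Sigma P L X)"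

definition APS_flat ::
    "complex list \<Rightarrow> link \<Rightarrow> (complex \<Rightarrow> complex) list \<Rightarrow> int \<Rightarrow> int \<Rightarrow> int \<Rightarrow> chain subquo" where
  "APS_flat P L X = gr_homology L X (coeff_sum \<circ> Phi P L X)"

end

theory Submission
  imports Defs
begin

text \<open>
  Let \<open>g\<close> and \<open>p\<close> be the flattened gradings of an enhanced state that define \<open>MKh\<close> and the
  tilde version of \<open>APS\<close>. In a merge or split of circles \<open>U\<close>, \<open>V\<close>, \<open>W\<close>, a puncture enclosed by one of
  the three circles is enclosed by exactly two of them. So the numbers of enclosed punctures, and
  likewise the indicators of nontriviality, satisfy the three triangle inequalities, and
  neither \<open>g\<close> nor \<open>p\<close> increases under the differential. If \<open>p\<close> is preserved, one
  of the circles is trivial and the other two enclose the same punctures, so that \<open>g\<close> is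
  preserved too. Hence the graded complex for \<open>p\<close> is that of the part \<open>D\<close> of the
  differential that preserves \<open>g\<close>, filtered by \<open>p\<close>, and the spectral sequence of this filtration
  of the graded complex for \<open>g\<close> is the desired one.
\<close>

section \<open>Filtered complexes and their spectral sequences\<close>

text \<open>A circle is a connected component of a set of points in the plane, so the combinatorics
  of the cube must be extracted from topology. The obstacle is to show that changing one smoothing
  merges two circles or splits one. The part of a resolution outside a crossing pairs the four
  strand ends there by two disjoint arcs. If neighbouring ends are paired, the change is a merge or
  a split; opposite ends paired would turn one circle into one circle, and winding numbers in the
  oriented chart exclude this. Winding numbers, reduced mod 2 because the curves come without a
  preferred orientation, also give the rule for enclosed punctures. That the differential squares to
  zero has to be proved as well. Base points on the common outer part name circles across
  resolutions and reduce each face of the cube to the state with all labels +; counting circles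
  leaves six kinds of faces. The differential \<open>D\<close> keeps the value \<open>k\<close> of
  g, so all pages carry \<open>k\<close> as internal degree, as the flattened MKh requires. APS
  records only p, so its pieces are sums over \<open>k\<close> of those of the first page.\<close>

lemma scaleQ_rat_times [simp]: "scaleQ a (b::rat) = a * b"
  by (simp add: scaleQ_rat_def)

section \<open>Linear extension from a basis and chains with prescribed support\<close>

definition lin :: "('a \<Rightarrow> 'b::rat_vector) \<Rightarrow> ('a \<Rightarrow>\<^sub>0 rat) \<Rightarrow> 'b" where
  "lin f c = (\<Sum>x\<in>Poly_Mapping.keys c. scaleQ (Poly_Mapping.lookup c x) (f x))"

lemma lin_superset:
  assumes "finite A" "Poly_Mapping.keys c \<subseteq> A"
  shows "lin f c = (\<Sum>x\<in>A. scaleQ (Poly_Mapping.lookup c x) (f x))"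
  unfolding lin_def using assms
  by (intro sum.mono_neutral_left) (auto simp: in_keys_iff)

lemma lin_add: "lin f (c + d) = lin f c + lin f d"
proof -
  let ?A = "Poly_Mapping.keys c \<union> Poly_Mapping.keys d"
  have "finite ?A" by simp
  note L = lin_superset [OF this, where f = f]
  have "lin f (c + d) = (\<Sum>x\<in>?A. scaleQ (Poly_Mapping.lookup (c + d) x) (f x))"
    by (rule L) (rule Poly_Mapping.keys_add)
  also have "\<dots> = lin f c + lin f d"
    by (simp add: L [of c] L [of d] lookup_add scaleQ_add_left sum.distrib)
  finally show ?thesis .
qed

lemma lin_scaleQ: "lin f (scaleQ a c) = scaleQ a (lin f c)"
proof -
  have "Poly_Mapping.keys (scaleQ a c) \<subseteq> Poly_Mapping.keys c"
    by (auto simp: in_keys_iff lookup_scaleQ)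
  from lin_superset [OF finite_keys this, of f] show ?thesis
    by (simp add: lin_def lookup_scaleQ Q.scale_sum_right)
qed

lemma linear_lin: "Vector_Spaces.linear scaleQ scaleQ (lin f)"
  unfolding Vector_Spaces.linear_iff
  by (simp add: lin_add lin_scaleQ Q.vector_space_axioms)

lemma lin_0 [simp]: "lin f 0 = 0"
  by (simp add: lin_def)

lemma lin_diff: "lin f (c - d) = lin f c - lin f d"
  using lin_add [of f "c - d" d] by simp

lemma lin_sum: "lin f (sum c A) = (\<Sum>i\<in>A. lin f (c i))"
  by (induction A rule: infinite_finite_induct) (simp_all add: lin_add)

lemma lin_single [simp]: "lin f (Poly_Mapping.single x a) = scaleQ a (f x)"
  by (simp add: lin_def)

text \<open>Composites of linear extensions are linear extensions again, so with
  \<open>lin_cong\<close> an identity of maps reduces to basis elements.\<close>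

lemma lin_lin: "lin f (lin g c) = lin (\<lambda>x. lin f (g x)) c"
  by (simp add: lin_def [of g] lin_def [of "\<lambda>x. lin f (g x)"] lin_sum lin_scaleQ)

lemma lin_cong: "(\<And>x. x \<in> Poly_Mapping.keys c \<Longrightarrow> f x = g x) \<Longrightarrow> lin f c = lin g c"
  by (simp add: lin_def)

lemma lookup_sum_poly_mapping: "Poly_Mapping.lookup (sum f A) y = (\<Sum>x\<in>A. Poly_Mapping.lookup (f x) y)"
  by (induction A rule: infinite_finite_induct) (simp_all add: lookup_add)

lemma lookup_lin:
  "Poly_Mapping.lookup (lin f c) y =
     (\<Sum>x\<in>Poly_Mapping.keys c. scaleQ (Poly_Mapping.lookup c x) (Poly_Mapping.lookup (f x) y))"
  by (simp add: lin_def lookup_sum_poly_mapping lookup_scaleQ)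

lemma keys_lin: "Poly_Mapping.keys (lin f c) \<subseteq> (\<Union>x\<in>Poly_Mapping.keys c. Poly_Mapping.keys (f x))"
proof
  fix y assume "y \<in> Poly_Mapping.keys (lin f c)"
  then have "(\<Sum>x\<in>Poly_Mapping.keys c. scaleQ (Poly_Mapping.lookup c x) (Poly_Mapping.lookup (f x) y)) \<noteq> 0"
    unfolding in_keys_iff lookup_lin .
  then obtain x where "x \<in> Poly_Mapping.keys c"
      "scaleQ (Poly_Mapping.lookup c x) (Poly_Mapping.lookup (f x) y) \<noteq> 0"
    by (rule sum.not_neutral_contains_not_neutral)
  moreover from this(2) have "Poly_Mapping.lookup (f x) y \<noteq> 0" by (metis Q.scale_zero_right)
  ultimately show "y \<in> (\<Union>x\<in>Poly_Mapping.keys c. Poly_Mapping.keys (f x))"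
    by (auto simp: in_keys_iff)
qed

definition supp :: "'a set \<Rightarrow> ('a \<Rightarrow>\<^sub>0 rat) set" where
  "supp T = {c. Poly_Mapping.keys c \<subseteq> T}"

lemma supp_subspace: "Q.subspace (supp T)"
proof (rule Q.subspaceI)
  fix c d :: "'a \<Rightarrow>\<^sub>0 rat" and a
  assume c: "c \<in> supp T" and d: "d \<in> supp T"
  then show "c + d \<in> supp T"
    using Poly_Mapping.keys_add [of c d] by (auto simp: supp_def)
  show "scaleQ a c \<in> supp T" using c by (auto simp: supp_def in_keys_iff lookup_scaleQ)
qed (simp add: supp_def)

lemma supp_mono: "S \<subseteq> T \<Longrightarrow> supp S \<subseteq> supp T"
  by (auto simp: supp_def)

text \<open>Filtration pieces are spans of basis elements; this turns membership in them into a
  condition on keys, which sums and projections respect.\<close>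

lemma span_singles: "Q.span ((\<lambda>x. Poly_Mapping.single x (1::rat)) ` T) = supp T"
proof
  show "Q.span ((\<lambda>x. Poly_Mapping.single x (1::rat)) ` T) \<subseteq> supp T"
  proof (rule Q.span_minimal [OF _ supp_subspace])
    show "(\<lambda>x. Poly_Mapping.single x (1::rat)) ` T \<subseteq> supp T" by (auto simp: supp_def)
  qed
  show "supp T \<subseteq> Q.span ((\<lambda>x. Poly_Mapping.single x (1::rat)) ` T)"
  proof
    fix c assume c: "c \<in> supp T"
    have "c = (\<Sum>x\<in>Poly_Mapping.keys c. scaleQ (Poly_Mapping.lookup c x) (Poly_Mapping.single x 1))"
    proof (rule poly_mapping_eqI)
      fix y
      show "Poly_Mapping.lookup c y = Poly_Mapping.lookup (\<Sum>x\<in>Poly_Mapping.keys c. scaleQ (Poly_Mapping.lookup c x) (Poly_Mapping.single x 1)) y"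
      proof -
        have "(\<Sum>x\<in>Poly_Mapping.keys c. Poly_Mapping.lookup c x * (1 when x = y)) =
            (\<Sum>x\<in>Poly_Mapping.keys c. if x = y then Poly_Mapping.lookup c x else 0)"
          by (rule sum.cong) (auto simp: when_def)
        then show ?thesis
          by (simp add: lookup_sum_poly_mapping lookup_scaleQ lookup_single in_keys_iff)
      qed
    qed
    also have "\<dots> \<in> Q.span ((\<lambda>x. Poly_Mapping.single x (1::rat)) ` T)"
      using c by (intro Q.span_sum Q.span_scale Q.span_base) (auto simp: supp_def)
    finally show "c \<in> Q.span ((\<lambda>x. Poly_Mapping.single x (1::rat)) ` T)" .
  qed
qed

lemma lin_supp:
  assumes "c \<in> supp S" "\<And>x y. x \<in> S \<Longrightarrow> y \<in> Poly_Mapping.keys (f x) \<Longrightarrow> y \<in> T"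
  shows "lin f c \<in> supp T"
proof -
  have "(\<Union>x\<in>Poly_Mapping.keys c. Poly_Mapping.keys (f x)) \<subseteq> T"
    using assms by (auto simp: supp_def)
  then show ?thesis using keys_lin [of f c] by (simp add: supp_def)
qed

lemma lin_eq_0:
  assumes "c \<in> supp S" "\<And>x. x \<in> S \<Longrightarrow> f x = 0"
  shows "lin f c = 0"
  using assms unfolding lin_def supp_def by (intro sum.neutral) auto

text \<open>All pieces are subspaces of one ambient space, and \<open>D\<close> acts on all of it;
  hence \<open>D_D\<close> is asked only on the pieces. The filtration in \<open>p\<close> is
  bounded: zero up to \<open>lo\<close> and constant from \<open>hi\<close> on, uniformly in the
  other degrees.\<close>

locale filtered_complex =
  fixes D :: "'v::rat_vector \<Rightarrow> 'v" and F :: "int \<Rightarrow> int \<Rightarrow> int \<Rightarrow> int \<Rightarrow> 'v set" and lo hi :: int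
  assumes linear_D: "Vector_Spaces.linear scaleQ scaleQ D"
    and subspace_F: "Q.subspace (F p h q k)"
    and F_mono: "p \<le> p' \<Longrightarrow> F p h q k \<subseteq> F p' h q k"
    and D_F: "c \<in> F p h q k \<Longrightarrow> D c \<in> F p (h + 1) q k"
    and D_D: "c \<in> F p h q k \<Longrightarrow> D (D c) = 0"
    and F_lo: "p \<le> lo \<Longrightarrow> F p h q k = {0}"
    and F_hi: "hi \<le> p \<Longrightarrow> F p h q k = F hi h q k"
begin

lemma D_add: "D (x + y) = D x + D y" and D_scale: "D (scaleQ a x) = scaleQ a (D x)"
  using linear_D unfolding Vector_Spaces.linear_iff by auto

lemma D_diff: "D (x - y) = D x - D y" and D_0: "D 0 = 0"
  using D_add [of "x - y" y] D_add [of 0 0] by auto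

text \<open>The approximate cycles of the classical construction. The index is an integer, so that
  \<open>s - 1\<close> is never truncated.\<close>

definition Z :: "int \<Rightarrow> int \<Rightarrow> int \<Rightarrow> int \<Rightarrow> int \<Rightarrow> 'v set" where
  "Z s p h q k = {c \<in> F p h q k. D c \<in> F (p - s) (h + 1) q k}"

text \<open>The classical denominator of a page: approximate cycles of smaller filtration, and
  boundaries that have come down by at least \<open>s - 1\<close> steps, from
  \<open>p + s - 1\<close> to \<open>p\<close>.\<close>

definition Bd :: "int \<Rightarrow> int \<Rightarrow> int \<Rightarrow> int \<Rightarrow> int \<Rightarrow> 'v set" where
  "Bd s p h q k = {z + w |z w. z \<in> Z (s - 1) (p - 1) h q k \<and> w \<in> D ` Z (s - 1) (p + s - 1) (h - 1) q k}"

definition page :: "nat \<Rightarrow> int \<Rightarrow> int \<Rightarrow> int \<Rightarrow> int \<Rightarrow> 'v subquo" where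
  "page r p h q k = (Z (int r) p h q k, Bd (int r) p h q k)"

lemma subspace_Z: "Q.subspace (Z s p h q k)"
proof (rule Q.subspaceI)
  show "0 \<in> Z s p h q k" using Q.subspace_0 [OF subspace_F] by (simp add: Z_def D_0)
  fix x y a assume "x \<in> Z s p h q k" "y \<in> Z s p h q k"
  then show "x + y \<in> Z s p h q k" "scaleQ a x \<in> Z s p h q k"
    by (simp_all add: Z_def D_add D_scale Q.subspace_add [OF subspace_F] Q.subspace_scale [OF subspace_F])
qed

lemma subspace_D_image:
  assumes "Q.subspace V" shows "Q.subspace (D ` V)"
proof (rule Q.subspaceI)
  show "0 \<in> D ` V" using Q.subspace_0 [OF assms] D_0 by (metis imageI)
  fix x y a assume "x \<in> D ` V" "y \<in> D ` V"
  then obtain v w where "v \<in> V" "w \<in> V" "x = D v" "y = D w" by blast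
  then show "x + y \<in> D ` V" "scaleQ a x \<in> D ` V"
    using Q.subspace_add [OF assms] Q.subspace_scale [OF assms] by (auto simp flip: D_add D_scale)
qed

lemma subspace_Bd: "Q.subspace (Bd s p h q k)"
  unfolding Bd_def by (intro Q.subspace_sums subspace_Z subspace_D_image)

text \<open>\<open>D c\<close> is an honest cycle, so it is an approximate cycle to every order
  \<open>t\<close>.\<close>

lemma D_Z: "c \<in> Z s p h q k \<Longrightarrow> D c \<in> Z t (p - s) (h + 1) q k"
  using Q.subspace_0 [OF subspace_F] D_D [of c p h q k] by (simp add: Z_def)

lemma Z_mono: "s \<le> t \<Longrightarrow> Z t p h q k \<subseteq> Z s p h q k"
  unfolding Z_def using F_mono [of "p - t" "p - s"] by auto

lemma Z_shift: "p \<le> p' \<Longrightarrow> p - s \<le> p' - s' \<Longrightarrow> Z s p h q k \<subseteq> Z s' p' h q k"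
  unfolding Z_def using F_mono [of p p'] F_mono [of "p - s" "p' - s'"] by blast

lemma Bd_subset: "1 \<le> s \<Longrightarrow> Bd s p h q k \<subseteq> Z s p h q k"
proof
  fix x assume s: "1 \<le> s" and "x \<in> Bd s p h q k"
  then obtain z w where x: "x = z + D w" "z \<in> Z (s - 1) (p - 1) h q k" "w \<in> Z (s - 1) (p + s - 1) (h - 1) q k"
    unfolding Bd_def by blast
  have "z \<in> Z s p h q k" using x(2) Z_shift [of "p - 1" p "s - 1" s h q k] by auto
  moreover have "D w \<in> Z s p h q k" using D_Z [OF x(3), of s] by (simp add: algebra_simps)
  ultimately show "x \<in> Z s p h q k" unfolding x(1) by (rule Q.subspace_add [OF subspace_Z])
qed

lemma Z_subset_Bd: "Z (s - 1) (p - 1) h q k \<subseteq> Bd s p h q k"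
proof
  fix z assume "z \<in> Z (s - 1) (p - 1) h q k"
  moreover have "0 \<in> D ` Z (s - 1) (p + s - 1) (h - 1) q k"
    using Q.subspace_0 [OF subspace_D_image [OF subspace_Z]] .
  ultimately show "z \<in> Bd s p h q k" unfolding Bd_def by (metis (mono_tags, lifting) add_0_right mem_Collect_eq)
qed

lemma D_Z_subset_Bd: "w \<in> Z (s - 1) (p + s - 1) (h - 1) q k \<Longrightarrow> D w \<in> Bd s p h q k"
  using Q.subspace_0 [OF subspace_Z, of "s - 1" "p - 1" h q k]
  unfolding Bd_def by (metis (mono_tags, lifting) add_0 imageI mem_Collect_eq)

lemma subquo_page: "1 \<le> r \<Longrightarrow> subquo (page r p h q k)"
  unfolding subquo_def page_def by (simp add: subspace_Z subspace_Bd Bd_subset)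

text \<open>The second summand is killed by \<open>D\<close>, and the image of the first has the
  shape of the second summand in filtration \<open>p - s\<close>, because
  \<open>p - s + s - 1 = p - 1\<close>.\<close>

lemma D_Bd:
  assumes "x \<in> Bd s p h q k"
  shows "D x \<in> Bd s (p - s) (h + 1) q k"
proof -
  obtain z w where x: "x = z + D w" "z \<in> Z (s - 1) (p - 1) h q k" "w \<in> Z (s - 1) (p + s - 1) (h - 1) q k"
    using assms unfolding Bd_def by blast
  have "D x = D z" using x D_D [of w] by (auto simp: D_add Z_def)
  then show ?thesis
    using D_Z_subset_Bd [of z s "p - s" "h + 1" q k] x(2) by simp
qed

lemma D_page: "induces_map D (page r p h q k) (page r (p - int r) (h + 1) q k)"
  unfolding induces_map_def page_def using linear_D D_Z D_Bd by auto

text \<open>Numerators and denominators on both sides lie in one space, so the identity on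
  representatives induces the isomorphism. For surjectivity, a cycle \<open>y\<close> of the page
  has \<open>D y = z + D w\<close> with \<open>w\<close> in the denominator, and
  \<open>y - w\<close> is a cycle to one more order.\<close>

lemma page_Suc:
  assumes "1 \<le> r"
  shows "isomorphic (page (Suc r) p h q k)
     (homology D D (page r (p + int r) (h - 1) q k) (page r p h q k) (page r (p - int r) (h + 1) q k))"
proof -
  define s where "s = int r"
  have s: "1 \<le> s" using assms by (simp add: s_def)
  define HZ where "HZ = {y \<in> Z s p h q k. D y \<in> Bd s (p - s) (h + 1) q k}"
  define HB where "HB = {x + b |x b. x \<in> D ` Z s (p + s) (h - 1) q k \<and> b \<in> Bd s p h q k}"
  have hom: "homology D D (page r (p + int r) (h - 1) q k) (page r p h q k) (page r (p - int r) (h + 1) q k) = (HZ, HB)"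
    unfolding homology_def page_def HZ_def HB_def s_def by auto
  have subHZ: "Q.subspace HZ"
  proof (rule Q.subspaceI)
    show "0 \<in> HZ" using Q.subspace_0 [OF subspace_Z] Q.subspace_0 [OF subspace_Bd] by (simp add: HZ_def D_0)
    fix x y a assume "x \<in> HZ" "y \<in> HZ"
    then show "x + y \<in> HZ" "scaleQ a x \<in> HZ"
      by (simp_all add: HZ_def D_add D_scale Q.subspace_add [OF subspace_Z] Q.subspace_scale [OF subspace_Z]
        Q.subspace_add [OF subspace_Bd] Q.subspace_scale [OF subspace_Bd])
  qed
  have subHB: "Q.subspace HB"
    unfolding HB_def by (intro Q.subspace_sums subspace_D_image subspace_Z subspace_Bd)
  have 0: "0 \<in> Bd s (p - s) (h + 1) q k" by (rule Q.subspace_0 [OF subspace_Bd])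
  have "HB \<subseteq> HZ"
  proof
    fix y assume "y \<in> HB"
    then obtain x b where y: "y = D x + b" "x \<in> Z s (p + s) (h - 1) q k" "b \<in> Bd s p h q k"
      unfolding HB_def by blast
    have "D x \<in> Z s p h q k" using D_Z [OF y(2), of s] by simp
    then have "y \<in> Z s p h q k"
      unfolding y(1) by (rule Q.subspace_add [OF subspace_Z _ subsetD [OF Bd_subset [OF s] y(3)]])
    moreover have "D y = D b" using y D_D [of x] by (auto simp: D_add Z_def)
    ultimately show "y \<in> HZ" using D_Bd [OF y(3)] by (simp add: HZ_def)
  qed
  then have sq: "subquo (HZ, HB)" using subHZ subHB by (simp add: subquo_def)
  have "induces_map (\<lambda>x. x) (page (Suc r) p h q k) (HZ, HB)"
    unfolding induces_map_def
  proof (intro conjI)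
    show "Vector_Spaces.linear scaleQ scaleQ (\<lambda>x::'v. x)" by (rule Q.linear_id [unfolded id_def])
    have "Z (s + 1) p h q k \<subseteq> HZ"
    proof
      fix y assume y: "y \<in> Z (s + 1) p h q k"
      have "D y \<in> Z (s - 1) (p - s - 1) (h + 1) q k"
        using D_Z [OF y, of "s - 1"] by (simp add: algebra_simps)
      then have "D y \<in> Bd s (p - s) (h + 1) q k" using Z_subset_Bd by blast
      then show "y \<in> HZ" using subsetD [OF Z_mono [of s "s + 1"] y] by (simp add: HZ_def)
    qed
    then show "(\<lambda>x. x) ` fst (page (Suc r) p h q k) \<subseteq> fst (HZ, HB)"
      by (simp add: page_def s_def add.commute)
    have "Bd (s + 1) p h q k \<subseteq> HB"
    proof
      fix y assume "y \<in> Bd (s + 1) p h q k"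
      then obtain z w where y: "y = z + D w" "z \<in> Z s (p - 1) h q k" "w \<in> Z s (p + s) (h - 1) q k"
        unfolding Bd_def by auto
      have "z \<in> Bd s p h q k" using y(2) Z_mono [of "s - 1" s] Z_subset_Bd by force
      moreover have "y = D w + z" using y(1) by simp
      ultimately show "y \<in> HB" unfolding HB_def using y(3) by blast
    qed
    then show "(\<lambda>x. x) ` snd (page (Suc r) p h q k) \<subseteq> snd (HZ, HB)"
      by (simp add: page_def s_def add.commute)
  qed
  moreover have "x \<in> snd (page (Suc r) p h q k)" if "x \<in> fst (page (Suc r) p h q k)" "x \<in> HB" for x
  proof -
    note hyp = that
    have xZ: "x \<in> Z (s + 1) p h q k" using that(1) by (simp add: page_def s_def add.commute)
    obtain x' b where x': "x = D x' + b" "x' \<in> Z s (p + s) (h - 1) q k" "b \<in> Bd s p h q k"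
      using hyp(2) unfolding HB_def by blast
    obtain z w where b: "b = z + D w" "z \<in> Z (s - 1) (p - 1) h q k" "w \<in> Z (s - 1) (p + s - 1) (h - 1) q k"
      using x'(3) unfolding Bd_def by blast
    \<comment> \<open>Both \<open>D x'\<close> and \<open>D w\<close> are cycles. As
      \<open>x\<close> is a cycle to order \<open>s + 1\<close>, this puts \<open>D z\<close> into
      filtration \<open>p - s - 1\<close>, one step lower than \<open>z\<close> guarantees by
      itself.\<close>
    have "D z = D x" using x' b D_D [of x'] D_D [of w] by (auto simp: D_add Z_def)
    then have "z \<in> Z s (p - 1) h q k" using xZ b(2) by (simp add: Z_def algebra_simps)
    moreover have "w \<in> Z s (p + s) (h - 1) q k" using b(3) Z_shift [of "p + s - 1" "p + s" "s - 1" s] by auto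
    then have "x' + w \<in> Z s (p + s) (h - 1) q k" using x'(2) by (intro Q.subspace_add [OF subspace_Z])
    ultimately have "z + D (x' + w) \<in> Bd (s + 1) p h q k" unfolding Bd_def by auto
    also have "z + D (x' + w) = x" using x' b by (simp add: D_add algebra_simps)
    finally show ?thesis by (simp add: page_def s_def add.commute)
  qed
  moreover have "\<exists>x\<in>fst (page (Suc r) p h q k). y - x \<in> HB" if "y \<in> HZ" for y
  proof -
    have y: "y \<in> Z s p h q k" "D y \<in> Bd s (p - s) (h + 1) q k" using that by (auto simp: HZ_def)
    obtain z w where zw: "D y = z + D w" "z \<in> Z (s - 1) (p - s - 1) (h + 1) q k" "w \<in> Z (s - 1) (p - 1) h q k"
      using y(2) unfolding Bd_def by auto
    have "w \<in> F p h q k" using zw(3) F_mono [of "p - 1" p] by (auto simp: Z_def)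
    moreover have "D (y - w) = z" using zw by (simp add: D_diff)
    moreover have "z \<in> F (p - (s + 1)) (h + 1) q k" using zw(2) by (simp add: Z_def algebra_simps)
    ultimately have "y - w \<in> Z (s + 1) p h q k"
      using y(1) by (simp add: Z_def Q.subspace_diff [OF subspace_F])
    moreover have "w \<in> HB"
    proof -
      have "w \<in> Bd s p h q k" using zw(3) Z_subset_Bd by blast
      moreover have "0 \<in> D ` Z s (p + s) (h - 1) q k" by (rule Q.subspace_0 [OF subspace_D_image [OF subspace_Z]])
      ultimately show ?thesis unfolding HB_def by (metis (mono_tags, lifting) add_0 mem_Collect_eq)
    qed
    ultimately show ?thesis by (intro bexI [of _ "y - w"]) (simp_all add: page_def s_def add.commute)
  qed
  ultimately show ?thesis
    unfolding hom isomorphic_def using subquo_page [of "Suc r"] sq by (intro conjI exI [of _ "\<lambda>x. x"]) auto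
qed

theorem spectral_sequence_page: "spectral_sequence page (\<lambda>_ _ _ _ _. D)"
  unfolding spectral_sequence_def
proof (intro allI impI conjI)
  fix r :: nat and p h q k :: int assume r: "1 \<le> r"
  show "subquo (page r p h q k)" by (rule subquo_page [OF r])
  show "induces_map D (page r p h q k) (page r (p - int r) (h + 1) q k)" by (rule D_page)
  have "D (D x) \<in> Bd (int r) (p - 2 * int r) (h + 2) q k" if "x \<in> Z (int r) p h q k" for x
    using that D_D [of x p h q k] Q.subspace_0 [OF subspace_Bd] by (simp add: Z_def)
  then show "zero_map (D \<circ> D) (page r p h q k) (page r (p - 2 * int r) (h + 2) q k)"
    by (auto simp: zero_map_def page_def)
  show "isomorphic (page (Suc r) p h q k)
     (homology D D (page r (p + int r) (h - 1) q k) (page r p h q k) (page r (p - int r) (h + 1) q k))"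
    by (rule page_Suc [OF r])
qed

text \<open>Two unrelated reasons: below \<open>lo\<close> the target filtration is zero; above
  \<open>hi\<close> the filtration no longer grows, so \<open>x\<close> already has filtration
  \<open>p - 1\<close> and \<open>D x\<close> is a boundary in the denominator of the
  target.\<close>

lemma D_page_eq_zero:
  assumes "1 \<le> r" "p - int r \<le> lo \<or> hi \<le> p - 1"
  shows "zero_map D (page r p h q k) (page r (p - int r) (h + 1) q k)"
  unfolding zero_map_def page_def
proof (intro image_subsetI; simp)
  fix x assume x: "x \<in> Z (int r) p h q k"
  from assms(2) show "D x \<in> Bd (int r) (p - int r) (h + 1) q k"
  proof
    assume "p - int r \<le> lo"
    then have "D x = 0" using x F_lo [of "p - int r"] by (simp add: Z_def)
    then show ?thesis using Q.subspace_0 [OF subspace_Bd] by simp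
  next
    assume "hi \<le> p - 1"
    then have "F p h q k = F (p - 1) h q k" using F_hi [of p] F_hi [of "p - 1"] by simp
    then have "x \<in> Z (int r - 1) (p - 1) h q k" using x by (simp add: Z_def)
    then show ?thesis using D_Z_subset_Bd [of x "int r" "p - int r" "h + 1"] by simp
  qed
qed

text \<open>\<open>H\<close> is compared with the homology of \<open>D\<close> on the full pieces by
  four conditions on representatives: \<open>cyc\<close> and \<open>bd\<close> make the comparison
  map well defined, \<open>onto\<close> and \<open>inj\<close> make it bijective. This allows a
  limit that is the homology of a different differential on a quotient.\<close>

theorem page_converges:
  fixes H :: "int \<Rightarrow> int \<Rightarrow> int \<Rightarrow> 'v subquo"
  assumes H: "\<And>h q k. subquo (H h q k)"
    and cyc: "\<And>h q k y. y \<in> F hi h q k \<Longrightarrow> D y = 0 \<Longrightarrow> y \<in> fst (H h q k)"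
    and bd: "\<And>h q k w. w \<in> F hi (h - 1) q k \<Longrightarrow> D w \<in> snd (H h q k)"
    and onto: "\<And>h q k y. y \<in> fst (H h q k) \<Longrightarrow> \<exists>c\<in>F hi h q k. D c = 0 \<and> y - c \<in> snd (H h q k)"
    and inj: "\<And>h q k y. y \<in> F hi h q k \<Longrightarrow> D y = 0 \<Longrightarrow> y \<in> snd (H h q k) \<Longrightarrow> y \<in> D ` F hi (h - 1) q k"
  shows "converges_to page (\<lambda>_ _ _ _ _. D) H"
proof -
  define K where "K p h q k = {c \<in> F p h q k. D c = 0}" for p h q k
  have subK: "Q.subspace (K p h q k)" for p h q k
    by (rule Q.subspaceI) (simp_all add: K_def D_0 D_add D_scale Q.subspace_0 [OF subspace_F]
        Q.subspace_add [OF subspace_F] Q.subspace_scale [OF subspace_F])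
  have F_sub: "F p h q k \<subseteq> F hi h q k" for p h q k
    using F_mono [of p hi] F_hi [of p] by (cases "p \<le> hi") auto
  \<comment> \<open>The image in \<open>H\<close> of the cycles of filtration \<open>p\<close>;
    adding the denominator of \<open>H\<close> places it between the two parts of
    \<open>H\<close>.\<close>
  define G where "G p h q k = {y + b |y b. y \<in> K p h q k \<and> b \<in> snd (H h q k)}" for p h q k
  have sub: "Q.subspace (fst (H h q k))" "Q.subspace (snd (H h q k))" "snd (H h q k) \<subseteq> fst (H h q k)" for h q k
    using H [of h q k] by (auto simp: subquo_def)
  have subG: "Q.subspace (G p h q k)" for p h q k
    unfolding G_def by (intro Q.subspace_sums subK sub)
  have snd_G: "snd (H h q k) \<subseteq> G p h q k" for p h q k
  proof
    fix b assume "b \<in> snd (H h q k)"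
    then show "b \<in> G p h q k"
      unfolding G_def using Q.subspace_0 [OF subK] by (metis (mono_tags, lifting) add_0 mem_Collect_eq)
  qed
  have K_G: "K p h q k \<subseteq> G p h q k" for p h q k
  proof
    fix y assume "y \<in> K p h q k"
    then show "y \<in> G p h q k"
      unfolding G_def using Q.subspace_0 [OF sub(2)] by (metis (mono_tags, lifting) add_0_right mem_Collect_eq)
  qed
  have G_fst: "G p h q k \<subseteq> fst (H h q k)" for p h q k
  proof
    fix x assume "x \<in> G p h q k"
    then obtain y b where x: "x = y + b" "y \<in> K p h q k" "b \<in> snd (H h q k)" unfolding G_def by blast
    have "y \<in> fst (H h q k)" using x(2) by (auto intro: cyc [OF subsetD [OF F_sub]] simp: K_def)
    then show "x \<in> fst (H h q k)" unfolding x(1) using x(3) sub(3) by (intro Q.subspace_add [OF sub(1)]) auto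
  qed
  have G_mono: "G p h q k \<subseteq> G (p + 1) h q k" for p h q k
    unfolding G_def K_def using F_mono [of p "p + 1" h q k] by auto
  have "finite_filtration G H"
    unfolding finite_filtration_def
  proof (intro conjI allI exI)
    show "G lo h q k = snd (H h q k)" for h q k
      using snd_G F_lo [of lo h q k] by (auto simp: G_def K_def D_0)
    show "G hi h q k = fst (H h q k)" for h q k
    proof
      show "fst (H h q k) \<subseteq> G hi h q k"
      proof
        fix y assume "y \<in> fst (H h q k)"
        then obtain c where "c \<in> F hi h q k" "D c = 0" "y - c \<in> snd (H h q k)" using onto by blast
        then have "c + (y - c) \<in> G hi h q k" unfolding G_def K_def by blast
        then show "y \<in> G hi h q k" by simp
      qed
    qed (rule G_fst)
  qed (use subG snd_G G_fst G_mono in auto)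
  moreover have "\<exists>R\<ge>1. stable_from page (\<lambda>_ _ _ _ _. D) R p h q k \<and>
      isomorphic (page R p h q k) (G p h q k, G (p - 1) h q k)" for p h q k
  proof -
    \<comment> \<open>Chosen so that \<open>p - R\<close> is at most \<open>lo\<close> and
      \<open>p + R - 1\<close> at least \<open>hi\<close>: from then on nothing leaves or reaches
      degree \<open>p\<close>, approximate cycles are cycles, and boundaries come from the whole
      complex.\<close>
    define R where "R = nat (\<bar>p - lo\<bar> + \<bar>hi - p\<bar> + 1)"
    have R: "1 \<le> R" "p - int R \<le> lo" "hi \<le> p + int R - 1" by (auto simp: R_def)
    have "stable_from page (\<lambda>_ _ _ _ _. D) R p h q k"
      unfolding stable_from_def
    proof (intro allI impI conjI)
      fix r assume r: "R \<le> r"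
      show "zero_map D (page r p h q k) (page r (p - int r) (h + 1) q k)"
        using R r by (intro D_page_eq_zero) auto
      show "zero_map D (page r (p + int r) (h - 1) q k) (page r p h q k)"
        using D_page_eq_zero [of r "p + int r" "h - 1" q k] R r by auto
    qed
    moreover have "isomorphic (page R p h q k) (G p h q k, G (p - 1) h q k)"
    proof -
      have Z: "Z (int R) p h q k = K p h q k"
        using F_lo [OF R(2)] by (auto simp: Z_def K_def)
      have Z1: "Z (int R - 1) (p - 1) h q k = K (p - 1) h q k"
        using F_lo [OF R(2)] by (auto simp: Z_def K_def)
      have Z2: "Z (int R - 1) (p + int R - 1) (h - 1) q k = {w \<in> F hi (h - 1) q k. D w \<in> F p h q k}"
        using F_hi [OF R(3)] by (simp add: Z_def)
      have G1: "G (p - 1) h q k \<subseteq> G p h q k" using G_mono [of "p - 1"] by simp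
      have "induces_map (\<lambda>x. x) (page R p h q k) (G p h q k, G (p - 1) h q k)"
        unfolding induces_map_def
      proof (intro conjI)
        show "Vector_Spaces.linear scaleQ scaleQ (\<lambda>x::'v. x)" by (rule Q.linear_id [unfolded id_def])
        show "(\<lambda>x. x) ` fst (page R p h q k) \<subseteq> fst (G p h q k, G (p - 1) h q k)"
          using K_G by (simp add: page_def Z)
        have "Bd (int R) p h q k \<subseteq> G (p - 1) h q k"
          unfolding Bd_def Z1 Z2 G_def using bd by blast
        then show "(\<lambda>x. x) ` snd (page R p h q k) \<subseteq> snd (G p h q k, G (p - 1) h q k)"
          by (simp add: page_def)
      qed
      moreover have "x \<in> snd (page R p h q k)" if "x \<in> fst (page R p h q k)" "x \<in> G (p - 1) h q k" for x
      proof -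
        note hyp = that
        have x: "x \<in> F p h q k" "D x = 0" using that(1) by (auto simp: page_def Z K_def)
        obtain y b where y: "x = y + b" "y \<in> F (p - 1) h q k" "D y = 0" "b \<in> snd (H h q k)"
          using hyp(2) unfolding G_def K_def by blast
        \<comment> \<open>The part \<open>b\<close> is a cycle that vanishes in \<open>H\<close>, so
          \<open>inj\<close> makes it a boundary; being of filtration \<open>p\<close>, it lies in
          the denominator of the page.\<close>
        have "D b = 0" using x(2) y by (simp add: D_add)
        have "y \<in> F p h q k" using y(2) F_mono [of "p - 1" p] by auto
        then have "x - y \<in> F p h q k" using x(1) by (intro Q.subspace_diff [OF subspace_F])
        then have b: "b \<in> F p h q k" using y(1) by simp
        then obtain w where w: "w \<in> F hi (h - 1) q k" "b = D w" using inj [of b] \<open>D b = 0\<close> y(4) F_sub by blast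
        then show ?thesis
          unfolding page_def snd_conv Bd_def Z1 Z2 using y b by (auto simp: K_def)
      qed
      moreover have "\<exists>x\<in>fst (page R p h q k). y - x \<in> G (p - 1) h q k" if "y \<in> G p h q k" for y
      proof -
        note hyp = that
        obtain c b where "y = c + b" "c \<in> K p h q k" "b \<in> snd (H h q k)" using hyp unfolding G_def by blast
        then show ?thesis using subsetD [OF snd_G [of h q k "p - 1"]] by (intro bexI [of _ c]) (auto simp: page_def Z)
      qed
      ultimately show ?thesis
        unfolding isomorphic_def using subquo_page [OF R(1)] subG G1
        by (intro conjI exI [of _ "\<lambda>x. x"]) (auto simp: subquo_def)
    qed
    ultimately show ?thesis using R(1) by blast
  qed
  ultimately show ?thesis unfolding converges_to_def by blast
qed

end


section \<open>Two compatible gradings on one based complex\<close>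

definition res :: "('a \<Rightarrow> bool) \<Rightarrow> ('a \<Rightarrow>\<^sub>0 rat) \<Rightarrow> 'a \<Rightarrow>\<^sub>0 rat" where
  "res Q = lin (\<lambda>y. if Q y then Poly_Mapping.single y 1 else 0)"

lemma lookup_res: "Poly_Mapping.lookup (res Q c) y = (if Q y then Poly_Mapping.lookup c y else 0)"
proof -
  have "Poly_Mapping.lookup (res Q c) y =
      (\<Sum>x\<in>Poly_Mapping.keys c. if x = y then (if Q y then Poly_Mapping.lookup c y else 0) else 0)"
    unfolding res_def lookup_lin by (rule sum.cong) (auto simp: lookup_single when_def)
  then show ?thesis by (simp add: in_keys_iff)
qed

lemma keys_res: "Poly_Mapping.keys (res Q c) = {y \<in> Poly_Mapping.keys c. Q y}"
  by (auto simp: in_keys_iff lookup_res split: if_splits)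

lemma res_supp: "c \<in> supp S \<Longrightarrow> res Q c \<in> supp {y \<in> S. Q y}"
  by (auto simp: supp_def keys_res)

lemma res_add: "res Q (c + d) = res Q c + res Q d" and res_diff: "res Q (c - d) = res Q c - res Q d"
  by (simp_all add: res_def lin_add lin_diff)

lemma res_id: "c \<in> supp S \<Longrightarrow> (\<And>y. y \<in> S \<Longrightarrow> Q y) \<Longrightarrow> res Q c = c"
  by (rule poly_mapping_eqI) (auto simp: lookup_res supp_def in_keys_iff)

lemma res_0: "c \<in> supp S \<Longrightarrow> (\<And>y. y \<in> S \<Longrightarrow> \<not> Q y) \<Longrightarrow> res Q c = 0"
  by (rule poly_mapping_eqI) (auto simp: lookup_res supp_def in_keys_iff)

lemma sum_res:
  assumes "finite A" "\<And>y. y \<in> Poly_Mapping.keys c \<Longrightarrow> g y \<in> A"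
  shows "(\<Sum>k\<in>A. res (\<lambda>y. g y = k) c) = c"
proof (rule poly_mapping_eqI)
  fix y
  have "Poly_Mapping.lookup (\<Sum>k\<in>A. res (\<lambda>y. g y = k) c) y =
      (\<Sum>k\<in>A. if g y = k then Poly_Mapping.lookup c y else 0)"
    by (simp add: lookup_sum_poly_mapping lookup_res)
  also have "\<dots> = Poly_Mapping.lookup c y"
    using assms by (auto simp: in_keys_iff)
  finally show "Poly_Mapping.lookup (\<Sum>k\<in>A. res (\<lambda>y. g y = k) c) y = Poly_Mapping.lookup c y" .
qed

lemma homology_alt:
  "homology d d' X Y W = ({y \<in> fst Y. d' y \<in> snd W}, {x + b |x b. x \<in> d ` fst X \<and> b \<in> snd Y})"
  unfolding homology_def by auto

text \<open>\<open>bs\<close> gives the boundary of basis elements; \<open>g\<close> is the grading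
  for the limit and \<open>p\<close> the one for the first page. The implication at the end of the
  assumption \<open>bs\<close> is the link between them.\<close>

locale bifiltered_complex =
  fixes St :: "'a set" and bs :: "'a \<Rightarrow> 'a \<Rightarrow>\<^sub>0 rat" and hd qd g p :: "'a \<Rightarrow> int"
  assumes finite_St: "finite St"
    and bs: "\<And>x y. x \<in> St \<Longrightarrow> y \<in> Poly_Mapping.keys (bs x) \<Longrightarrow>
      y \<in> St \<and> hd y = hd x + 1 \<and> qd y = qd x \<and> g y \<le> g x \<and> p y \<le> p x \<and> (p y = p x \<longrightarrow> g y = g x)"
    and lin_bs: "\<And>x. x \<in> St \<Longrightarrow> lin bs (bs x) = 0"
begin

abbreviation "bdry \<equiv> lin bs"

text \<open>The basis elements split the filtration by \<open>g\<close>, so the differential induced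
  on the graded complex of \<open>g\<close> can be realised on chains, without quotients.\<close>

definition D :: "('a \<Rightarrow>\<^sub>0 rat) \<Rightarrow> 'a \<Rightarrow>\<^sub>0 rat" where
  "D = lin (\<lambda>x. res (\<lambda>y. g y = g x) (bs x))"

text \<open>The predicate covers exact values of \<open>g\<close>, weak and strict bounds on either
  grading, and their combinations.\<close>

definition T :: "int \<Rightarrow> int \<Rightarrow> ('a \<Rightarrow> bool) \<Rightarrow> 'a set" where
  "T h q P = {x \<in> St. hd x = h \<and> qd x = q \<and> P x}"

text \<open>Exact in \<open>g\<close> and bounded in \<open>p\<close>: the filtration by
  \<open>p\<close> of the part of degree \<open>k\<close> of the graded complex for
  \<open>g\<close>.\<close>

definition F :: "int \<Rightarrow> int \<Rightarrow> int \<Rightarrow> int \<Rightarrow> ('a \<Rightarrow>\<^sub>0 rat) set" where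
  "F a h q k = supp (T h q (\<lambda>x. g x = k \<and> p x \<le> a))"

text \<open>Any common bound for the absolute values of \<open>p\<close> serves; the sum is also
  defined when there are no states.\<close>

definition M :: int where "M = (\<Sum>x\<in>St. \<bar>p x\<bar>)"

text \<open>The homology of the associated graded complex, with spans replaced by supports; for an
  integer grading the pieces below \<open>a\<close> add up to the chains with
  \<open>deg x < a\<close>.\<close>

definition GH :: "('a \<Rightarrow> int) \<Rightarrow> int \<Rightarrow> int \<Rightarrow> int \<Rightarrow> ('a \<Rightarrow>\<^sub>0 rat) subquo" where
  "GH deg h q a = homology bdry bdry
    (supp (T (h - 1) q (\<lambda>x. deg x \<le> a)), supp (T (h - 1) q (\<lambda>x. deg x < a)))
    (supp (T h q (\<lambda>x. deg x \<le> a)), supp (T h q (\<lambda>x. deg x < a)))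
    (supp (T (h + 1) q (\<lambda>x. deg x \<le> a)), supp (T (h + 1) q (\<lambda>x. deg x < a)))"

lemma M: "x \<in> St \<Longrightarrow> \<bar>p x\<bar> \<le> M"
  unfolding M_def using finite_St by (intro member_le_sum) auto

lemma T_mono: "(\<And>x. P x \<Longrightarrow> Q x) \<Longrightarrow> supp (T h q P) \<subseteq> supp (T h q Q)"
  by (rule supp_mono) (auto simp: T_def)

lemma boundary_supp:
  assumes "c \<in> supp (T h q P)"
    and "\<And>x y. x \<in> St \<Longrightarrow> P x \<Longrightarrow> g y \<le> g x \<Longrightarrow> p y \<le> p x \<Longrightarrow> (p y = p x \<Longrightarrow> g y = g x) \<Longrightarrow> Q y"
  shows "bdry c \<in> supp (T (h + 1) q Q)"
  using assms(1)
proof (rule lin_supp)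
  fix x y assume "x \<in> T h q P" "y \<in> Poly_Mapping.keys (bs x)"
  then show "y \<in> T (h + 1) q Q" using bs [of x y] assms(2) [of x y] by (auto simp: T_def)
qed

lemma boundary_boundary: "c \<in> supp (T h q P) \<Longrightarrow> bdry (bdry c) = 0"
  unfolding lin_lin by (rule lin_eq_0) (auto simp: T_def lin_bs)

lemma D_supp:
  assumes "c \<in> supp (T h q P)"
    and "\<And>x y. x \<in> St \<Longrightarrow> P x \<Longrightarrow> g y = g x \<Longrightarrow> p y \<le> p x \<Longrightarrow> Q y"
  shows "D c \<in> supp (T (h + 1) q Q)"
  unfolding D_def using assms(1)
proof (rule lin_supp)
  fix x y assume "x \<in> T h q P" "y \<in> Poly_Mapping.keys (res (\<lambda>y. g y = g x) (bs x))"
  then show "y \<in> T (h + 1) q Q" using bs [of x y] assms(2) [of x y] by (auto simp: T_def keys_res)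
qed

text \<open>A term of the boundary that lowers \<open>g\<close> cannot preserve \<open>p\<close>, so
  it lowers both. Hence \<open>bdry\<close> and \<open>D\<close> agree on the associated graded
  complexes of both gradings.\<close>

lemma boundary_diff_D:
  assumes "c \<in> supp (T h q P)"
    and "\<And>x y. x \<in> St \<Longrightarrow> P x \<Longrightarrow> g y < g x \<Longrightarrow> p y < p x \<Longrightarrow> Q y"
  shows "bdry c - D c \<in> supp (T (h + 1) q Q)"
proof -
  have "bdry c - D c = lin (\<lambda>x. bs x - res (\<lambda>y. g y = g x) (bs x)) c"
    by (simp add: D_def lin_def Q.scale_right_diff_distrib sum_subtractf)
  also have "\<dots> \<in> supp (T (h + 1) q Q)" using assms(1)
  proof (rule lin_supp)
    fix x y assume "x \<in> T h q P" "y \<in> Poly_Mapping.keys (bs x - res (\<lambda>y. g y = g x) (bs x))"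
    then have x: "x \<in> St" "P x" "hd x = h" "qd x = q" and y: "y \<in> Poly_Mapping.keys (bs x)" "g y \<noteq> g x"
      by (auto simp: T_def in_keys_iff lookup_minus lookup_res split: if_splits)
    have "g y < g x" "p y < p x" using bs [OF x(1) y(1)] y(2) by auto
    then show "y \<in> T (h + 1) q Q" using bs [OF x(1) y(1)] assms(2) [of x y] x by (auto simp: T_def)
  qed
  finally show ?thesis .
qed

lemma res_D: "res (\<lambda>y. g y = k) (D c) = D (res (\<lambda>y. g y = k) c)"
proof -
  let ?r = "\<lambda>y. if g y = k then Poly_Mapping.single y (1::rat) else 0"
  have "lin ?r (D c) = lin (\<lambda>x. D (?r x)) c"
    unfolding D_def lin_lin
  proof (rule lin_cong)
    fix x
    have "res (\<lambda>y. g y = k) (res (\<lambda>y. g y = g x) (bs x)) = (if g x = k then res (\<lambda>y. g y = g x) (bs x) else 0)"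
      by (rule poly_mapping_eqI) (simp add: lookup_res)
    then show "lin ?r (res (\<lambda>y. g y = g x) (bs x)) = lin (\<lambda>x. res (\<lambda>y. g y = g x) (bs x)) (?r x)"
      by (simp add: res_def [of "\<lambda>y. g y = k"])
  qed
  then show ?thesis by (simp add: res_def D_def lin_lin)
qed

text \<open>Compare leading terms: on chains of exact degree \<open>k\<close> in \<open>g\<close>,
  \<open>bdry\<close> differs from \<open>D\<close> by terms of degree below \<open>k\<close>, so
  the part of degree \<open>k\<close> of \<open>bdry (bdry c) = 0\<close> is \<open>D (D c)\<close>.
  General chains are sums of homogeneous ones.\<close>

lemma D_D: "c \<in> supp (T h q P) \<Longrightarrow> D (D c) = 0"
proof -
  have one: "D (D c) = 0" if c: "c \<in> supp (T h q (\<lambda>x. g x = k))" for c k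
  proof -
    let ?r = "res (\<lambda>y. g y = k)"
    have Dc: "D c \<in> supp (T (h + 1) q (\<lambda>x. g x = k))" using c by (rule D_supp) simp
    have DDc: "D (D c) \<in> supp (T (h + 1 + 1) q (\<lambda>x. g x = k))" using Dc by (rule D_supp) simp
    have l1: "bdry (D c) - D (D c) \<in> supp (T (h + 1 + 1) q (\<lambda>x. g x < k))" using Dc by (rule boundary_diff_D) simp
    have "bdry c - D c \<in> supp (T (h + 1) q (\<lambda>x. g x < k))" using c by (rule boundary_diff_D) simp
    then have l2: "bdry (bdry c - D c) \<in> supp (T (h + 1 + 1) q (\<lambda>x. g x < k))" by (rule boundary_supp) simp
    have "D (D c) = ?r (D (D c))" using res_id [OF DDc] by (simp add: T_def)
    also have "\<dots> = ?r (bdry (D c)) - ?r (bdry (D c) - D (D c))" by (simp add: res_diff)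
    also have "?r (bdry (D c) - D (D c)) = 0" using res_0 [OF l1] by (simp add: T_def)
    also have "?r (bdry (D c)) = ?r (bdry (bdry c)) - ?r (bdry (bdry c - D c))" by (simp add: lin_diff res_diff)
    also have "?r (bdry (bdry c - D c)) = 0" using res_0 [OF l2] by (simp add: T_def)
    also have "bdry (bdry c) = 0" by (rule boundary_boundary [OF c])
    finally show ?thesis by (simp add: res_def)
  qed
  assume c: "c \<in> supp (T h q P)"
  let ?A = "g ` St"
  have fin: "finite ?A" using finite_St by simp
  have "(\<Sum>k\<in>?A. res (\<lambda>y. g y = k) c) = c"
    by (rule sum_res [OF fin]) (use c in \<open>auto simp: supp_def T_def\<close>)
  moreover have "D (D (\<Sum>k\<in>?A. res (\<lambda>y. g y = k) c)) = (\<Sum>k\<in>?A. D (D (res (\<lambda>y. g y = k) c)))"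
    by (simp add: D_def lin_sum)
  ultimately have "D (D c) = (\<Sum>k\<in>?A. D (D (res (\<lambda>y. g y = k) c)))" by simp
  also have "\<dots> = 0"
  proof (rule sum.neutral, rule ballI)
    fix k
    have "res (\<lambda>y. g y = k) c \<in> supp (T h q (\<lambda>x. g x = k))"
      using res_supp [OF c, of "\<lambda>y. g y = k"] by (rule subsetD [OF supp_mono, rotated]) (auto simp: T_def)
    then show "D (D (res (\<lambda>y. g y = k) c)) = 0" by (rule one)
  qed
  finally show ?thesis .
qed

text \<open>All values of \<open>p\<close> lie between \<open>- M\<close> and \<open>M\<close>, so
  the piece at \<open>- M - 1\<close> has no basis elements and the filtration is exhausted at
  \<open>M\<close>.\<close>

lemma filtered_complex: "filtered_complex D F (- M - 1) M"
proof (rule filtered_complex.intro)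
  fix a h q k
  show "Vector_Spaces.linear scaleQ scaleQ D" unfolding D_def by (rule linear_lin)
  show "Q.subspace (F a h q k)" unfolding F_def by (rule supp_subspace)
  fix c
  show "c \<in> F a h q k \<Longrightarrow> D c \<in> F a (h + 1) q k"
    unfolding F_def by (erule D_supp) auto
  show "c \<in> F a h q k \<Longrightarrow> D (D c) = 0" unfolding F_def by (rule D_D)
next
  fix a a' h q k :: int assume "a \<le> a'"
  then show "F a h q k \<subseteq> F a' h q k" unfolding F_def by (intro T_mono) auto
next
  fix a h q k :: int assume "a \<le> - M - 1"
  then have "T h q (\<lambda>x. g x = k \<and> p x \<le> a) = {}" using M by (force simp: T_def)
  then show "F a h q k = {0}" by (auto simp: F_def supp_def)
next
  fix a h q k :: int assume "M \<le> a"
  then have "T h q (\<lambda>x. g x = k \<and> p x \<le> a) = T h q (\<lambda>x. g x = k \<and> p x \<le> M)" using M by (force simp: T_def)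
  then show "F a h q k = F M h q k" by (simp add: F_def)
qed

sublocale FC: filtered_complex D F "- M - 1" M
  by (rule filtered_complex)

lemma subquo_GH:
  assumes "\<And>x y. x \<in> St \<Longrightarrow> y \<in> Poly_Mapping.keys (bs x) \<Longrightarrow> deg y \<le> deg x"
  shows "subquo (GH deg h q a)"
proof -
  have bd: "bdry c \<in> supp (T (h + 1) q (\<lambda>x. deg x < a))" if "c \<in> supp (T h q (\<lambda>x. deg x < a))" for c h
    using that
  proof (rule lin_supp)
    fix x y assume "x \<in> T h q (\<lambda>x. deg x < a)" "y \<in> Poly_Mapping.keys (bs x)"
    then show "y \<in> T (h + 1) q (\<lambda>x. deg x < a)" using bs [of x y] assms [of x y] by (auto simp: T_def)
  qed
  have bd': "bdry c \<in> supp (T (h + 1) q (\<lambda>x. deg x \<le> a))" if "c \<in> supp (T h q (\<lambda>x. deg x \<le> a))" for c h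
    using that
  proof (rule lin_supp)
    fix x y assume "x \<in> T h q (\<lambda>x. deg x \<le> a)" "y \<in> Poly_Mapping.keys (bs x)"
    then show "y \<in> T (h + 1) q (\<lambda>x. deg x \<le> a)" using bs [of x y] assms [of x y] by (auto simp: T_def)
  qed
  let ?Z = "fst (GH deg h q a)" and ?B = "snd (GH deg h q a)"
  have Z: "?Z = {y \<in> supp (T h q (\<lambda>x. deg x \<le> a)). bdry y \<in> supp (T (h + 1) q (\<lambda>x. deg x < a))}"
    and B: "?B = {x + b |x b. x \<in> bdry ` supp (T (h - 1) q (\<lambda>x. deg x \<le> a)) \<and> b \<in> supp (T h q (\<lambda>x. deg x < a))}"
    by (simp_all add: GH_def homology_alt)
  have "Q.subspace ?Z"
    unfolding Z
    by (rule Q.subspaceI) (simp_all add: lin_add lin_scaleQ Q.subspace_0 [OF supp_subspace]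
        Q.subspace_add [OF supp_subspace] Q.subspace_scale [OF supp_subspace])
  moreover have im: "Q.subspace (bdry ` supp S)" for S
  proof (rule Q.subspaceI)
    show "0 \<in> bdry ` supp S" using Q.subspace_0 [OF supp_subspace] lin_0 by (metis imageI)
    fix x y c assume "x \<in> bdry ` supp S" "y \<in> bdry ` supp S"
    then obtain v w where "v \<in> supp S" "w \<in> supp S" "x = bdry v" "y = bdry w" by blast
    moreover from this have "x + y = bdry (v + w)" "scaleQ c x = bdry (scaleQ c v)"
      by (simp_all add: lin_add lin_scaleQ)
    ultimately show "x + y \<in> bdry ` supp S" "scaleQ c x \<in> bdry ` supp S"
      using Q.subspace_add [OF supp_subspace, of v S w] Q.subspace_scale [OF supp_subspace, of v S c] by auto
  qed
  then have "Q.subspace ?B" unfolding B by (intro Q.subspace_sums supp_subspace)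
  moreover have "?B \<subseteq> ?Z"
  proof
    fix y assume "y \<in> ?B"
    then obtain x b where y: "y = bdry x + b" "x \<in> supp (T (h - 1) q (\<lambda>x. deg x \<le> a))" "b \<in> supp (T h q (\<lambda>x. deg x < a))"
      unfolding B by blast
    have "b \<in> supp (T h q (\<lambda>x. deg x \<le> a))" using y(3) by (rule subsetD [OF T_mono, rotated]) simp
    moreover have "bdry x \<in> supp (T h q (\<lambda>x. deg x \<le> a))" using bd' [OF y(2)] by simp
    moreover have "bdry y = bdry b" using boundary_boundary [OF y(2)] y(1) by (simp add: lin_add)
    ultimately show "y \<in> ?Z" unfolding Z using bd [OF y(3)] y(1) by (simp add: Q.subspace_add [OF supp_subspace])
  qed
  ultimately show ?thesis by (simp add: subquo_def)
qed

lemma GH_sndI: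
  assumes "x \<in> supp (T (h - 1) q (\<lambda>x. deg x \<le> a))" "b \<in> supp (T h q (\<lambda>x. deg x < a))"
  shows "bdry x + b \<in> snd (GH deg h q a)"
  using assms unfolding GH_def homology_alt by auto

lemma supp_lt_subset_GH_snd: "supp (T h q (\<lambda>x. deg x < a)) \<subseteq> snd (GH deg h q a)"
  using GH_sndI [of 0] by (auto simp: supp_def)

text \<open>A chain of exact degree \<open>k\<close> represents itself in the graded complex of
  \<open>g\<close>; in the other direction, a representative with \<open>g \<le> k\<close> is
  replaced by its part of degree \<open>k\<close>, which changes it only by terms in the
  denominator.\<close>

theorem converges: "converges_to FC.page (\<lambda>_ _ _ _ _. D) (GH g)"
proof (rule FC.page_converges)
  have FM: "F M h q k = supp (T h q (\<lambda>x. g x = k))" for h q k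
  proof -
    have "T h q (\<lambda>x. g x = k \<and> p x \<le> M) = T h q (\<lambda>x. g x = k)" using M by (force simp: T_def)
    then show ?thesis by (simp add: F_def)
  qed
  have eq_le: "supp (T h q (\<lambda>x. g x = k)) \<subseteq> supp (T h q (\<lambda>x. g x \<le> k))" for h q k
    by (rule T_mono) simp
  fix h q k
  show "subquo (GH g h q k)" by (rule subquo_GH) (use bs in blast)
  show "y \<in> fst (GH g h q k)" if "y \<in> F M h q k" "D y = 0" for y
  proof -
    have y: "y \<in> supp (T h q (\<lambda>x. g x = k))" using that FM by simp
    then have "bdry y - D y \<in> supp (T (h + 1) q (\<lambda>x. g x < k))" by (rule boundary_diff_D) simp
    then show ?thesis using that(2) y eq_le by (auto simp: GH_def homology_alt)
  qed
  show "D w \<in> snd (GH g h q k)" if "w \<in> F M (h - 1) q k" for w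
  proof -
    have w: "w \<in> supp (T (h - 1) q (\<lambda>x. g x = k))" using that FM by simp
    then have "bdry w - D w \<in> supp (T (h - 1 + 1) q (\<lambda>x. g x < k))" by (rule boundary_diff_D) simp
    from Q.subspace_neg [OF supp_subspace this] have "- (bdry w - D w) \<in> supp (T h q (\<lambda>x. g x < k))"
      by (simp only: diff_add_cancel)
    then have "bdry w + - (bdry w - D w) \<in> snd (GH g h q k)"
      using w eq_le by (intro GH_sndI) auto
    then show ?thesis by simp
  qed
  let ?r = "res (\<lambda>y. g y = k)"
  have r: "?r c \<in> supp (T h q (\<lambda>x. g x = k))" if "c \<in> supp (T h q P)" for c h P
    using res_supp [OF that, of "\<lambda>y. g y = k"] by (rule subsetD [OF supp_mono, rotated]) (auto simp: T_def)
  \<comment> \<open>In top degree \<open>k\<close> the boundary is computed by \<open>D\<close>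
    alone.\<close>
  have rD: "?r (bdry c) = D (?r c)" if "c \<in> supp (T h q (\<lambda>x. g x \<le> k))" for c h
  proof -
    have "bdry c - D c \<in> supp (T (h + 1) q (\<lambda>x. g x < k))" using that by (rule boundary_diff_D) simp
    then have "?r (bdry c - D c) = 0" by (rule res_0) (simp add: T_def)
    then show ?thesis by (simp add: res_diff res_D)
  qed
  show "\<exists>c\<in>F M h q k. D c = 0 \<and> y - c \<in> snd (GH g h q k)" if "y \<in> fst (GH g h q k)" for y
  proof (intro bexI conjI)
    have y: "y \<in> supp (T h q (\<lambda>x. g x \<le> k))" "bdry y \<in> supp (T (h + 1) q (\<lambda>x. g x < k))"
      using that by (auto simp: GH_def homology_alt)
    show "?r y \<in> F M h q k" unfolding FM by (rule r [OF y(1)])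
    have "?r (bdry y) = 0" using y(2) by (rule res_0) (simp add: T_def)
    then show "D (?r y) = 0" using rD [OF y(1)] by simp
    have "y - ?r y \<in> supp (T h q (\<lambda>x. g x < k))"
      using y(1) by (auto simp: supp_def T_def in_keys_iff lookup_minus lookup_res subset_iff split: if_splits)
    then show "y - ?r y \<in> snd (GH g h q k)" using supp_lt_subset_GH_snd by blast
  qed
  show "y \<in> D ` F M (h - 1) q k" if "y \<in> F M h q k" "D y = 0" "y \<in> snd (GH g h q k)" for y
  proof -
    note hyp = that
    obtain x b where y: "y = bdry x + b" "x \<in> supp (T (h - 1) q (\<lambda>x. g x \<le> k))" "b \<in> supp (T h q (\<lambda>x. g x < k))"
      using hyp(3) unfolding GH_def homology_alt by auto
    have "y = ?r y" using that(1) unfolding FM by (rule res_id [symmetric]) (simp add: T_def)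
    also have "\<dots> = D (?r x) + ?r b" using rD [OF y(2)] by (simp add: y(1) res_add)
    also have "?r b = 0" using y(3) by (rule res_0) (simp add: T_def)
    finally have "y = D (?r x)" by simp
    then show ?thesis using r [OF y(2)] FM by blast
  qed
qed

text \<open>For each \<open>k\<close>, the first page is the homology of the complex graded by
  \<open>p\<close> with differential \<open>D\<close>. Modulo smaller \<open>p\<close> this is
  \<open>bdry\<close>, which then preserves \<open>g\<close>, so adding the components over all
  \<open>k\<close> gives the isomorphism and the projections \<open>?r k\<close> invert it.\<close>

theorem page_1: "isomorphic (direct_sum (\<lambda>k. FC.page 1 a h q k)) (GH p h q a)"
proof -
  define psum :: "(int \<Rightarrow>\<^sub>0 ('a \<Rightarrow>\<^sub>0 rat)) \<Rightarrow> 'a \<Rightarrow>\<^sub>0 rat"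
    where "psum f = (\<Sum>k\<in>Poly_Mapping.keys f. Poly_Mapping.lookup f k)" for f
  have psum_sup: "psum f = (\<Sum>k\<in>A. Poly_Mapping.lookup f k)" if "finite A" "Poly_Mapping.keys f \<subseteq> A" for f A
    unfolding psum_def using that by (intro sum.mono_neutral_left) (auto simp: in_keys_iff)
  have psum_lin: "Vector_Spaces.linear scaleQ scaleQ psum"
    unfolding Vector_Spaces.linear_iff
  proof (intro conjI allI)
    fix f f' :: "int \<Rightarrow>\<^sub>0 ('a \<Rightarrow>\<^sub>0 rat)" and c
    let ?A = "Poly_Mapping.keys f \<union> Poly_Mapping.keys f'"
    have A: "finite ?A" by simp
    show "psum (f + f') = psum f + psum f'"
      by (simp add: psum_sup [OF A Poly_Mapping.keys_add] psum_sup [OF A, of f] psum_sup [OF A, of f'] lookup_add sum.distrib)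
    have "Poly_Mapping.keys (scaleQ c f) \<subseteq> Poly_Mapping.keys f" by (auto simp: in_keys_iff lookup_scaleQ)
    then show "psum (scaleQ c f) = scaleQ c (psum f)"
      by (simp add: psum_sup [OF finite_keys] psum_def [of f] lookup_scaleQ Q.scale_sum_right)
  qed (rule Q.vector_space_axioms)+
  let ?r = "\<lambda>k. res (\<lambda>y. g y = k)"
  let ?X = "direct_sum (\<lambda>k. FC.page 1 a h q k)"
  \<comment> \<open>Cycles to order 0 are all chains of the piece, so both summands of the
    denominator simplify.\<close>
  have page1: "FC.page 1 a h q k =
     ({c \<in> F a h q k. D c \<in> F (a - 1) (h + 1) q k},
      {z + w |z w. z \<in> F (a - 1) h q k \<and> w \<in> D ` F a (h - 1) q k})" for k
  proof -
    have Z0: "FC.Z 0 b h q k = F b h q k" for b h using FC.D_F by (auto simp: FC.Z_def)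
    have "FC.Z 1 a h q k = {c \<in> F a h q k. D c \<in> F (a - 1) (h + 1) q k}" by (simp add: FC.Z_def)
    then show ?thesis by (simp add: FC.page_def FC.Bd_def Z0)
  qed
  have sq: "subquo (GH p h q a)" by (rule subquo_GH) (use bs in blast)
  have sqp: "subquo (FC.page 1 a h q k)" for k by (rule FC.subquo_page) simp
  have sub: "Q.subspace (fst (FC.page 1 a h q k))" "Q.subspace (snd (FC.page 1 a h q k))"
     "snd (FC.page 1 a h q k) \<subseteq> fst (FC.page 1 a h q k)" for k
    using sqp [of k] by (auto simp: subquo_def)
  have sqX: "subquo ?X"
    unfolding subquo_def direct_sum_def fst_conv snd_conv
  proof (intro conjI)
    show "Q.subspace {f. \<forall>k. Poly_Mapping.lookup f k \<in> fst (FC.page 1 a h q k)}"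
      "Q.subspace {f. \<forall>k. Poly_Mapping.lookup f k \<in> snd (FC.page 1 a h q k)}"
      by (auto intro!: Q.subspaceI simp: lookup_add lookup_scaleQ Q.subspace_0 [OF sub(1)] Q.subspace_add [OF sub(1)]
         Q.subspace_scale [OF sub(1)] Q.subspace_0 [OF sub(2)] Q.subspace_add [OF sub(2)] Q.subspace_scale [OF sub(2)]
         simp del: One_nat_def)
    show "{f. \<forall>k. Poly_Mapping.lookup f k \<in> snd (FC.page 1 a h q k)} \<subseteq> {f. \<forall>k. Poly_Mapping.lookup f k \<in> fst (FC.page 1 a h q k)}"
      using sub(3) by auto
  qed
  have F_le: "F b h q k \<subseteq> supp (T h q (\<lambda>x. p x \<le> b))" for b h q k
    unfolding F_def by (rule T_mono) simp
  have F_lt: "F (b - 1) h q k \<subseteq> supp (T h q (\<lambda>x. p x < b))" for b h q k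
    unfolding F_def by (rule T_mono) simp
  have diff: "bdry c - D c \<in> supp (T (h + 1) q (\<lambda>x. p x < a))" if "c \<in> supp (T h q (\<lambda>x. p x \<le> a))" for c h
    using that by (rule boundary_diff_D) simp
  have Fr: "?r k c \<in> F (a - 1) h q k" if "c \<in> supp (T h q (\<lambda>x. p x < a))" for c h k
    unfolding F_def using res_supp [OF that, of "\<lambda>y. g y = k"] by (rule subsetD [OF supp_mono, rotated]) (auto simp: T_def)
  have Fr': "?r k c \<in> F a h q k" if "c \<in> supp (T h q (\<lambda>x. p x \<le> a))" for c h k
    unfolding F_def using res_supp [OF that, of "\<lambda>y. g y = k"] by (rule subsetD [OF supp_mono, rotated]) (auto simp: T_def)
  have rB: "?r k (bdry c) - D (?r k c) \<in> F (a - 1) (h + 1) q k" if "c \<in> supp (T h q (\<lambda>x. p x \<le> a))" for c k h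
    using Fr [OF diff [OF that], of k] by (simp add: res_diff res_D)
  have GHf: "fst (GH p h q a) = {y \<in> supp (T h q (\<lambda>x. p x \<le> a)). bdry y \<in> supp (T (h + 1) q (\<lambda>x. p x < a))}"
    by (simp add: GH_def homology_alt)
  have subGH: "Q.subspace (fst (GH p h q a))" "Q.subspace (snd (GH p h q a))" using sq by (auto simp: subquo_def)
  have fin: "finite (g ` St)" using finite_St by simp
  have "induces_map psum ?X (GH p h q a)"
    unfolding induces_map_def
  proof (intro conjI psum_lin)
    show "psum ` fst ?X \<subseteq> fst (GH p h q a)"
    proof (rule image_subsetI)
      fix f assume "f \<in> fst ?X"
      then have f: "Poly_Mapping.lookup f k \<in> F a h q k" "D (Poly_Mapping.lookup f k) \<in> F (a - 1) (h + 1) q k" for k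
        by (simp_all add: direct_sum_def page1 del: One_nat_def)
      have "Poly_Mapping.lookup f k \<in> fst (GH p h q a)" for k
      proof -
        have 1: "Poly_Mapping.lookup f k \<in> supp (T h q (\<lambda>x. p x \<le> a))" using f(1) F_le by blast
        have "D (Poly_Mapping.lookup f k) \<in> supp (T (h + 1) q (\<lambda>x. p x < a))" using f(2) F_lt by blast
        from Q.subspace_add [OF supp_subspace diff [OF 1] this] show ?thesis using 1 by (simp add: GHf)
      qed
      then show "psum f \<in> fst (GH p h q a)" unfolding psum_def by (intro Q.subspace_sum [OF subGH(1)])
    qed
    show "psum ` snd ?X \<subseteq> snd (GH p h q a)"
    proof (rule image_subsetI)
      fix f assume f: "f \<in> snd ?X"
      have "Poly_Mapping.lookup f k \<in> snd (GH p h q a)" for k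
      proof -
        obtain z w where zw: "Poly_Mapping.lookup f k = z + D w" "z \<in> F (a - 1) h q k" "w \<in> F a (h - 1) q k"
          using f by (simp add: direct_sum_def page1 del: One_nat_def) blast
        have z: "z \<in> supp (T h q (\<lambda>x. p x < a))" using zw(2) F_lt by blast
        have w: "w \<in> supp (T (h - 1) q (\<lambda>x. p x \<le> a))" using zw(3) F_le by blast
        have "z - (bdry w - D w) \<in> supp (T h q (\<lambda>x. p x < a))"
          using Q.subspace_diff [OF supp_subspace z] diff [OF w] by simp
        from GH_sndI [where deg = p, OF w this] show ?thesis by (simp add: zw(1))
      qed
      then show "psum f \<in> snd (GH p h q a)" unfolding psum_def by (intro Q.subspace_sum [OF subGH(2)])
    qed
  qed
  moreover have "f \<in> snd ?X" if "f \<in> fst ?X" "psum f \<in> snd (GH p h q a)" for f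
  proof -
    note hyp = that
    have f: "Poly_Mapping.lookup f k \<in> F a h q k" for k using that(1) by (simp add: direct_sum_def page1 del: One_nat_def)
    obtain x b where xb: "psum f = bdry x + b" "x \<in> supp (T (h - 1) q (\<lambda>x. p x \<le> a))" "b \<in> supp (T h q (\<lambda>x. p x < a))"
      using hyp(2) unfolding GH_def homology_alt by auto
    have "Poly_Mapping.lookup f k \<in> snd (FC.page 1 a h q k)" for k
    proof -
      \<comment> \<open>Different summands have different \<open>g\<close>, so a projection recovers
        each of them from the sum.\<close>
      have "?r k (Poly_Mapping.lookup f j) = (if j = k then Poly_Mapping.lookup f k else 0)" for j
        using res_id [OF f [of k, unfolded F_def], of "\<lambda>y. g y = k"] res_0 [OF f [of j, unfolded F_def], of "\<lambda>y. g y = k"]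
        by (auto simp: T_def)
      then have "?r k (psum f) = Poly_Mapping.lookup f k"
        by (simp add: psum_def res_def lin_sum in_keys_iff)
      then have "Poly_Mapping.lookup f k = (?r k (bdry x) - D (?r k x) + ?r k b) + D (?r k x)"
        by (simp add: xb(1) res_add)
      moreover have "?r k (bdry x) - D (?r k x) + ?r k b \<in> F (a - 1) h q k"
        using rB [OF xb(2), of k] Fr [OF xb(3), of k] by (simp add: Q.subspace_add [OF FC.subspace_F])
      ultimately show ?thesis using Fr' [OF xb(2), of k] unfolding page1 snd_conv by blast
    qed
    then show ?thesis by (simp add: direct_sum_def)
  qed
  moreover have "\<exists>f\<in>fst ?X. y - psum f \<in> snd (GH p h q a)" if "y \<in> fst (GH p h q a)" for y
  proof -
    have y: "y \<in> supp (T h q (\<lambda>x. p x \<le> a))" "bdry y \<in> supp (T (h + 1) q (\<lambda>x. p x < a))" using that by (auto simp: GHf)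
    \<comment> \<open>The decomposition of \<open>y\<close> by the values of \<open>g\<close>; only
      finitely many occur.\<close>
    define f where "f = (\<Sum>k\<in>g ` St. Poly_Mapping.single k (?r k y))"
    have kS: "g x \<in> g ` St" if "x \<in> Poly_Mapping.keys y" for x using y(1) that by (auto simp: supp_def T_def)
    have lf: "Poly_Mapping.lookup f k = ?r k y" for k
    proof -
      have "Poly_Mapping.lookup f k = (\<Sum>j\<in>g ` St. if j = k then ?r k y else 0)"
        unfolding f_def lookup_sum_poly_mapping by (rule sum.cong) (auto simp: lookup_single when_def)
      also have "\<dots> = ?r k y"
      proof (cases "k \<in> g ` St")
        case False
        then have "?r k y = 0" using kS by (intro res_0 [of y "Poly_Mapping.keys y"]) (auto simp: supp_def)
        then show ?thesis using False by (simp add: sum.neutral)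
      qed (use fin in simp)
      finally show ?thesis .
    qed
    have "Poly_Mapping.lookup f k \<in> fst (FC.page 1 a h q k)" for k
    proof -
      have "?r k (bdry y) \<in> F (a - 1) (h + 1) q k" by (rule Fr [OF y(2)])
      from Q.subspace_diff [OF FC.subspace_F this rB [OF y(1), of k]]
      show ?thesis using Fr' [OF y(1), of k] by (simp add: page1 lf del: One_nat_def)
    qed
    then have "f \<in> fst ?X" by (simp add: direct_sum_def)
    moreover have "psum f = y"
    proof -
      have "Poly_Mapping.keys f \<subseteq> g ` St"
      proof
        fix k assume "k \<in> Poly_Mapping.keys f"
        then have "?r k y \<noteq> 0" by (simp add: in_keys_iff lf)
        then obtain x where "x \<in> Poly_Mapping.keys y" "g x = k"
          using res_0 [of y "Poly_Mapping.keys y" "\<lambda>y. g y = k"] by (auto simp: supp_def)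
        then show "k \<in> g ` St" using kS by blast
      qed
      from psum_sup [OF fin this] show ?thesis by (simp add: lf sum_res [OF fin kS])
    qed
    ultimately show ?thesis using Q.subspace_0 [OF subGH(2)] by (intro bexI [of _ f]) auto
  qed
  ultimately show ?thesis unfolding isomorphic_def using sq sqX by blast
qed

end

section \<open>The cube of resolutions\<close>

text \<open>Read from \<open>K\<close> to \<open>K'\<close> this is a merge, from \<open>K'\<close>
  to \<open>K\<close> a split. The points \<open>a\<close> and \<open>b\<close> lie on the two
  separate circles and on the common one; they stay fixed while the circles, as sets,
  change.\<close>

definition fusion :: "'p set set \<Rightarrow> 'p set set \<Rightarrow> 'p \<Rightarrow> 'p \<Rightarrow> bool" where
  "fusion K K' a b \<longleftrightarrow> (\<exists>U V W. U \<noteq> V \<and> K - K' = {U, V} \<and> K' - K = {W} \<and>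
     a \<in> U \<and> b \<in> V \<and> a \<in> W \<and> b \<in> W)"

lemma fusionE:
  assumes "fusion K K' a b"
  obtains U V W where "U \<noteq> V" "K - K' = {U, V}" "K' - K = {W}" "a \<in> U" "b \<in> V" "a \<in> W" "b \<in> W"
  using assms unfolding fusion_def by (elim exE conjE)

text \<open>The edge map on labels alone, without the sign and the vertex of the cube.\<close>

definition edge :: "complex set set \<Rightarrow> complex set set \<Rightarrow> (complex set set \<Rightarrow>\<^sub>0 rat) \<Rightarrow> (complex set set \<Rightarrow>\<^sub>0 rat)" where
  "edge K K' = lin (\<lambda>A. \<Sum>A'\<in>Pow K'. Poly_Mapping.single A' (edge_coeff K K' A A'))"

text \<open>
  Multiplication by \<open>v\<^sub>-\<close> in the factor of the circle \<open>C\<close>, in the Frobenius algebra with unit \<open>v\<^sub>+\<close>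
  that underlies the merge and split maps.
\<close>
definition xop :: "'c \<Rightarrow> ('c set \<Rightarrow>\<^sub>0 rat) \<Rightarrow> 'c set \<Rightarrow>\<^sub>0 rat" where
  "xop C = lin (\<lambda>A. if C \<in> A then Poly_Mapping.single (A - {C}) 1 else 0)"

section \<open>Merge and split on sets of circles labelled +\<close>

lemma merge_setD:
  assumes "U \<noteq> V" "K - K' = {U, V}" "K' - K = {W}"
  shows "U \<in> K" "V \<in> K" "W \<in> K'" "U \<notin> K'" "V \<notin> K'" "W \<notin> K" "W \<noteq> U" "W \<noteq> V"
    "K = insert U (insert V (K \<inter> K'))" "K' = insert W (K \<inter> K')"
  using assms by blast+

lemma merge_term_iff:
  assumes "U \<noteq> V" "K - K' = {U, V}" "K' - K = {W}"
  shows "merge_term K K' A A' \<or> split_term K K' A A' \<longleftrightarrow>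
    (U \<in> A \<and> V \<in> A \<and> W \<in> A' \<or> U \<in> A \<and> V \<notin> A \<and> W \<notin> A' \<or> U \<notin> A \<and> V \<in> A \<and> W \<notin> A')"
proof -
  have "\<not> split_term K K' A A'"
    using assms(1) unfolding split_term_def assms(2,3) by (auto simp: doubleton_eq_iff)
  moreover have "merge_term K K' A A' \<longleftrightarrow>
    (U \<in> A \<and> V \<in> A \<and> W \<in> A' \<or> U \<in> A \<and> V \<notin> A \<and> W \<notin> A' \<or> U \<notin> A \<and> V \<in> A \<and> W \<notin> A')"
    using assms(1) unfolding merge_term_def assms(2,3) by (auto simp: doubleton_eq_iff)
  ultimately show ?thesis by simp
qed

lemma split_term_iff:
  assumes "V \<noteq> W" "K - K' = {U}" "K' - K = {V, W}"
  shows "merge_term K K' A A' \<or> split_term K K' A A' \<longleftrightarrow>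
    (U \<in> A \<and> V \<in> A' \<and> W \<notin> A' \<or> U \<in> A \<and> V \<notin> A' \<and> W \<in> A' \<or> U \<notin> A \<and> V \<notin> A' \<and> W \<notin> A')"
proof -
  have "\<not> merge_term K K' A A'"
    using assms(1) unfolding merge_term_def assms(2,3) by (auto simp: doubleton_eq_iff)
  moreover have "split_term K K' A A' \<longleftrightarrow>
    (U \<in> A \<and> V \<in> A' \<and> W \<notin> A' \<or> U \<in> A \<and> V \<notin> A' \<and> W \<in> A' \<or> U \<notin> A \<and> V \<notin> A' \<and> W \<notin> A')"
    using assms(1) unfolding split_term_def assms(2,3) by (auto simp: doubleton_eq_iff)
  ultimately show ?thesis by simp
qed

lemma sum_single_indicator:
  assumes "finite S" "T \<subseteq> S"
  shows "(\<Sum>x\<in>S. Poly_Mapping.single x (if x \<in> T then 1 else 0 :: rat)) = (\<Sum>x\<in>T. Poly_Mapping.single x 1)"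
  using assms by (intro sum.mono_neutral_cong_right) auto

lemma edge_single:
  assumes "finite K'" "T \<subseteq> Pow K'"
    and "\<And>A'. A' \<subseteq> K' \<Longrightarrow> A \<inter> (K \<inter> K') = A' \<inter> (K \<inter> K') \<and> (merge_term K K' A A' \<or> split_term K K' A A') \<longleftrightarrow> A' \<in> T"
  shows "edge K K' (Poly_Mapping.single A 1) = (\<Sum>A'\<in>T. Poly_Mapping.single A' 1)"
proof -
  have "edge K K' (Poly_Mapping.single A 1) = (\<Sum>A'\<in>Pow K'. Poly_Mapping.single A' (if A' \<in> T then 1 else 0))"
  proof -
    have "Poly_Mapping.single A' (edge_coeff K K' A A') = Poly_Mapping.single A' (if A' \<in> T then 1 else 0)"
      if "A' \<in> Pow K'" for A'
    proof -
      have "A' \<subseteq> K'" using that by simp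
      from assms(3) [OF this] show ?thesis by (simp add: edge_coeff_def)
    qed
    then have "(\<Sum>A'\<in>Pow K'. Poly_Mapping.single A' (edge_coeff K K' A A')) =
        (\<Sum>A'\<in>Pow K'. Poly_Mapping.single A' (if A' \<in> T then 1 else 0))"
      by (rule sum.cong [OF refl])
    then show ?thesis by (simp add: edge_def)
  qed
  also have "\<dots> = (\<Sum>A'\<in>T. Poly_Mapping.single A' 1)"
    using assms by (intro sum_single_indicator) auto
  finally show ?thesis .
qed

text \<open>A minus label is absence from the set, so \<open>v_+ v_-\<close> results in
  \<open>A\<close> without the affected circles, and \<open>W\<close> is inserted only for
  \<open>v_+ v_+\<close>.\<close>

lemma edge_merge:
  assumes "finite K'" "U \<noteq> V" "K - K' = {U, V}" "K' - K = {W}" "A \<subseteq> K"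
  shows "edge K K' (Poly_Mapping.single A 1) =
     (if U \<in> A \<and> V \<in> A then Poly_Mapping.single (insert W (A - {U, V})) 1
      else if U \<in> A \<or> V \<in> A then Poly_Mapping.single (A - {U, V}) 1 else 0)"
proof -
  note D = merge_setD [OF assms(2-4)] and M = merge_term_iff [OF assms(2-4)]
  define R where "R = A - {U, V}"
  have "x \<in> K \<Longrightarrow> x \<noteq> U \<Longrightarrow> x \<noteq> V \<Longrightarrow> x \<in> K'" for x using assms(3) by blast
  then have R: "R = A \<inter> (K \<inter> K')" using assms(5) D(4,5) unfolding R_def by blast
  then have R: "R = A \<inter> (K \<inter> K')" "R \<subseteq> K'" "W \<notin> R" using D(6) by blast+
  have eqR: "A \<inter> (K \<inter> K') = A' \<inter> (K \<inter> K') \<longleftrightarrow> A' - {W} = R" if "A' \<subseteq> K'" for A'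
  proof -
    have "A' - {W} = A' \<inter> (K \<inter> K')" using that D(6) assms(4) by blast
    then show ?thesis unfolding R(1) by metis
  qed
  have "edge K K' (Poly_Mapping.single A 1) = (\<Sum>A'\<in>(if U \<in> A \<and> V \<in> A then {insert W R}
      else if U \<in> A \<or> V \<in> A then {R} else {}). Poly_Mapping.single A' 1)"
  proof (rule edge_single [OF assms(1)])
    show "(if U \<in> A \<and> V \<in> A then {insert W R} else if U \<in> A \<or> V \<in> A then {R} else {}) \<subseteq> Pow K'"
      using R D by auto
    fix A' assume A': "A' \<subseteq> K'"
    have "A' - {W} = R \<and> W \<in> A' \<longleftrightarrow> A' = insert W R" "A' - {W} = R \<and> W \<notin> A' \<longleftrightarrow> A' = R"
      using R(3) by auto
    then show "A \<inter> (K \<inter> K') = A' \<inter> (K \<inter> K') \<and> (merge_term K K' A A' \<or> split_term K K' A A') \<longleftrightarrow>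
       A' \<in> (if U \<in> A \<and> V \<in> A then {insert W R} else if U \<in> A \<or> V \<in> A then {R} else {})"
      unfolding M eqR [OF A'] by (cases "U \<in> A"; cases "V \<in> A") simp_all
  qed
  then show ?thesis unfolding R_def by simp
qed

lemma split_label_iff:
  assumes "V \<notin> R" "W \<notin> R" "V \<noteq> W"
  shows "B - {V, W} = R \<and> V \<in> B \<and> W \<notin> B \<longleftrightarrow> B = insert V R"
    "B - {V, W} = R \<and> V \<notin> B \<and> W \<in> B \<longleftrightarrow> B = insert W R"
    "B - {V, W} = R \<and> V \<notin> B \<and> W \<notin> B \<longleftrightarrow> B = R"
proof -
  show "B - {V, W} = R \<and> V \<in> B \<and> W \<notin> B \<longleftrightarrow> B = insert V R"
  proof
    assume "B - {V, W} = R \<and> V \<in> B \<and> W \<notin> B"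
    then show "B = insert V R" by blast
  next
    assume "B = insert V R"
    then show "B - {V, W} = R \<and> V \<in> B \<and> W \<notin> B" using assms by simp
  qed
  show "B - {V, W} = R \<and> V \<notin> B \<and> W \<in> B \<longleftrightarrow> B = insert W R"
  proof
    assume "B - {V, W} = R \<and> V \<notin> B \<and> W \<in> B"
    then show "B = insert W R" by blast
  next
    assume B: "B = insert W R"
    have "insert W R - {V, W} = R" using assms by blast
    then show "B - {V, W} = R \<and> V \<notin> B \<and> W \<in> B" using assms B by simp
  qed
  show "B - {V, W} = R \<and> V \<notin> B \<and> W \<notin> B \<longleftrightarrow> B = R"
  proof
    assume "B - {V, W} = R \<and> V \<notin> B \<and> W \<notin> B"
    then show "B = R" by blast
  next
    assume "B = R"
    then show "B - {V, W} = R \<and> V \<notin> B \<and> W \<notin> B" using assms by simp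
  qed
qed

text \<open>If \<open>U\<close> carries -, both new circles carry -, and the set of + circles does
  not change.\<close>

lemma edge_split:
  assumes "finite K'" "V \<noteq> W" "K - K' = {U}" "K' - K = {V, W}" "A \<subseteq> K"
  shows "edge K K' (Poly_Mapping.single A 1) =
     (if U \<in> A then Poly_Mapping.single (insert V (A - {U})) 1 + Poly_Mapping.single (insert W (A - {U})) 1
      else Poly_Mapping.single A 1)"
proof -
  note D = merge_setD [OF assms(2,4,3)] and M = split_term_iff [OF assms(2-4)]
  define R where "R = A - {U}"
  have "x \<in> K \<Longrightarrow> x \<noteq> U \<Longrightarrow> x \<in> K'" for x using assms(3) by blast
  then have R: "R = A \<inter> (K \<inter> K')" using assms(5) D(6) unfolding R_def by blast
  then have R: "R = A \<inter> (K \<inter> K')" "R \<subseteq> K'" "W \<notin> R" "V \<notin> R" using D(4,5) by blast+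
  have eqR: "A \<inter> (K \<inter> K') = A' \<inter> (K \<inter> K') \<longleftrightarrow> A' - {V, W} = R" if "A' \<subseteq> K'" for A'
  proof -
    have "A' - {V, W} = A' \<inter> (K \<inter> K')" using that D(4,5) assms(4) by blast
    then show ?thesis unfolding R(1) by metis
  qed
  have "edge K K' (Poly_Mapping.single A 1) = (\<Sum>A'\<in>(if U \<in> A then {insert V R, insert W R} else {R}). Poly_Mapping.single A' 1)"
  proof (rule edge_single [OF assms(1)])
    show "(if U \<in> A then {insert V R, insert W R} else {R}) \<subseteq> Pow K'"
      using R D by auto
    fix A' assume A': "A' \<subseteq> K'"
    note S = split_label_iff [OF R(4,3) assms(2), of A', symmetric]
    show "A \<inter> (K \<inter> K') = A' \<inter> (K \<inter> K') \<and> (merge_term K K' A A' \<or> split_term K K' A A') \<longleftrightarrow>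
       A' \<in> (if U \<in> A then {insert V R, insert W R} else {R})"
      unfolding M eqR [OF A'] by (cases "U \<in> A") (simp_all add: S, blast)
  qed
  moreover have "insert V R \<noteq> insert W R" using R(3,4) assms(2) by blast
  moreover have "U \<notin> A \<Longrightarrow> R = A" unfolding R_def by blast
  ultimately show ?thesis unfolding R_def [symmetric] by simp
qed

lemma xop_single [simp]:
  "xop C (Poly_Mapping.single A 1) = (if C \<in> A then Poly_Mapping.single (A - {C}) 1 else 0)"
  by (simp add: xop_def)

lemma edge_0 [simp]: "edge K K' 0 = 0" and xop_0 [simp]: "xop C 0 = 0"
  by (simp_all add: edge_def xop_def)

lemma edge_add: "edge K K' (c + d) = edge K K' c + edge K K' d" and xop_add: "xop C (c + d) = xop C c + xop C d"
  by (simp_all add: edge_def xop_def lin_add)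

text \<open>Multiplication is a module map: a factor \<open>v_-\<close> may be applied before or
  after merging. The last assumption says that \<open>C'\<close> is \<open>C\<close>, untouched, or
  the merged circle that absorbs \<open>C\<close>.\<close>

lemma edge_xop_merge:
  assumes "finite K'" "U \<noteq> V" "K - K' = {U, V}" "K' - K = {W}" "A \<subseteq> K"
    and C: "C \<in> K" "C' \<in> K'" "C = C' \<or> C \<in> {U, V} \<and> C' = W"
  shows "edge K K' (xop C (Poly_Mapping.single A 1)) = xop C' (edge K K' (Poly_Mapping.single A 1))"
proof -
  note D = merge_setD [OF assms(2-4)]
  have E: "edge K K' (Poly_Mapping.single B 1) =
     (if U \<in> B \<and> V \<in> B then Poly_Mapping.single (insert W (B - {U, V})) 1
      else if U \<in> B \<or> V \<in> B then Poly_Mapping.single (B - {U, V}) 1 else 0)" if "B \<subseteq> K" for B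
    by (rule edge_merge [OF assms(1-4) that])
  have WA: "W \<notin> A" using assms(5) D by blast
  have AS: "A - S \<subseteq> K" for S using assms(5) by blast
  from C(3) show ?thesis
  proof
    assume "C = C'"
    then have ne: "C \<noteq> U" "C \<noteq> V" "C \<noteq> W" "C' = C" using C D by auto
    have "A - {C} - {U, V} = A - {U, V} - {C}" "insert W (A - {C} - {U, V}) = insert W (A - {U, V}) - {C}"
      using ne by blast+
    then show ?thesis using ne by (simp add: E [OF assms(5)] E AS)
  next
    assume c: "C \<in> {U, V} \<and> C' = W"
    have "insert W (A - {U, V}) - {W} = A - {U, V}" "A - {U} - {U, V} = A - {U, V}" "A - {V} - {U, V} = A - {U, V}"
      using WA by blast+
    note eqs = this
    have "C = U \<or> C = V" "C' = W" using c by auto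
    then show ?thesis
      using assms(2) WA assms(2) [symmetric] eqs
      unfolding E [OF assms(5)] xop_single
      by (elim disjE; hypsubst; cases "U \<in> A"; cases "V \<in> A"; simp add: E AS)
  qed
qed

text \<open>Comultiplication is a module map for either of its two tensor factors, so
  \<open>C'\<close> may be either of the new circles when \<open>C\<close> is the one that
  splits.\<close>

lemma edge_xop_split:
  assumes "finite K'" "V \<noteq> W" "K - K' = {U}" "K' - K = {V, W}" "A \<subseteq> K"
    and C: "C \<in> K" "C' \<in> K'" "C = C' \<or> C' \<in> {V, W} \<and> C = U"
  shows "edge K K' (xop C (Poly_Mapping.single A 1)) = xop C' (edge K K' (Poly_Mapping.single A 1))"
proof -
  note D = merge_setD [OF assms(2,4,3)]
  have E: "edge K K' (Poly_Mapping.single B 1) =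
     (if U \<in> B then Poly_Mapping.single (insert V (B - {U})) 1 + Poly_Mapping.single (insert W (B - {U})) 1
      else Poly_Mapping.single B 1)" if "B \<subseteq> K" for B
    by (rule edge_split [OF assms(1-4) that])
  have VWA: "W \<notin> A" "V \<notin> A" using assms(5) D by blast+
  have AS: "A - S \<subseteq> K" for S using assms(5) by blast
  from C(3) show ?thesis
  proof
    assume "C = C'"
    then have ne: "C \<noteq> U" "C \<noteq> V" "C \<noteq> W" "C' = C" using C D by auto
    have "insert V (A - {C} - {U}) = insert V (A - {U}) - {C}" "insert W (A - {C} - {U}) = insert W (A - {U}) - {C}"
      using ne by blast+
    then show ?thesis using ne by (simp add: E [OF assms(5)] E AS xop_add)
  next
    assume c: "C' \<in> {V, W} \<and> C = U"
    have "insert V (A - {U}) - {V} = A - {U}" "insert W (A - {U}) - {W} = A - {U}"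
      using VWA by blast+
    note eqs = this
    have "C' = V \<or> C' = W" "C = U" using c by auto
    then show ?thesis
      using assms(2) VWA assms(2) [symmetric] eqs
      unfolding E [OF assms(5)] xop_single
      by (elim disjE; hypsubst; cases "U \<in> A"; simp add: E AS xop_add)
  qed
qed

text \<open>
  \<open>Base\<close> stands for the part of the diagram outside the crossings, which all resolutions share.
\<close>
definition circle_system :: "'p set \<Rightarrow> 'p set set \<Rightarrow> bool" where
  "circle_system Base K \<longleftrightarrow> finite K \<and> disjoint K \<and> Base \<subseteq> \<Union>K \<and> (\<forall>C\<in>K. C \<inter> Base \<noteq> {})"

section \<open>Circles named by base points\<close>

lemma circle_systemD:
  assumes "circle_system Base K"
  shows "finite K" "disjoint K" "Base \<subseteq> \<Union>K" "C \<in> K \<Longrightarrow> C \<inter> Base \<noteq> {}"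
  using assms unfolding circle_system_def by blast+

text \<open>A point of the common part names one circle in every resolution, so operators can be
  carried along an edge without following the sets themselves.\<close>

definition circle_of :: "'p set set \<Rightarrow> 'p \<Rightarrow> 'p set" where
  "circle_of K z = (THE C. C \<in> K \<and> z \<in> C)"

lemma circle_of_eq:
  assumes "circle_system Base K" "C \<in> K" "z \<in> C"
  shows "circle_of K z = C"
  unfolding circle_of_def
proof (rule the_equality)
  show "C \<in> K \<and> z \<in> C" using assms by simp
  fix C' assume C': "C' \<in> K \<and> z \<in> C'"
  show "C' = C"
  proof (rule ccontr)
    assume "C' \<noteq> C"
    then have "C' \<inter> C = {}" using assms(2) C' disjointD [OF circle_systemD(2) [OF assms(1)]] by blast
    then show False using C' assms by blast
  qed
qed

lemma circle_of_mem:
  assumes "circle_system Base K" "z \<in> Base"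
  shows "circle_of K z \<in> K" "z \<in> circle_of K z"
proof -
  obtain C where "C \<in> K" "z \<in> C" using assms(2) circle_systemD(3) [OF assms(1)] by blast
  then show "circle_of K z \<in> K" "z \<in> circle_of K z" using circle_of_eq [OF assms(1)] by auto
qed

text \<open>By disjointness, a circle through \<open>z\<close> that belongs to both systems is the
  circle of \<open>z\<close> in both; otherwise the circles on both sides are affected by the
  change.\<close>

lemma fusion_circle_of:
  assumes K: "circle_system Base K" and K': "circle_system Base K'" and z: "z \<in> Base"
    and UVW: "U \<noteq> V" "K - K' = {U, V}" "K' - K = {W}"
  shows "circle_of K z = circle_of K' z \<or> circle_of K z \<in> {U, V} \<and> circle_of K' z = W"
proof -
  note C = circle_of_mem [OF K z] and C' = circle_of_mem [OF K' z]
  show ?thesis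
  proof (cases "circle_of K z \<in> K' \<or> circle_of K' z \<in> K")
    case True
    then show ?thesis using circle_of_eq [OF K'] circle_of_eq [OF K] C C' by metis
  next
    case False
    then have "circle_of K z \<in> K - K'" "circle_of K' z \<in> K' - K" using C C' by blast+
    then show ?thesis unfolding UVW by blast
  qed
qed

lemma edge_xop:
  assumes K: "circle_system Base K" and K': "circle_system Base K'" and z: "z \<in> Base"
    and f: "fusion K K' a b \<or> fusion K' K a b" and A: "A \<subseteq> K"
  shows "edge K K' (xop (circle_of K z) (Poly_Mapping.single A 1)) =
     xop (circle_of K' z) (edge K K' (Poly_Mapping.single A 1))"
proof -
  have fin: "finite K'" by (rule circle_systemD(1) [OF K'])
  from f show ?thesis
  proof
    assume "fusion K K' a b"
    then obtain U V W where UVW: "U \<noteq> V" "K - K' = {U, V}" "K' - K = {W}"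
      by (elim fusionE)
    show ?thesis
      by (rule edge_xop_merge [OF fin UVW A circle_of_mem(1) [OF K z] circle_of_mem(1) [OF K' z]
        fusion_circle_of [OF K K' z UVW]])
  next
    assume "fusion K' K a b"
    then obtain U V W where UVW: "U \<noteq> V" "K' - K = {U, V}" "K - K' = {W}" 
      by (elim fusionE)
    have "circle_of K z = circle_of K' z \<or> circle_of K' z \<in> {U, V} \<and> circle_of K z = W"
      using fusion_circle_of [OF K' K z UVW] by auto
    from edge_xop_split [OF fin UVW(1,3,2) A circle_of_mem(1) [OF K z] circle_of_mem(1) [OF K' z] this]
    show ?thesis .
  qed
qed

lemma edge_in_supp: "edge K K' c \<in> supp (Pow K')"
  unfolding edge_def
proof (rule lin_supp)
  show "c \<in> supp UNIV" by (simp add: supp_def)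
  fix A A' assume "A' \<in> Poly_Mapping.keys (\<Sum>A'\<in>Pow K'. Poly_Mapping.single A' (edge_coeff K K' A A'))"
  then have "(\<Sum>B\<in>Pow K'. Poly_Mapping.lookup (Poly_Mapping.single B (edge_coeff K K' A B)) A') \<noteq> 0"
    by (simp add: in_keys_iff lookup_sum_poly_mapping)
  then obtain B where "B \<in> Pow K'" "Poly_Mapping.lookup (Poly_Mapping.single B (edge_coeff K K' A B)) A' \<noteq> 0"
    by (rule sum.not_neutral_contains_not_neutral)
  then show "A' \<in> Pow K'" by (auto simp: lookup_single when_def split: if_splits)
qed

lemma edge_xop_supp:
  assumes "circle_system Base K" "circle_system Base K'" "z \<in> Base"
    and "fusion K K' a b \<or> fusion K' K a b" and c: "c \<in> supp (Pow K)"
  shows "edge K K' (xop (circle_of K z) c) = xop (circle_of K' z) (edge K K' c)"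
proof -
  have "edge K K' (xop (circle_of K z) c) = lin (\<lambda>A. edge K K' (xop (circle_of K z) (Poly_Mapping.single A 1))) c"
    by (simp add: xop_def edge_def lin_lin)
  also have "\<dots> = lin (\<lambda>A. xop (circle_of K' z) (edge K K' (Poly_Mapping.single A 1))) c"
    using c by (intro lin_cong edge_xop [OF assms(1-4)]) (auto simp: supp_def)
  also have "\<dots> = xop (circle_of K' z) (edge K K' c)"
    by (simp add: xop_def edge_def lin_lin)
  finally show ?thesis .
qed

lemma edge_all_plus_merge:
  assumes "finite K'" "fusion K K' a b"
  shows "edge K K' (Poly_Mapping.single K 1) = Poly_Mapping.single K' 1"
proof -
  obtain U V W where UVW: "U \<noteq> V" "K - K' = {U, V}" "K' - K = {W}"
      using assms(2) by (elim fusionE)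
  note D = merge_setD [OF UVW]
  have "insert W (K - {U, V}) = K'" using D UVW by blast
  then show ?thesis using D by (simp add: edge_merge [OF assms(1) UVW order_refl])
qed

text \<open>The comultiplication of the unit, \<open>v_+ \<otimes> v_- + v_- \<otimes> v_+\<close>,
  with the new circles named by the marked points on them.\<close>

lemma edge_all_plus_split:
  assumes K: "circle_system Base K" and K': "circle_system Base K'" and "fusion K' K a b"
  shows "edge K K' (Poly_Mapping.single K 1) =
     xop (circle_of K' a) (Poly_Mapping.single K' 1) + xop (circle_of K' b) (Poly_Mapping.single K' 1)"
proof -
  obtain U V W where UVW: "U \<noteq> V" "K' - K = {U, V}" "K - K' = {W}" "a \<in> U" "b \<in> V"
      using assms(3) by (elim fusionE)
  note D = merge_setD [OF UVW(1-3)]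
  have fin: "finite K'" by (rule circle_systemD(1) [OF K'])
  have C: "circle_of K' a = U" "circle_of K' b = V" using circle_of_eq [OF K'] D UVW by auto
  have "insert U (K - {W}) = K' - {V}" "insert V (K - {W}) = K' - {U}" using D UVW(1-3) by blast+
  then show ?thesis using D by (simp add: C edge_split [OF fin UVW(1,3,2) order_refl] add.commute)
qed

section \<open>Commutativity of the faces of the cube\<close>

lemma card_fusion:
  assumes "finite K" "finite K'" "fusion K K' a b"
  shows "card K = Suc (card K')"
proof -
  obtain U V W where UVW: "U \<noteq> V" "K - K' = {U, V}" "K' - K = {W}"
      using assms(3) by (elim fusionE)
  have "card (K - K') + card (K \<inter> K') = card K" "card (K' - K) + card (K \<inter> K') = card K'"
    using assms(1,2) card_Diff_subset_Int [of K K'] card_Diff_subset_Int [of K' K]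
      card_mono [of K "K \<inter> K'"] card_mono [of K' "K \<inter> K'"] by (simp_all add: Int_commute)
  then show ?thesis using UVW by simp
qed

lemma fusion_mem:
  assumes K: "circle_system Base K" and K': "circle_system Base K'" and "fusion K K' a b"
  shows "circle_of K a \<noteq> circle_of K b" "K - K' = {circle_of K a, circle_of K b}"
    "circle_of K' a = circle_of K' b" "K' - K = {circle_of K' a}"
    "a \<in> circle_of K a" "b \<in> circle_of K b" "a \<in> circle_of K' a" "b \<in> circle_of K' a"
proof -
  obtain U V W where UVW: "U \<noteq> V" "K - K' = {U, V}" "K' - K = {W}" "a \<in> U" "b \<in> V" "a \<in> W" "b \<in> W"
      using assms(3) by (elim fusionE)
  note D = merge_setD [OF UVW(1-3)]
  have "circle_of K a = U" "circle_of K b = V" "circle_of K' a = W" "circle_of K' b = W"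
    using circle_of_eq [OF K] circle_of_eq [OF K'] D UVW by auto
  then show "circle_of K a \<noteq> circle_of K b" "K - K' = {circle_of K a, circle_of K b}"
    "circle_of K' a = circle_of K' b" "K' - K = {circle_of K' a}"
    "a \<in> circle_of K a" "b \<in> circle_of K b" "a \<in> circle_of K' a" "b \<in> circle_of K' a"
    using UVW by simp_all
qed

text \<open>The two digits of \<open>K00\<close>, ..., \<open>K11\<close> tell whether the crossings
  i and j are 1-resolved; each crossing has the same two marked points on both of its edges.\<close>

locale cube_face =
  fixes Base :: "complex set" and K00 K10 K01 K11 :: "complex set set" and ai bi aj bj :: complex
  assumes K: "circle_system Base K00" "circle_system Base K10" "circle_system Base K01" "circle_system Base K11"
    and pts: "ai \<in> Base" "bi \<in> Base" "aj \<in> Base" "bj \<in> Base"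
    and fi0: "fusion K00 K10 ai bi \<or> fusion K10 K00 ai bi"
    and fi1: "fusion K01 K11 ai bi \<or> fusion K11 K01 ai bi"
    and fj0: "fusion K00 K01 aj bj \<or> fusion K01 K00 aj bj"
    and fj1: "fusion K10 K11 aj bj \<or> fusion K11 K10 aj bj"
begin

lemma fin: "finite K00" "finite K10" "finite K01" "finite K11"
  by (rule circle_systemD(1), rule K)+

abbreviation one :: "complex set set \<Rightarrow> complex set set \<Rightarrow>\<^sub>0 rat" where
  "one A \<equiv> Poly_Mapping.single A 1"

abbreviation X :: "complex \<Rightarrow> (complex set set \<Rightarrow>\<^sub>0 rat) \<Rightarrow> complex set set \<Rightarrow>\<^sub>0 rat" where
  "X z \<equiv> xop (circle_of K11 z)"

lemma one_supp: "A \<subseteq> N \<Longrightarrow> one A \<in> supp (Pow N)"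
  by (simp add: supp_def)

lemma path_i_merge: "fusion K00 K10 ai bi \<Longrightarrow> edge K10 K11 (edge K00 K10 (one K00)) = edge K10 K11 (one K10)"
  using edge_all_plus_merge [OF fin(2)] by simp

lemma path_i_split:
  assumes "fusion K10 K00 ai bi"
  shows "edge K10 K11 (edge K00 K10 (one K00)) = X ai (edge K10 K11 (one K10)) + X bi (edge K10 K11 (one K10))"
  using edge_all_plus_split [OF K(1,2) assms] edge_xop_supp [OF K(2,4) _ fj1 one_supp [OF order_refl]] pts
  by (simp add: edge_add)

lemma path_j_merge: "fusion K00 K01 aj bj \<Longrightarrow> edge K01 K11 (edge K00 K01 (one K00)) = edge K01 K11 (one K01)"
  using edge_all_plus_merge [OF fin(3)] by simp

lemma path_j_split:
  assumes "fusion K01 K00 aj bj"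
  shows "edge K01 K11 (edge K00 K01 (one K00)) = X aj (edge K01 K11 (one K01)) + X bj (edge K01 K11 (one K01))"
  using edge_all_plus_split [OF K(1,3) assms] edge_xop_supp [OF K(3,4) _ fi1 one_supp [OF order_refl]] pts
  by (simp add: edge_add)

lemma j1_merge: "fusion K10 K11 aj bj \<Longrightarrow> edge K10 K11 (one K10) = one K11"
  using edge_all_plus_merge [OF fin(4)] by simp

lemma i1_merge: "fusion K01 K11 ai bi \<Longrightarrow> edge K01 K11 (one K01) = one K11"
  using edge_all_plus_merge [OF fin(4)] by simp

lemma j1_split: "fusion K11 K10 aj bj \<Longrightarrow> edge K10 K11 (one K10) = X aj (one K11) + X bj (one K11)"
  using edge_all_plus_split [OF K(2,4)] by simp

lemma i1_split: "fusion K11 K01 ai bi \<Longrightarrow> edge K01 K11 (one K01) = X ai (one K11) + X bi (one K11)"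
  using edge_all_plus_split [OF K(3,4)] by simp

lemma xop_commute: "xop C (xop C' (one A)) = xop C' (xop C (one A))"
proof -
  have "A - {C} - {C'} = A - {C'} - {C}" by blast
  then show ?thesis by auto
qed

text \<open>Every edge changes the number of circles by one and both paths have the same ends, which
  leaves six of the sixteen patterns of merges and splits. Four of them agree by the formulas for
  units; when both paths merge and then split, or split and then merge, it must also be known which
  marked points share a circle in \<open>K11\<close>.\<close>

lemma all_plus_commute: "edge K10 K11 (edge K00 K10 (one K00)) = edge K01 K11 (edge K00 K01 (one K00))"
proof -
  define n00 n10 n01 n11 where n: "n00 = card K00" "n10 = card K10" "n01 = card K01" "n11 = card K11"
  have c: "fusion K00 K10 ai bi \<Longrightarrow> n00 = Suc n10" "fusion K10 K00 ai bi \<Longrightarrow> n10 = Suc n00"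
    "fusion K00 K01 aj bj \<Longrightarrow> n00 = Suc n01" "fusion K01 K00 aj bj \<Longrightarrow> n01 = Suc n00"
    "fusion K10 K11 aj bj \<Longrightarrow> n10 = Suc n11" "fusion K11 K10 aj bj \<Longrightarrow> n11 = Suc n10"
    "fusion K01 K11 ai bi \<Longrightarrow> n01 = Suc n11" "fusion K11 K01 ai bi \<Longrightarrow> n11 = Suc n01"
    unfolding n by (rule card_fusion, simp_all add: fin)+
  have "fusion K00 K10 ai bi \<and> n00 = Suc n10 \<or> fusion K10 K00 ai bi \<and> n10 = Suc n00"
    "fusion K00 K01 aj bj \<and> n00 = Suc n01 \<or> fusion K01 K00 aj bj \<and> n01 = Suc n00"
    "fusion K10 K11 aj bj \<and> n10 = Suc n11 \<or> fusion K11 K10 aj bj \<and> n11 = Suc n10"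
    "fusion K01 K11 ai bi \<and> n01 = Suc n11 \<or> fusion K11 K01 ai bi \<and> n11 = Suc n01"
    using fi0 fi1 fj0 fj1 c by blast+
  then have "(fusion K00 K10 ai bi \<and> fusion K10 K11 aj bj \<and> fusion K00 K01 aj bj \<and> fusion K01 K11 ai bi) \<or>
      (fusion K10 K00 ai bi \<and> fusion K11 K10 aj bj \<and> fusion K01 K00 aj bj \<and> fusion K11 K01 ai bi) \<or>
      (fusion K00 K10 ai bi \<and> fusion K11 K10 aj bj \<and> fusion K01 K00 aj bj \<and> fusion K01 K11 ai bi) \<or>
      (fusion K10 K00 ai bi \<and> fusion K10 K11 aj bj \<and> fusion K00 K01 aj bj \<and> fusion K11 K01 ai bi) \<or>
      (fusion K00 K10 ai bi \<and> fusion K11 K10 aj bj \<and> fusion K00 K01 aj bj \<and> fusion K11 K01 ai bi) \<or>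
      (fusion K10 K00 ai bi \<and> fusion K10 K11 aj bj \<and> fusion K01 K00 aj bj \<and> fusion K01 K11 ai bi)"
    by (elim disjE conjE) simp_all
  then consider
    (mm) "fusion K00 K10 ai bi" "fusion K10 K11 aj bj" "fusion K00 K01 aj bj" "fusion K01 K11 ai bi"
  | (ss) "fusion K10 K00 ai bi" "fusion K11 K10 aj bj" "fusion K01 K00 aj bj" "fusion K11 K01 ai bi"
  | (ms1) "fusion K00 K10 ai bi" "fusion K11 K10 aj bj" "fusion K01 K00 aj bj" "fusion K01 K11 ai bi"
  | (ms2) "fusion K10 K00 ai bi" "fusion K10 K11 aj bj" "fusion K00 K01 aj bj" "fusion K11 K01 ai bi"
  | (up) "fusion K00 K10 ai bi" "fusion K11 K10 aj bj" "fusion K00 K01 aj bj" "fusion K11 K01 ai bi"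
  | (dn) "fusion K10 K00 ai bi" "fusion K10 K11 aj bj" "fusion K01 K00 aj bj" "fusion K01 K11 ai bi"
    by blast
  then show ?thesis
  proof cases
    case mm
    then show ?thesis by (simp add: path_i_merge path_j_merge j1_merge i1_merge)
  next
    case ss
    then show ?thesis
      by (simp add: path_i_split path_j_split j1_split i1_split xop_add xop_commute [of "circle_of K11 ai"]
          xop_commute [of "circle_of K11 bi"] algebra_simps del: xop_single)
  next
    case ms1
    then show ?thesis by (simp add: path_i_merge path_j_split j1_split i1_merge)
  next
    case ms2
    then show ?thesis by (simp add: path_i_split path_j_merge j1_merge i1_split)
  next
    case up
    \<comment> \<open>Two circles touch at both crossings; in the end each of the two new circles touches both crossings.\<close>
    note f1 = fusion_mem [OF K(1,2) up(1)] and f2 = fusion_mem [OF K(4,2) up(2)] and f3 = fusion_mem [OF K(1,3) up(3)] and f4 = fusion_mem [OF K(4,3) up(4)]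
    \<comment> \<open>A final circle through \<open>z\<close> that did not arise from the split
      would already be in \<open>K10\<close> and contain both \<open>ai\<close> and
      \<open>bi\<close>, which lie on different circles of \<open>K11\<close>.\<close>
    have "circle_of K11 z \<in> {circle_of K11 aj, circle_of K11 bj}" if z: "z = ai \<or> z = bi" for z
    proof (rule ccontr)
      assume "\<not> ?thesis"
      moreover have "z \<in> Base" using z pts by auto
      note zz = circle_of_mem [OF K(4) this]
      ultimately have "circle_of K11 z \<in> K10" using f2(2) by blast
      then have "circle_of K10 z = circle_of K11 z" by (rule circle_of_eq [OF K(2) _ zz(2)])
      moreover have "circle_of K10 z = circle_of K10 ai" using z f1(3) by auto
      ultimately have "ai \<in> circle_of K11 z" "bi \<in> circle_of K11 z" using f1(7,8) by auto
      then have "circle_of K11 ai = circle_of K11 z" "circle_of K11 bi = circle_of K11 z"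
        using circle_of_eq [OF K(4) zz(1)] by auto
      then show False using f4(1) by simp
    qed
    from this [of ai] this [of bi] f4(1)
    have "circle_of K11 ai = circle_of K11 aj \<and> circle_of K11 bi = circle_of K11 bj \<or>
        circle_of K11 ai = circle_of K11 bj \<and> circle_of K11 bi = circle_of K11 aj" by auto
    then show ?thesis using up by (auto simp: path_i_merge path_j_merge j1_split i1_split add.commute simp del: xop_single)
  next
    case dn
    \<comment> \<open>A circle is cut in two and reconnected, so all ends lie on one circle in the end.\<close>
    note f1 = fusion_mem [OF K(2,1) dn(1)] and f2 = fusion_mem [OF K(2,4) dn(2)] and f3 = fusion_mem [OF K(3,1) dn(3)] and f4 = fusion_mem [OF K(3,4) dn(4)]
    \<comment> \<open>Otherwise the final circle through \<open>ai\<close> and \<open>bi\<close>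
      would be untouched by the merge from \<open>K10\<close>, where these points lie on different
      circles.\<close>
    have "circle_of K11 ai = circle_of K11 aj"
    proof (rule ccontr)
      assume ne: "\<not> ?thesis"
      note zz = circle_of_mem [OF K(4) pts(1)]
      have "circle_of K11 ai \<in> K10" using f2(4) ne zz(1) by blast
      moreover have "ai \<in> circle_of K11 ai" "bi \<in> circle_of K11 ai" using f4(7,8) by auto
      ultimately have "circle_of K10 ai = circle_of K11 ai" "circle_of K10 bi = circle_of K11 ai"
        using circle_of_eq [OF K(2)] by auto
      then show False using f1(1) by simp
    qed
    then show ?thesis using dn f2(3) f4(3)
      by (simp add: path_i_split path_j_split j1_merge i1_merge del: xop_single)
  qed
qed

text \<open>
  The edge maps commute with the operators \<open>xop\<close>, which produce every state from the one with all
  labels \<open>+\<close>.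
\<close>
lemma commute_diff:
  assumes "finite B" "B \<subseteq> K00"
  shows "edge K10 K11 (edge K00 K10 (one (K00 - B))) = edge K01 K11 (edge K00 K01 (one (K00 - B)))"
  using assms
proof (induction B)
  case empty
  then show ?case using all_plus_commute by simp
next
  case (insert C B)
  then obtain z where z: "z \<in> Base" "z \<in> C" using circle_systemD(4) [OF K(1), of C] by blast
  have C: "circle_of K00 z = C" using circle_of_eq [OF K(1)] insert.prems z(2) by auto
  have "K00 - insert C B = K00 - B - {C}" by blast
  then have eq: "one (K00 - insert C B) = xop (circle_of K00 z) (one (K00 - B))"
    using insert.hyps insert.prems by (simp add: C)
  have s: "one (K00 - B) \<in> supp (Pow K00)" by (rule one_supp) blast
  show ?case
    unfolding eq edge_xop_supp [OF K(1,2) z(1) fi0 s] edge_xop_supp [OF K(1,3) z(1) fj0 s]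
      edge_xop_supp [OF K(2,4) z(1) fj1 edge_in_supp] edge_xop_supp [OF K(3,4) z(1) fi1 edge_in_supp]
    using insert by simp
qed

theorem edge_edge_commute:
  assumes "A \<subseteq> K00"
  shows "edge K10 K11 (edge K00 K10 (one A)) = edge K01 K11 (edge K00 K01 (one A))"
proof -
  have "K00 - (K00 - A) = A" using assms by blast
  then show ?thesis using commute_diff [of "K00 - A"] fin(1) by simp
qed

end

section \<open>Arcs and closed curves\<close>

text \<open>Arcs and curves are sets without a chosen parametrization, since resolutions are unions
  of sets and circles their components.\<close>

definition arc_between :: "'a::real_normed_vector set \<Rightarrow> 'a \<Rightarrow> 'a \<Rightarrow> bool" where
  "arc_between A a b \<longleftrightarrow> (\<exists>g. arc g \<and> path_image g = A \<and> pathstart g = a \<and> pathfinish g = b)"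

definition closed_curve :: "'a::real_normed_vector set \<Rightarrow> bool" where
  "closed_curve C \<longleftrightarrow> (\<exists>g. simple_path g \<and> pathfinish g = pathstart g \<and> path_image g = C)"

lemma arc_betweenD:
  assumes "arc_between A a b"
  shows "a \<noteq> b" "a \<in> A" "b \<in> A" "compact A" "connected A" "closed A"
  using assms arc_distinct_ends compact_imp_closed [OF compact_arc_image]
  unfolding arc_between_def
  by (fastforce simp: compact_arc_image connected_arc_image)+

lemma closed_curveD:
  assumes "closed_curve C"
  shows "C \<noteq> {}" "compact C" "connected C" "closed C"
  using assms compact_imp_closed [OF compact_simple_path_image]
  unfolding closed_curve_def
  by (auto simp: compact_simple_path_image connected_simple_path_image)

lemma arc_between_commute: "arc_between A a b \<longleftrightarrow> arc_between A b a"
  unfolding arc_between_def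
  by (metis arc_reversepath path_image_reversepath pathfinish_reversepath pathstart_reversepath)

lemma arc_between_join:
  assumes "arc_between A a b" "arc_between B b c" "A \<inter> B = {b}"
  shows "arc_between (A \<union> B) a c"
proof -
  obtain g h where g: "arc g" "path_image g = A" "pathstart g = a" "pathfinish g = b"
    and h: "arc h" "path_image h = B" "pathstart h = b" "pathfinish h = c"
    using assms unfolding arc_between_def by blast
  then have "arc (g +++ h)"
    by (intro arc_join) (use assms in auto)
  then show ?thesis
    unfolding arc_between_def using g h
    by (intro exI [of _ "g +++ h"]) (auto simp: path_image_join)
qed

lemma closed_curve_join:
  assumes "arc_between A a b" "arc_between B b a" "A \<inter> B = {a, b}"
  shows "closed_curve (A \<union> B)"
proof -
  obtain g h where g: "arc g" "path_image g = A" "pathstart g = a" "pathfinish g = b"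
    and h: "arc h" "path_image h = B" "pathstart h = b" "pathfinish h = a"
    using assms unfolding arc_between_def by blast
  then have "simple_path (g +++ h)"
    by (intro simple_path_join_loop) (use assms in auto)
  then show ?thesis
    unfolding closed_curve_def using g h
    by (intro exI [of _ "g +++ h"]) (auto simp: path_image_join)
qed

lemma arc_between_image:
  assumes "arc_between A a b" "continuous_on A f" "inj_on f A"
  shows "arc_between (f ` A) (f a) (f b)"
proof -
  obtain g where g: "arc g" "path_image g = A" "pathstart g = a" "pathfinish g = b"
    using assms unfolding arc_between_def by blast
  have "arc (f \<circ> g)"
    using g assms unfolding arc_def
    by (auto simp: path_continuous_image path_image_def intro: comp_inj_on)
  then show ?thesis
    unfolding arc_between_def using g
    by (intro exI [of _ "f \<circ> g"]) (auto simp: path_image_compose pathstart_compose pathfinish_compose)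
qed

lemma closed_curve_image:
  assumes "closed_curve A" "continuous_on A f" "inj_on f A"
  shows "closed_curve (f ` A)"
proof -
  obtain g where g: "simple_path g" "pathfinish g = pathstart g" "path_image g = A"
    using assms unfolding closed_curve_def by blast
  have "path (f \<circ> g)"
    using g assms by (simp add: path_continuous_image simple_path_imp_path)
  moreover have "loop_free (f \<circ> g)"
    unfolding loop_free_def
  proof (intro ballI impI)
    fix x y :: real assume xy: "x \<in> {0..1}" "y \<in> {0..1}" and "(f \<circ> g) x = (f \<circ> g) y"
    then have "f (g x) = f (g y)" "g x \<in> A" "g y \<in> A"
      using g by (auto simp: path_image_def)
    then have "g x = g y" using assms(3) by (meson inj_onD)
    then show "x = y \<or> x = 0 \<and> y = 1 \<or> x = 1 \<and> y = 0"
      using g(1) xy unfolding simple_path_def loop_free_def by blast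
  qed
  ultimately have "simple_path (f \<circ> g)" by (simp add: simple_path_def)
  then show ?thesis
    unfolding closed_curve_def using g
    by (intro exI [of _ "f \<circ> g"]) (auto simp: path_image_compose pathstart_compose pathfinish_compose)
qed

lemma closed_curve_embedding:
  assumes "continuous_on (sphere 0 1) l" "inj_on l (sphere (0::complex) 1)"
  shows "closed_curve (l ` sphere 0 1)"
proof (rule closed_curve_image [OF _ assms])
  show "closed_curve (sphere (0::complex) 1)"
    unfolding closed_curve_def
    by (intro exI [of _ "circlepath 0 1"]) (simp add: simple_path_circlepath)
qed

section \<open>Cutting arcs and closed curves\<close>

lemma arc_between_simple_path:
  assumes "simple_path g" "0 \<le> s" "s < t" "t \<le> 1" "0 < s \<or> t < 1"
  shows "arc_between (g ` {s..t}) (g s) (g t)"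
proof -
  have "simple_path (subpath s t g)"
    using assms by (intro simple_path_subpath) auto
  moreover have "g s \<noteq> g t"
    using assms unfolding simple_path_def loop_free_def by force
  ultimately have "arc (subpath s t g)"
    by (simp add: arc_simple_path)
  then show ?thesis
    unfolding arc_between_def
    using assms by (intro exI [of _ "subpath s t g"]) (auto simp: path_image_subpath)
qed

text \<open>The inverse of \<open>h\<close> composed with a parametrization of \<open>T\<close> is
  continuous and injective from an interval to the line, hence its image is the segment between the
  parameters of the ends.\<close>

lemma subarc_interval:
  assumes "arc h" "arc_between T p q" "T \<subseteq> path_image h"
  obtains s t where "s \<in> {0..1}" "t \<in> {0..1}" "h s = p" "h t = q" "T = h ` closed_segment s t"
proof -
  obtain k where k: "homeomorphism {0..1} (path_image h) h k"
    using homeomorphism_arc [OF assms(1)] by blast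
  obtain g where g: "arc g" "path_image g = T" "pathstart g = p" "pathfinish g = q"
    using assms unfolding arc_between_def by blast
  have gin: "g x \<in> path_image h" if "x \<in> {0..1}" for x
    using that g(2) assms(3) by (auto simp: path_image_def)
  have hk: "h (k y) = y" "k y \<in> {0..1}" if "y \<in> path_image h" for y
    using k that unfolding homeomorphism_def by auto
  have "continuous_on (g ` {0..1}) k"
    using homeomorphism_cont2 [OF k] assms(3) g(2) continuous_on_subset
    unfolding path_image_def by blast
  then have "continuous_on {0..1} (k \<circ> g)"
    using g(1) by (intro continuous_on_compose) (auto simp: arc_def path_def)
  moreover have "inj_on (k \<circ> g) {0..1}"
  proof (rule inj_onI)
    fix x y assume xy: "x \<in> {0..1}" "y \<in> {0..1}" "(k \<circ> g) x = (k \<circ> g) y"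
    then have "h (k (g x)) = h (k (g y))" by simp
    then have "g x = g y" using hk(1) [OF gin [OF xy(1)]] hk(1) [OF gin [OF xy(2)]] by simp
    then show "x = y" using g(1) xy unfolding arc_def by (meson inj_onD)
  qed
  ultimately have im: "(k \<circ> g) ` closed_segment 0 1 = closed_segment ((k \<circ> g) 0) ((k \<circ> g) 1)"
    by (intro continuous_injective_image_segment_1) (simp_all add: closed_segment_eq_real_ivl)
  have "h ` (k \<circ> g) ` {0..1} = g ` {0..1}"
    using hk(1) gin by (force simp: image_image)
  moreover have "(k \<circ> g) ` {0..1} = closed_segment (k p) (k q)"
    using im g by (simp add: closed_segment_eq_real_ivl [of 0 1] pathstart_def pathfinish_def)
  ultimately have "T = h ` closed_segment (k p) (k q)"
    using g by (simp add: path_image_def)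
  moreover have "p \<in> path_image h" "q \<in> path_image h"
    using assms(3) arc_betweenD [OF assms(2)] by auto
  ultimately show ?thesis using that [of "k p" "k q"] hk by auto
qed

text \<open>A subarc that is the whole arc uses the whole parameter interval.\<close>

lemma arc_between_ends_unique:
  assumes "arc_between A a b" "arc_between A c d"
  shows "{a, b} = {c, d}"
proof -
  obtain h where h: "arc h" "path_image h = A" "pathstart h = a" "pathfinish h = b"
    using assms unfolding arc_between_def by blast
  obtain s t where st: "s \<in> {0..1}" "t \<in> {0..1}" "h s = c" "h t = d" "A = h ` closed_segment s t"
    using subarc_interval [OF h(1) assms(2)] h(2) by auto
  have inj: "inj_on h {0..1}" using h(1) by (simp add: arc_def)
  have sub: "closed_segment s t \<subseteq> {0..1}"
    using st(1,2) by (auto simp: closed_segment_eq_real_ivl split: if_splits)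
  have "h ` {0..1} = h ` closed_segment s t" using h(2) st(5) by (simp add: path_image_def)
  then have "closed_segment s t = {0..1}"
    using inj sub by (simp add: inj_on_image_eq_iff)
  then have "{s, t} = {0, 1}"
    by (auto simp: closed_segment_eq_real_ivl split: if_splits)
  then show ?thesis using st h by (auto simp: pathstart_def pathfinish_def doubleton_eq_iff)
qed

text \<open>Composing with the inverse of \<open>h\<close> would give a real function on the closed
  curve; by the intermediate value theorem it takes a value between \<open>f 0 = f 1\<close> and
  \<open>f (1/2)\<close> on both halves, against injectivity.\<close>

lemma closed_curve_not_arc:
  assumes "closed_curve C" shows "\<not> arc_between C a b"
proof
  assume "arc_between C a b"
  then obtain h where h: "arc h" "path_image h = C"
    unfolding arc_between_def by blast
  obtain g where g: "simple_path g" "pathfinish g = pathstart g" "path_image g = C"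
    using assms unfolding closed_curve_def by blast
  obtain k where k: "homeomorphism {0..1} C h k"
    using homeomorphism_arc [OF h(1)] h(2) by blast
  have gC: "g x \<in> C" if "x \<in> {0..1}" for x using that g(3) by (auto simp: path_image_def)
  define f where "f = k \<circ> g"
  have cont: "continuous_on {0..1} f"
    unfolding f_def using g homeomorphism_cont2 [OF k]
    by (intro continuous_on_compose) (auto simp: simple_path_def path_def path_image_def)
  have inj: "x = y \<or> x = 0 \<and> y = 1 \<or> x = 1 \<and> y = 0"
    if "x \<in> {0..1}" "y \<in> {0..1}" "f x = f y" for x y
  proof -
    have "g x = g y" using that k gC unfolding f_def homeomorphism_def by (metis comp_apply)
    then show ?thesis using g(1) that unfolding simple_path_def loop_free_def by blast
  qed
  have "f 0 = f 1" using g(2) by (simp add: f_def pathstart_def pathfinish_def)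
  define m where "m = (f 0 + f (1/2)) / 2"
  have mseg: "m \<in> closed_segment (f 0) (f (1/2))" "m \<in> closed_segment (f (1/2)) (f 1)"
    using \<open>f 0 = f 1\<close> by (auto simp: m_def closed_segment_eq_real_ivl)
  have "f 0 \<noteq> f (1/2)" using inj [of 0 "1/2"] by auto
  then have mne: "m \<noteq> f 0" "m \<noteq> f (1/2)" by (auto simp: m_def)
  have "\<exists>x\<in>closed_segment 0 (1/2). f x = m"
    using mseg(1) continuous_on_subset [OF cont]
    by (intro IVT'_closed_segment_real) (auto simp: closed_segment_eq_real_ivl)
  moreover have "\<exists>x\<in>closed_segment (1/2) 1. f x = m"
    using mseg(2) continuous_on_subset [OF cont]
    by (intro IVT'_closed_segment_real) (auto simp: closed_segment_eq_real_ivl)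
 ultimately obtain x y where xy: "x \<in> {0..1/2}" "y \<in> {1/2..1}" "f x = m" "f y = m"
    by (auto simp: closed_segment_eq_real_ivl)
  have "x \<noteq> 1/2" "y \<noteq> 1/2" using mne xy by metis+
  then show False using xy inj [of x y] mne \<open>f 0 = f 1\<close> by auto
qed

text \<open>The direction of \<open>T\<close> relative to \<open>A\<close> is unknown, so
  \<open>p'\<close> and \<open>q'\<close> are \<open>p\<close> and \<open>q\<close> in the order met
  from \<open>a\<close>.\<close>

lemma cut_arc:
  assumes A: "arc_between A a b" and T: "arc_between T p q" "T \<subseteq> A" "a \<notin> T" "b \<notin> T"
  obtains A1 A2 p' q' where "{p', q'} = {p, q}" "arc_between A1 a p'" "arc_between A2 q' b"
    "A1 \<inter> A2 = {}" "A1 \<union> A2 = (A - T) \<union> {p, q}"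
    "A1 \<inter> T = {p'}" "A2 \<inter> T = {q'}"
proof -
  obtain h where h: "arc h" "path_image h = A" "pathstart h = a" "pathfinish h = b"
    using A unfolding arc_between_def by blast
  obtain s t where st: "s \<in> {0..1}" "t \<in> {0..1}" "h s = p" "h t = q" "T = h ` closed_segment s t"
    using subarc_interval [OF h(1) T(1)] h(2) T(2) by auto
  have inj: "inj_on h {0..1}" using h(1) by (simp add: arc_def)
  have ab: "h 0 = a" "h 1 = b" using h by (auto simp: pathstart_def pathfinish_def)
  define u v where "u = min s t" and "v = max s t"
  have "s \<noteq> t" using arc_betweenD(1) [OF T(1)] st by auto
  then have uv: "0 \<le> u" "u < v" "v \<le> 1" "T = h ` {u..v}" "{h u, h v} = {p, q}"
    using st by (auto simp: u_def v_def closed_segment_eq_real_ivl min_def max_def)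
  have "u \<noteq> 0" "v \<noteq> 1" using uv ab T by (auto simp: image_iff)
  then have u: "0 < u" "v < 1" using uv by auto
  have sp: "simple_path h" using h(1) by (simp add: arc_imp_simple_path)
  have 1: "arc_between (h ` {0..u}) a (h u)" "arc_between (h ` {v..1}) (h v) b"
    using arc_between_simple_path [OF sp, of 0 u] arc_between_simple_path [OF sp, of v 1] u uv ab
    by auto
  have int: "h ` X \<inter> h ` Y = h ` (X \<inter> Y)" if "X \<subseteq> {0..1}" "Y \<subseteq> {0..1}" for X Y
    using inj that by (simp add: inj_on_image_Int)
  have "h ` {0..u} \<inter> h ` {v..1} = {}"
    using u uv by (subst int) auto
  moreover have "h ` {0..u} \<inter> T = {h u}"
    using u uv unfolding uv(4) by (subst int) (auto simp: Int_atLeastAtMost)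
  moreover have "h ` {v..1} \<inter> T = {h v}"
    using u uv unfolding uv(4) by (subst int) (auto simp: Int_atLeastAtMost)
  moreover have "h ` {0..u} \<union> h ` {v..1} = (A - T) \<union> {p, q}"
  proof -
    have "A - T = h ` ({0..1} - {u..v})"
      unfolding uv(4) h(2)[symmetric] path_image_def
      using u uv inj by (subst inj_on_image_set_diff [of h "{0..1}"]) auto
    moreover have "{0..1} - {u..v} \<union> {u, v} = {0..u} \<union> {v..1}"
      using u uv by auto
    ultimately show ?thesis unfolding uv(5)[symmetric] by (metis image_Un image_empty image_insert)
  qed
  ultimately show ?thesis using that [of "h u" "h v"] 1 uv(5) by auto
qed

text \<open>Started at a point \<open>c\<close> off \<open>T\<close>, the curve contains
  \<open>T\<close> within a shorter arc, to which \<open>cut_arc\<close> applies. The two remainders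
  are joined through the rest \<open>N\<close> of the curve, which passes through
  \<open>c\<close>.\<close>

lemma cut_closed_curve:
  assumes C: "closed_curve C" and T: "arc_between T p q" "T \<subseteq> C"
  shows "arc_between ((C - T) \<union> {p, q}) p q"
proof -
  have "C \<noteq> T" using closed_curve_not_arc [OF C] T by blast
  then obtain c where c: "c \<in> C" "c \<notin> T" using T by blast
  obtain g0 where g0: "simple_path g0" "pathfinish g0 = pathstart g0" "path_image g0 = C"
    using C unfolding closed_curve_def by blast
  obtain w where w: "w \<in> {0..1}" "g0 w = c" using c g0(3) by (auto simp: path_image_def)
  define g where "g = shiftpath w g0"
  have g: "simple_path g" "path_image g = C" "g 0 = c" "g 1 = c"
    using g0 w simple_path_shiftpath [of g0 w] path_image_shiftpath [of w g0]
      pathstart_shiftpath [of w g0] pathfinish_shiftpath [of w g0]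
    by (auto simp: g_def pathstart_def pathfinish_def)
  have gcont: "continuous_on {0..1} g" using g(1) by (simp add: simple_path_def path_def)
  define Q where "Q = {x \<in> {0..1}. g x \<in> T}"
  have "closed Q"
    unfolding Q_def
    using continuous_closed_preimage [OF gcont closed_atLeastAtMost arc_betweenD(6) [OF T(1)]]
    by (simp add: vimage_def Int_def)
  moreover have "Q \<subseteq> {0..1}" by (auto simp: Q_def)
  ultimately have Q: "compact Q" by (meson compact_Icc compact_Int_closed bounded_subset compact_eq_bounded_closed)
  have "p \<in> C" using T arc_betweenD by blast
  then have "Q \<noteq> {}" using g(2) arc_betweenD [OF T(1)] by (auto simp: Q_def path_image_def)
  then obtain s0 s1 where s: "s0 \<in> Q" "s1 \<in> Q" "\<And>x. x \<in> Q \<Longrightarrow> s0 \<le> x \<and> x \<le> s1"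
    using compact_attains_inf [OF Q] compact_attains_sup [OF Q] by metis
  have "s0 \<noteq> 0" "s1 \<noteq> 1" using s c g by (auto simp: Q_def)
  then have s01: "0 < s0" "s0 \<le> s1" "s1 < 1" using s by (auto simp: Q_def less_le)
  \<comment> \<open>Midpoints between the extreme parameters of \<open>T\<close> and the ends of the
    interval, so that \<open>T\<close> avoids the ends of the shorter arc.\<close>
  define u v where "u = s0/2" and "v = (1 + s1)/2"
  have uv: "0 < u" "u < v" "v < 1" "u < s0" "s1 < v" using s01 by (auto simp: u_def v_def)
  have "T \<subseteq> g ` {u..v}"
  proof
    fix y assume "y \<in> T"
    then obtain x where "x \<in> {0..1}" "y = g x" using T g(2) by (auto simp: path_image_def)
    then show "y \<in> g ` {u..v}" using \<open>y \<in> T\<close> s(3) [of x] uv by (force simp: Q_def)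
  qed
  moreover have "u \<notin> Q" "v \<notin> Q" using s uv by force+
  then have "g u \<notin> T" "g v \<notin> T" using uv by (auto simp: Q_def)
  moreover have mid: "arc_between (g ` {u..v}) (g u) (g v)"
    using arc_between_simple_path [OF g(1)] uv by auto
  ultimately obtain A1 A2 p' q' where cut: "{p', q'} = {p, q}" "arc_between A1 (g u) p'"
     "arc_between A2 q' (g v)" "A1 \<inter> A2 = {}" "A1 \<union> A2 = (g ` {u..v} - T) \<union> {p, q}"
     "A1 \<inter> T = {p'}" "A2 \<inter> T = {q'}"
    using cut_arc [OF _ T(1)] by metis
  have inj: "x = y \<or> x = 0 \<and> y = 1 \<or> x = 1 \<and> y = 0"
    if "x \<in> {0..1}" "y \<in> {0..1}" "g x = g y" for x y
    using g(1) that unfolding simple_path_def loop_free_def by blast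
  have "g ` {v..1} \<inter> g ` {0..u} = {c}"
  proof
    show "g ` {v..1} \<inter> g ` {0..u} \<subseteq> {c}"
    proof
      fix y assume "y \<in> g ` {v..1} \<inter> g ` {0..u}"
      then obtain x x' where "x \<in> {v..1}" "x' \<in> {0..u}" "y = g x" "y = g x'" by blast
      then show "y \<in> {c}" using inj [of x x'] uv g by auto
    qed
    show "{c} \<subseteq> g ` {v..1} \<inter> g ` {0..u}"
      using g uv by (metis IntI atLeastAtMost_iff empty_subsetI imageI insert_subset less_imp_le order_refl)
  qed
  then have out: "arc_between (g ` {v..1} \<union> g ` {0..u}) (g v) (g u)"
    using arc_between_simple_path [OF g(1), of v 1] arc_between_simple_path [OF g(1), of 0 u] uv g
    by (intro arc_between_join [where b = c]) auto
  define N where "N = g ` {v..1} \<union> g ` {0..u}"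
  have pq: "p \<in> T" "q \<in> T" "p' \<in> T" "q' \<in> T" using arc_betweenD [OF T(1)] cut(1) by auto
  have MN: "g ` {u..v} \<inter> N = {g u, g v}"
  proof
    show "g ` {u..v} \<inter> N \<subseteq> {g u, g v}"
    proof
      fix y assume "y \<in> g ` {u..v} \<inter> N"
      then obtain x x' where "x \<in> {u..v}" "x' \<in> {v..1} \<union> {0..u}" "y = g x" "y = g x'"
        unfolding N_def by blast
      then show "y \<in> {g u, g v}" using inj [of x x'] uv g by auto
    qed
    show "{g u, g v} \<subseteq> g ` {u..v} \<inter> N" using uv by (auto simp: N_def)
  qed
  have TN: "T \<inter> N = {}"
  proof -
    have "y \<in> {g u, g v}" if "y \<in> T" "y \<in> N" for y
      using that MN \<open>T \<subseteq> g ` {u..v}\<close> by blast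
    then show ?thesis using \<open>g u \<notin> T\<close> \<open>g v \<notin> T\<close> by auto
  qed
  have A12: "A1 \<subseteq> g ` {u..v}" "A2 \<subseteq> g ` {u..v}" using cut(5) pq \<open>T \<subseteq> g ` {u..v}\<close> by auto
  have gA: "g u \<in> A1" "g v \<in> A2" using cut(2,3) arc_betweenD by blast+
  have gN: "g u \<in> N" "g v \<in> N" using uv by (auto simp: N_def)
  have "x = g v" if "x \<in> A2" "x \<in> N" for x
  proof -
    have "x \<in> {g u, g v}" using that MN A12 by blast
    then show ?thesis using that gA cut(4) by auto
  qed
  then have "A2 \<inter> N = {g v}" using gA gN by blast
  then have B: "arc_between (A2 \<union> N) q' (g u)"
    using arc_between_join [OF cut(3) out [folded N_def]] by simp
  have "x = g u" if "x \<in> A1" "x \<in> N" for x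
  proof -
    have "x \<in> {g u, g v}" using that MN A12 by blast
    then show ?thesis using that gA cut(4) by auto
  qed
  then have "(A2 \<union> N) \<inter> A1 = {g u}" using gA gN cut(4) by blast
  then have fin: "arc_between (A2 \<union> N \<union> A1) q' p'"
    using arc_between_join [OF B cut(2)] by simp
  have CMN: "C = g ` {u..v} \<union> N"
  proof -
    have "{0..1} = {u..v} \<union> ({v..1} \<union> {0..u})" using uv by auto
    then show ?thesis unfolding g(2)[symmetric] path_image_def N_def by (metis image_Un)
  qed
  have "A2 \<union> N \<union> A1 = (C - T) \<union> {p, q}"
    using cut(5) CMN TN by blast
  with fin cut(1) show ?thesis
    by (metis arc_between_commute doubleton_eq_iff)
qed

text \<open>Empty for a closed curve and a pair for an arc, so the boundary points of a mixed union
  can be collected uniformly.\<close>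

definition ends :: "'a::real_normed_vector set \<Rightarrow> 'a set" where
  "ends C = {a. \<exists>b. arc_between C a b}"

lemma ends_arc: "arc_between C a b \<Longrightarrow> ends C = {a, b}"
  unfolding ends_def
  using arc_between_ends_unique [of C a b] arc_between_commute [of C] by (auto simp: doubleton_eq_iff) blast+

lemma ends_closed_curve: "closed_curve C \<Longrightarrow> ends C = {}"
  unfolding ends_def using closed_curve_not_arc by blast

lemma ends_subset: "ends C \<subseteq> C"
  unfolding ends_def using arc_betweenD by blast

section \<open>Compact curves with boundary under cutting and gluing\<close>

definition curve_or_arc :: "'a::real_normed_vector set \<Rightarrow> bool" where
  "curve_or_arc C \<longleftrightarrow> closed_curve C \<or> (\<exists>a b. arc_between C a b)"

lemma curve_or_arcD:
  assumes "curve_or_arc C"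
  shows "C \<noteq> {}" "compact C" "connected C" "closed C"
proof -
  have "C \<noteq> {} \<and> compact C \<and> connected C \<and> closed C"
    using assms unfolding curve_or_arc_def
  proof (elim disjE exE)
    assume "closed_curve C"
    from closed_curveD [OF this] show ?thesis by auto
  next
    fix a b assume "arc_between C a b"
    from arc_betweenD [OF this] show ?thesis by auto
  qed
  then show "C \<noteq> {}" "compact C" "connected C" "closed C" by simp_all
qed

text \<open>\<open>R\<close> plays the role of a compact one-dimensional manifold with boundary
  \<open>B\<close>; it is described through its components because these become the circles.\<close>

definition curves :: "'a::real_normed_vector set \<Rightarrow> 'a set \<Rightarrow> bool" where
  "curves R B \<longleftrightarrow> finite (components R) \<and> (\<forall>C\<in>components R. curve_or_arc C) \<and>
     B = (\<Union>C\<in>components R. ends C)"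

text \<open>By finiteness the union of the remaining members is closed, so a connected subset of the
  union that contains one member cannot meet another one.\<close>

lemma components_Union_closed:
  assumes "finite \<A>" "disjoint \<A>" "\<And>C. C \<in> \<A> \<Longrightarrow> closed C \<and> connected C \<and> C \<noteq> {}"
  shows "components (\<Union>\<A>) = \<A>"
proof -
  have sub: "C \<in> components (\<Union>\<A>)" if C: "C \<in> \<A>" for C
    unfolding in_components_maximal
  proof (intro conjI allI impI)
    show "C \<noteq> {}" "C \<subseteq> \<Union>\<A>" "connected C" using assms(3) C by blast+
    fix d assume d: "d \<noteq> {} \<and> C \<subseteq> d \<and> d \<subseteq> \<Union>\<A> \<and> connected d"
    have 1: "closed C" "closed (\<Union>(\<A> - {C}))" using assms C by auto
    have 2: "d \<subseteq> C \<union> \<Union>(\<A> - {C})" using d by auto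
    have 3: "C \<inter> \<Union>(\<A> - {C}) \<inter> d = {}" using assms(2) C by (auto simp: disjoint_def)
    have "C \<inter> d \<noteq> {}" using assms(3) C d by blast
    then have "\<Union>(\<A> - {C}) \<inter> d = {}"
      using d 1 2 3 unfolding connected_closed by metis
    then show "d = C" using 2 d by blast
  qed
  show ?thesis
  proof
    show "components (\<Union>\<A>) \<subseteq> \<A>"
    proof
      fix D assume D: "D \<in> components (\<Union>\<A>)"
      then have "D \<noteq> {}" "D \<subseteq> \<Union>\<A>"
        using in_components_nonempty in_components_subset by blast+
      then obtain x where "x \<in> D" "x \<in> \<Union>\<A>" by blast
      then obtain C where "C \<in> \<A>" "x \<in> C" by blast
      then show "D \<in> \<A>" using sub components_nonoverlap [OF D] \<open>x \<in> D\<close> by blast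
    qed
  qed (use sub in blast)
qed

lemma curvesI:
  assumes "finite \<A>" "disjoint \<A>" "\<And>C. C \<in> \<A> \<Longrightarrow> curve_or_arc C" "R = \<Union>\<A>"
    "B = (\<Union>C\<in>\<A>. ends C)"
  shows "components R = \<A>" "curves R B"
proof -
  show "components R = \<A>"
    unfolding assms(4)
  proof (rule components_Union_closed [OF assms(1,2)])
    show "closed C \<and> connected C \<and> C \<noteq> {}" if "C \<in> \<A>" for C
      using curve_or_arcD [OF assms(3) [OF that]] by simp
  qed
  then show "curves R B" unfolding curves_def using assms by simp
qed

lemma disjoint_components: "disjoint (components R)"
  using pairwise_disjoint_components [of R] by (simp add: pairwise_def disjnt_def)

lemma curves_image:
  assumes "curves R B" "continuous_on R f" "inj_on f R"
  shows "curves (f ` R) (f ` B)"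
proof (rule curvesI(2) [of "(`) f ` components R"])
  have fin: "finite (components R)" and ca: "\<And>C. C \<in> components R \<Longrightarrow> curve_or_arc C"
    and B: "B = (\<Union>C\<in>components R. ends C)"
    using assms by (auto simp: curves_def)
  have sub: "C \<subseteq> R" if "C \<in> components R" for C using that by (rule in_components_subset)
  have cont: "continuous_on C f" "inj_on f C" if "C \<in> components R" for C
    using assms sub [OF that] continuous_on_subset inj_on_subset by blast+
  show "finite ((`) f ` components R)" using fin by simp
  show "disjoint ((`) f ` components R)"
    unfolding disjoint_def
  proof (intro ballI impI)
    fix X Y assume "X \<in> (`) f ` components R" "Y \<in> (`) f ` components R" "X \<noteq> Y"
    then obtain C D where CD: "C \<in> components R" "D \<in> components R" "X = f ` C" "Y = f ` D" "C \<noteq> D"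
      by blast
    then have "f ` C \<inter> f ` D = f ` (C \<inter> D)"
      using inj_on_image_Int [OF assms(3)] sub by simp
    then show "X \<inter> Y = {}" using CD disjoint_components unfolding disjoint_def by blast
  qed
  show "curve_or_arc X" if "X \<in> (`) f ` components R" for X
    using that ca cont closed_curve_image arc_between_image unfolding curve_or_arc_def by blast
  show "f ` R = \<Union> ((`) f ` components R)" by (metis Union_components image_Union)
  have "ends (f ` C) = f ` ends C" if C: "C \<in> components R" for C
    using ca [OF C] unfolding curve_or_arc_def
  proof (elim disjE exE)
    assume "closed_curve C"
    then show ?thesis using closed_curve_image cont [OF C] ends_closed_curve by (metis image_empty)
  next
    fix a b assume "arc_between C a b"
    then show ?thesis using arc_between_image [OF _ cont [OF C]] ends_arc by (metis image_empty image_insert)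
  qed
  then have "(\<Union>C\<in>components R. ends (f ` C)) = (\<Union>C\<in>components R. f ` ends C)" by simp
  then show "f ` B = (\<Union>C\<in>(`) f ` components R. ends C)" by (simp add: B image_UN)
qed

lemma UN_diff_disjoint:
  assumes "\<C> \<subseteq> K" "\<And>C C'. C \<in> K - \<C> \<Longrightarrow> C' \<in> \<C> \<Longrightarrow> f C \<inter> f C' = {}"
  shows "(\<Union>C\<in>K. f C) - (\<Union>C\<in>\<C>. f C) = (\<Union>C\<in>K - \<C>. f C)"
  using assms by fast

text \<open>The common form of cutting and gluing: some components are exchanged for new ones and
  the rest, with its ends, is kept.\<close>

lemma curves_replace:
  assumes R: "curves R B" and old: "\<C> \<subseteq> components R"
    and new: "finite \<D>" "disjoint \<D>" "\<And>D. D \<in> \<D> \<Longrightarrow> curve_or_arc D"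
      "\<Union>\<D> \<inter> \<Union>(components R - \<C>) = {}"
    and R': "R' = \<Union>(components R - \<C>) \<union> \<Union>\<D>"
    and B': "B' = (B - (\<Union>C\<in>\<C>. ends C)) \<union> (\<Union>D\<in>\<D>. ends D)"
  shows "components R' = (components R - \<C>) \<union> \<D>" "curves R' B'"
proof -
  have fin: "finite (components R)" and ca: "\<And>C. C \<in> components R \<Longrightarrow> curve_or_arc C"
    and B: "B = (\<Union>C\<in>components R. ends C)"
    using R by (auto simp: curves_def)
  have d: "disjoint (components R - \<C> \<union> \<D>)"
    using new(2,4) pairwise_subset [OF disjoint_components [of R]]
    by (intro disjoint_union) (simp_all add: Int_commute)
  have "ends C \<inter> ends C' = {}" if "C \<in> components R - \<C>" "C' \<in> \<C>" for C C'
  proof -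
    have "C \<inter> C' = {}"
      using that old by (intro disjointD [OF disjoint_components [of R]]) auto
    then show ?thesis using ends_subset [of C] ends_subset [of C'] by auto
  qed
  from UN_diff_disjoint [OF old, of ends, OF this]
  have "B' = (\<Union>C\<in>components R - \<C> \<union> \<D>. ends C)"
    by (simp add: B B' UN_Un)
  moreover have "finite (components R - \<C> \<union> \<D>)" using fin new by simp
  moreover have "curve_or_arc C" if "C \<in> components R - \<C> \<union> \<D>" for C
    using that ca new(3) by blast
  moreover have "R' = \<Union>(components R - \<C> \<union> \<D>)" unfolding R' by simp
  ultimately show "components R' = (components R - \<C>) \<union> \<D>" "curves R' B'"
    using curvesI [OF _ d, of R' B'] by blast+
qed

lemma components_Union_diff:
  assumes "\<C> \<subseteq> components R"
  shows "\<Union>(components R - \<C>) = R - \<Union>\<C>"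
proof -
  have "C \<inter> C' = {}" if "C \<in> components R - \<C>" "C' \<in> \<C>" for C C'
    using that assms by (intro disjointD [OF disjoint_components [of R]]) auto
  from UN_diff_disjoint [OF assms, of "\<lambda>C. C", OF this] show ?thesis
    by (metis Union_components image_ident)
qed

text \<open>\<open>T\<close> is connected and so lies in one component; it avoids \<open>B\<close>,
  so it is interior to that component. The points \<open>p\<close> and \<open>q\<close> stay and
  become boundary points.\<close>

lemma curves_cut:
  assumes R: "curves R B" and T: "arc_between T p q" "T \<subseteq> R" "T \<inter> B = {}"
  shows "curves ((R - T) \<union> {p, q}) (B \<union> {p, q})"
proof -
  have ca: "\<And>C. C \<in> components R \<Longrightarrow> curve_or_arc C" and B: "B = (\<Union>C\<in>components R. ends C)"
    using R by (auto simp: curves_def)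
  note T' = arc_betweenD [OF T(1)]
  obtain C where C: "C \<in> components R" "T \<subseteq> C"
    using exists_component_superset [of T R] T T' by blast
  have CR: "C \<subseteq> R" using C(1) by (rule in_components_subset)
  have U: "\<Union>(components R - {C}) = R - C" using components_Union_diff [of "{C}" R] C by simp
  from ca [OF C(1)] show ?thesis
    unfolding curve_or_arc_def
  proof (elim disjE exE)
    assume cc: "closed_curve C"
    note N = cut_closed_curve [OF cc T(1) C(2)]
    show ?thesis
    proof (rule curves_replace(2) [OF R, of "{C}" "{(C - T) \<union> {p, q}}"])
      show "R - T \<union> {p, q} = \<Union> (components R - {C}) \<union> \<Union> {C - T \<union> {p, q}}"
        unfolding U using C CR by auto
      show "\<Union> {C - T \<union> {p, q}} \<inter> \<Union> (components R - {C}) = {}"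
        unfolding U using C T' by auto
      show "B \<union> {p, q} = B - (\<Union>C\<in>{C}. ends C) \<union> (\<Union>D\<in>{C - T \<union> {p, q}}. ends D)"
        using ends_closed_curve [OF cc] ends_arc [OF N] by simp
    qed (use C N in \<open>auto simp: curve_or_arc_def\<close>)
  next
    fix a b assume ar: "arc_between C a b"
    have abB: "{a, b} \<subseteq> B" using ends_arc [OF ar] B C by auto
    then have "a \<notin> T" "b \<notin> T" using T by auto
    from cut_arc [OF ar T(1) C(2) this]
    obtain A1 A2 p' q' where cut: "{p', q'} = {p, q}" "arc_between A1 a p'" "arc_between A2 q' b"
      "A1 \<inter> A2 = {}" "A1 \<union> A2 = (C - T) \<union> {p, q}" by metis
    show ?thesis
    proof (rule curves_replace(2) [OF R, of "{C}" "{A1, A2}"])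
      have "\<Union>{A1, A2} = (C - T) \<union> {p, q}" using cut by simp
      then show "R - T \<union> {p, q} = \<Union> (components R - {C}) \<union> \<Union> {A1, A2}"
         "\<Union> {A1, A2} \<inter> \<Union> (components R - {C}) = {}"
        unfolding U using C T' CR by auto
      show "disjoint {A1, A2}" using cut(4) by (auto simp: disjoint_def)
      show "B \<union> {p, q} = B - (\<Union>C\<in>{C}. ends C) \<union> (\<Union>D\<in>{A1, A2}. ends D)"
        using ends_arc [OF ar] ends_arc [OF cut(2)] ends_arc [OF cut(3)] cut(1) abB by auto
    qed (use C cut in \<open>auto simp: curve_or_arc_def\<close>)
  qed
qed

text \<open>Gluing must determine the components themselves: whether the chords join the ends of one
  arc or of two decides later between splitting and merging.\<close>

lemma components_glue_same:
  assumes R: "curves R B" and A: "A \<in> components R" "arc_between A a b"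
    and e: "arc_between e a b" "e \<inter> R = {a, b}"
  shows "components (R \<union> e) = components R - {A} \<union> {A \<union> e}" "closed_curve (A \<union> e)"
    "curves (R \<union> e) (B - {a, b})"
proof -
  note A' = arc_betweenD [OF A(2)]
  have AR: "A \<subseteq> R" using A(1) by (rule in_components_subset)
  have U: "\<Union>(components R - {A}) = R - A" using components_Union_diff [of "{A}" R] A by simp
  have "e \<inter> A = (e \<inter> R) \<inter> A" using AR by blast
  then have "A \<inter> e = {a, b}" using A'(2,3) unfolding e(2) by (simp add: Int_commute)
  then show cc: "closed_curve (A \<union> e)"
    using closed_curve_join [OF A(2), of e] e(1) arc_between_commute [of e a b] by simp
  have "R \<union> e = \<Union>(components R - {A}) \<union> \<Union>{A \<union> e}" "\<Union>{A \<union> e} \<inter> \<Union>(components R - {A}) = {}"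
     "B - {a, b} = B - (\<Union>C\<in>{A}. ends C) \<union> (\<Union>C\<in>{A \<union> e}. ends C)"
    unfolding U using e(2) AR A'(2,3) ends_arc [OF A(2)] ends_closed_curve [OF cc] by auto
  with cc A show "components (R \<union> e) = components R - {A} \<union> {A \<union> e}" "curves (R \<union> e) (B - {a, b})"
    by (intro curves_replace [OF R, of "{A}" "{A \<union> e}"]; auto simp: curve_or_arc_def)+
qed

lemma inter_endpoint:
  assumes "e \<inter> R = {a, b}" "A \<subseteq> R" "a \<in> A" "b \<in> A2" "A \<inter> A2 = {}" shows "A \<inter> e = {a}"
proof -
  have "x = a" if "x \<in> A" "x \<in> e" for x
  proof -
    have "x \<in> {a, b}" unfolding assms(1)[symmetric] using that assms(2) by (simp add: subsetD)
    moreover have "x \<noteq> b" using that assms(4,5) by (metis IntI empty_iff)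
    ultimately show ?thesis by simp
  qed
  moreover have "a \<in> e" using assms(1) by (metis Int_iff insertI1)
  ultimately show ?thesis using assms(3) by blast
qed

lemma components_glue_distinct:
  assumes R: "curves R B" and A: "A \<in> components R" "arc_between A a' a"
    and A2: "A2 \<in> components R" "arc_between A2 b b'" "A \<noteq> A2"
    and e: "arc_between e a b" "e \<inter> R = {a, b}"
  shows "components (R \<union> e) = components R - {A, A2} \<union> {A \<union> e \<union> A2}" "arc_between (A \<union> e \<union> A2) a' b'"
    "curves (R \<union> e) (B - {a, b})"
proof -
  note A' = arc_betweenD [OF A(2)] and A2' = arc_betweenD [OF A2(2)]
  have AR: "A \<subseteq> R" "A2 \<subseteq> R" using A(1) A2(1) by (simp_all add: in_components_subset)
  have dis: "A \<inter> A2 = {}" by (rule disjointD [OF disjoint_components A(1) A2(1,3)])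
  have U: "\<Union>(components R - {A, A2}) = R - (A \<union> A2)"
    using components_Union_diff [of "{A, A2}" R] A A2 by simp
  have "A \<inter> e = {a}" by (rule inter_endpoint [OF e(2) AR(1) A'(3) A2'(2) dis])
  then have 1: "arc_between (A \<union> e) a' b" by (rule arc_between_join [OF A(2) e(1)])
  have "e \<inter> R = {b, a}" "A2 \<inter> A = {}" using e(2) dis by (simp_all add: insert_commute Int_commute)
  from inter_endpoint [OF this(1) AR(2) A2'(2) A'(3) this(2)]
  have "(A \<union> e) \<inter> A2 = {b}" using dis by (simp add: Int_Un_distrib Int_commute)
  then show 2: "arc_between (A \<union> e \<union> A2) a' b'" by (rule arc_between_join [OF 1 A2(2)])
  have "ends A \<subseteq> B" "ends A2 \<subseteq> B" using R A(1) A2(1) by (auto simp: curves_def)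
  then have abB: "{a, b, a', b'} \<subseteq> B" using ends_arc [OF A(2)] ends_arc [OF A2(2)] by auto
  have ne: "a' \<noteq> a" "a' \<noteq> b" "b' \<noteq> a" "b' \<noteq> b" using A' A2' dis by auto
  have "R \<union> e = \<Union>(components R - {A, A2}) \<union> \<Union>{A \<union> e \<union> A2}"
     "\<Union>{A \<union> e \<union> A2} \<inter> \<Union>(components R - {A, A2}) = {}"
    unfolding U using e(2) AR A'(2,3) A2'(2,3) by auto
  moreover have "B - {a, b} = B - (\<Union>C\<in>{A, A2}. ends C) \<union> (\<Union>C\<in>{A \<union> e \<union> A2}. ends C)"
    using abB ne ends_arc [OF A(2)] ends_arc [OF A2(2)] ends_arc [OF 2] by auto
  ultimately show "components (R \<union> e) = components R - {A, A2} \<union> {A \<union> e \<union> A2}" "curves (R \<union> e) (B - {a, b})"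
    using 2 A A2
    by (intro curves_replace [OF R, of "{A, A2}" "{A \<union> e \<union> A2}"]; auto simp: curve_or_arc_def)+
qed

lemma curves_end_arc:
  assumes "curves R B" "a \<in> B"
  obtains A b where "A \<in> components R" "arc_between A a b" "b \<in> B"
proof -
  obtain A where A: "A \<in> components R" "a \<in> ends A" and "ends A \<subseteq> B"
    using assms unfolding curves_def by auto
  moreover obtain b where "arc_between A a b" using A unfolding ends_def by auto
  moreover have "b \<in> ends A" using ends_arc [OF \<open>arc_between A a b\<close>] by simp
  ultimately show ?thesis using that by auto
qed

lemma curves_glue:
  assumes R: "curves R B" and e: "arc_between e a b" "e \<inter> R = {a, b}" and ab: "a \<in> B" "b \<in> B"
  shows "curves (R \<union> e) (B - {a, b})"
proof -
  obtain A c where A: "A \<in> components R" "arc_between A a c" using curves_end_arc [OF R ab(1)] .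
  obtain A2 d where A2: "A2 \<in> components R" "arc_between A2 b d" using curves_end_arc [OF R ab(2)] .
  show ?thesis
  proof (cases "A = A2")
    case True
    then have "{a, c} = {b, d}" using arc_between_ends_unique A A2 by metis
    then have "c = b" using arc_betweenD(1) [OF e(1)] by (auto simp: doubleton_eq_iff)
    then show ?thesis using components_glue_same(3) [OF R A(1) _ e] A by simp
  next
    case False
    then show ?thesis
      using components_glue_distinct(3) [OF R A(1) _ A2 False e] A(2) arc_between_commute by blast
  qed
qed

section \<open>Winding numbers at a crossing\<close>

text \<open>The loop contracts in the convex set, and \<open>\<phi>\<close> carries the contraction
  into the complement of \<open>p\<close>.\<close>

lemma winding_number_convex_image:
  fixes \<phi> :: "complex \<Rightarrow> complex"
  assumes "convex S" "continuous_on S \<phi>" "path l" "path_image l \<subseteq> S" "pathfinish l = pathstart l"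
    and "p \<notin> \<phi> ` S"
  shows "winding_number (\<phi> \<circ> l) p = 0"
proof -
  define a where "a = pathstart l"
  have a: "a \<in> S" unfolding a_def using assms(4) by (auto simp: pathstart_in_path_image)
  have "simply_connected S" using assms(1) by (rule convex_imp_simply_connected)
  then have "homotopic_loops S l (linepath a a)"
    using assms(3-5) a unfolding simply_connected_eq_contractible_loop_any by blast
  then have "homotopic_loops (- {p}) (\<phi> \<circ> l) (\<phi> \<circ> linepath a a)"
    by (rule homotopic_loops_continuous_image) (use assms in auto)
  then have "winding_number (\<phi> \<circ> l) p = winding_number (\<phi> \<circ> linepath a a) p"
    by (rule winding_number_homotopic_loops)
  also have "\<phi> \<circ> linepath a a = linepath (\<phi> a) (\<phi> a)"
    by (auto simp: linepath_def fun_eq_iff simp flip: scaleR_add_left)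
  also have "winding_number (linepath (\<phi> a) (\<phi> a)) p = 0"
    using a assms(6) by (intro winding_number_trivial) auto
  finally show ?thesis .
qed

lemma reversepath_compose: "reversepath (\<phi> \<circ> l) = \<phi> \<circ> reversepath l"
  by (simp add: reversepath_def comp_def)

text \<open>\<open>l\<close> followed by the reverse of \<open>m\<close> is a loop in the convex
  set. This permits pushing a chord across any convex piece of the chart whose image avoids
  \<open>p\<close>.\<close>

lemma winding_number_chord:
  fixes \<phi> :: "complex \<Rightarrow> complex"
  assumes S: "convex S" "continuous_on S \<phi>" and l: "path l" "path_image l \<subseteq> S" and m: "path m" "path_image m \<subseteq> S"
    and ends: "pathstart l = pathstart m" "pathfinish l = pathfinish m" and p: "p \<notin> \<phi> ` S"
  shows "winding_number (\<phi> \<circ> l) p = winding_number (\<phi> \<circ> m) p"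
proof -
  have c: "path (\<phi> \<circ> k)" "p \<notin> path_image (\<phi> \<circ> k)" if "path k" "path_image k \<subseteq> S" for k
  proof -
    show "path (\<phi> \<circ> k)" using that continuous_on_subset [OF S(2)] by (intro path_continuous_image)
    show "p \<notin> path_image (\<phi> \<circ> k)" unfolding path_image_compose using that(2) p by blast
  qed
  have "winding_number (\<phi> \<circ> (l +++ reversepath m)) p = 0"
    using l m ends p by (intro winding_number_convex_image [OF S]) (auto simp: path_image_join)
  moreover have "winding_number (\<phi> \<circ> (l +++ reversepath m)) p = winding_number (\<phi> \<circ> l) p - winding_number (\<phi> \<circ> m) p"
    unfolding path_compose_join reversepath_compose [symmetric] using c [OF l] c [OF m] ends
    by (simp add: winding_number_join winding_number_reversepath pathstart_compose pathfinish_compose)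
  ultimately show ?thesis by simp
qed

lemma path_compose_cball:
  assumes "continuous_on (cball 0 1) \<phi>" "path l" "path_image l \<subseteq> cball (0::complex) 1"
  shows "path (\<phi> \<circ> l)"
  using assms path_continuous_image continuous_on_subset by blast

lemma linepath_in_cball:
  assumes "a \<in> cball (0::complex) 1" "b \<in> cball 0 1"
  shows "path_image (linepath a b) \<subseteq> cball 0 1"
  using assms by (simp add: closed_segment_subset)

text \<open>By additivity on triangles both sides equal the sum for the paths from \<open>b\<close>
  to \<open>a\<close>, from \<open>d\<close> to \<open>a\<close> and from \<open>a\<close> to
  \<open>c\<close>.\<close>

lemma winding_number_quadrilateral:
  fixes \<phi> :: "complex \<Rightarrow> complex"
  assumes "continuous_on (cball 0 1) \<phi>" "{a, b, c, d} \<subseteq> cball 0 1" "p \<notin> \<phi> ` cball 0 1"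
  shows "winding_number (\<phi> \<circ> linepath b a) p + winding_number (\<phi> \<circ> linepath d c) p =
    winding_number (\<phi> \<circ> linepath d a) p + winding_number (\<phi> \<circ> linepath b c) p"
proof -
  have q: "a \<in> cball 0 1" "b \<in> cball 0 1" "c \<in> cball 0 1" "d \<in> cball 0 1" using assms(2) by auto
  have triangle: "winding_number (\<phi> \<circ> linepath x y) p + winding_number (\<phi> \<circ> linepath y z) p = winding_number (\<phi> \<circ> linepath x z) p"
    if xyz: "x \<in> cball 0 1" "y \<in> cball 0 1" "z \<in> cball 0 1" for x y z
  proof -
    have *: "path (\<phi> \<circ> linepath x y)" "p \<notin> path_image (\<phi> \<circ> linepath x y)"
      if "x \<in> cball 0 1" "y \<in> cball 0 1" for x y
    proof -
      note l = linepath_in_cball [OF that]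
      show "path (\<phi> \<circ> linepath x y)" by (rule path_compose_cball [OF assms(1) _ l]) simp
      show "p \<notin> path_image (\<phi> \<circ> linepath x y)"
        unfolding path_image_compose using image_mono [OF l, of \<phi>] assms(3) by (rule contra_subsetD)
    qed
    have "path_image (linepath x y +++ linepath y z) \<subseteq> cball 0 1"
      by (rule subset_path_image_join) (rule linepath_in_cball xyz)+
    then have "winding_number (\<phi> \<circ> (linepath x y +++ linepath y z)) p = winding_number (\<phi> \<circ> linepath x z) p"
      using linepath_in_cball [OF xyz(1,3)]
      by (intro winding_number_chord [OF convex_cball assms(1)]) (simp_all add: assms(3))
    then show ?thesis
      using * xyz by (simp add: path_compose_join winding_number_join pathstart_compose pathfinish_compose)
  qed
  show ?thesis
    unfolding triangle [OF q(2,1,3), symmetric] triangle [OF q(4,1,3), symmetric] by (simp only: ac_simps)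
qed

text \<open>The winding number is 1 or -1 inside and 0 outside. Parity forgets the sign, so pieces
  of curves may be assembled in whatever direction they are given.\<close>

lemma inside_closed_curve_iff_odd:
  assumes "simple_path g" "pathfinish g = pathstart g" "p \<notin> path_image g"
  obtains n :: int where "winding_number g p = of_int n" "p \<in> inside (path_image g) \<longleftrightarrow> odd n"
proof (cases "p \<in> inside (path_image g)")
  case True
  have "winding_number g p = of_int 1 \<or> winding_number g p = of_int (-1)"
  proof (rule simple_closed_path_winding_number_inside [OF assms(1)])
    assume "\<And>z. z \<in> inside (path_image g) \<Longrightarrow> winding_number g z = 1"
    from this [OF True] show ?thesis by simp
  next
    assume "\<And>z. z \<in> inside (path_image g) \<Longrightarrow> winding_number g z = -1"
    from this [OF True] show ?thesis by simp
  qed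
  then show ?thesis
  proof
    assume "winding_number g p = of_int 1"
    then show ?thesis using True by (intro that [of 1]) simp_all
  next
    assume "winding_number g p = of_int (-1)"
    then show ?thesis using True by (intro that [of "-1"]) simp_all
  qed
next
  case False
  then have "p \<in> outside (path_image g)" using assms(3) inside_Un_outside by blast
  then have "winding_number g p = 0"
    using winding_number_zero_in_outside assms by (meson simple_path_imp_path)
  then show ?thesis using that [of 0] False by simp
qed

text \<open>The winding numbers of the single arcs are in general just complex numbers; it is their
  sum that is an integer.\<close>

lemma inside_join_iff_odd:
  assumes "arc g" "arc h" "pathfinish g = pathstart h" "pathfinish h = pathstart g"
    and "path_image g \<inter> path_image h \<subseteq> {pathstart g, pathstart h}"
    and "p \<notin> path_image g" "p \<notin> path_image h"
  obtains n :: int where "winding_number g p + winding_number h p = of_int n"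
    "p \<in> inside (path_image g \<union> path_image h) \<longleftrightarrow> odd n"
proof -
  have "simple_path (g +++ h)" using assms by (intro simple_path_join_loop) auto
  moreover have "path_image (g +++ h) = path_image g \<union> path_image h"
    using assms by (simp add: path_image_join)
  moreover have "winding_number (g +++ h) p = winding_number g p + winding_number h p"
    using assms by (simp add: winding_number_join arc_imp_path)
  ultimately show ?thesis
    using inside_closed_curve_iff_odd [of "g +++ h" p] that assms by auto
qed

text \<open>
  The winding number of the new curve differs from the sum of the old ones by that of a
  quadrilateral in the disk, which is 0.
\<close>
lemma inside_merge:
  fixes \<phi> :: "complex \<Rightarrow> complex"
  assumes \<phi>: "continuous_on (cball 0 1) \<phi>" "inj_on \<phi> (cball 0 1)"
    and q: "{a, b, c, d} \<subseteq> cball 0 1" "distinct [a, b, c, d]"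
      "closed_segment a d \<inter> closed_segment b c = {}" "closed_segment a b \<inter> closed_segment c d = {}"
    and g1: "arc g1" "pathstart g1 = \<phi> a" "pathfinish g1 = \<phi> d"
      "path_image g1 \<inter> \<phi> ` cball 0 1 = {\<phi> a, \<phi> d}"
    and g2: "arc g2" "pathstart g2 = \<phi> c" "pathfinish g2 = \<phi> b"
      "path_image g2 \<inter> \<phi> ` cball 0 1 = {\<phi> c, \<phi> b}"
    and dis: "path_image g1 \<inter> path_image g2 = {}"
    and p: "p \<notin> \<phi> ` cball 0 1" "p \<notin> path_image g1" "p \<notin> path_image g2"
  shows "p \<in> inside (path_image g1 \<union> \<phi> ` closed_segment c d \<union> path_image g2 \<union> \<phi> ` closed_segment a b) \<longleftrightarrow>
     (p \<in> inside (path_image g1 \<union> \<phi> ` closed_segment a d)) \<noteq>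
     (p \<in> inside (path_image g2 \<union> \<phi> ` closed_segment b c))"
proof -
  define L where "L x y = \<phi> \<circ> linepath x y" for x y
  define Q where "Q = {a, b, c, d}"
  have seg: "closed_segment x y \<subseteq> cball 0 1" if "x \<in> Q" "y \<in> Q" for x y
    using that q(1) unfolding Q_def by (intro closed_segment_subset) auto
  have L: "arc (L x y)" "path_image (L x y) = \<phi> ` closed_segment x y" "pathstart (L x y) = \<phi> x"
     "pathfinish (L x y) = \<phi> y" "p \<notin> path_image (L x y)" "path_image (L x y) \<subseteq> \<phi> ` cball 0 1"
    if "x \<in> Q" "y \<in> Q" "x \<noteq> y" for x y
  proof -
    note s = seg [OF that(1,2)]
    show im: "path_image (L x y) = \<phi> ` closed_segment x y" unfolding L_def by (simp add: path_image_compose)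
    show "pathstart (L x y) = \<phi> x" "pathfinish (L x y) = \<phi> y"
      unfolding L_def by (simp_all add: pathstart_compose pathfinish_compose)
    show "p \<notin> path_image (L x y)" "path_image (L x y) \<subseteq> \<phi> ` cball 0 1" unfolding im using s p by auto
    show "arc (L x y)" unfolding L_def arc_def
    proof
      show "path (\<phi> \<circ> linepath x y)" using path_compose_cball [OF \<phi>(1), of "linepath x y"] s by simp
      have "inj_on \<phi> (linepath x y ` {0..1})"
        using inj_on_subset [OF \<phi>(2) s] by (simp add: linepath_image_01)
      then show "inj_on (\<phi> \<circ> linepath x y) {0..1}"
        using that(3) by (intro comp_inj_on) (auto simp: inj_on_linepath)
    qed
  qed
  have ends_in: "\<phi> x \<in> path_image (L x y)" "\<phi> y \<in> path_image (L x y)"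
    if "x \<in> Q" "y \<in> Q" "x \<noteq> y" for x y
    using L [OF that] by auto
  have LL: "path_image (L x y) \<inter> path_image (L z w) = {}"
    if "closed_segment x y \<inter> closed_segment z w = {}" "x \<in> Q" "y \<in> Q" "x \<noteq> y"
     "z \<in> Q" "w \<in> Q" "z \<noteq> w" for x y z w
  proof -
    have "path_image (L x y) \<inter> path_image (L z w) = \<phi> ` (closed_segment x y \<inter> closed_segment z w)"
      unfolding L(2) [OF that(2-4)] L(2) [OF that(5-7)]
      by (rule inj_on_image_Int [OF \<phi>(2) seg [OF that(2,3)] seg [OF that(5,6)], symmetric])
    then show ?thesis using that by simp
  qed
  have ne: "a \<noteq> b" "a \<noteq> c" "a \<noteq> d" "b \<noteq> c" "b \<noteq> d" "c \<noteq> d" using q(2) by auto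
  have Q: "a \<in> Q" "b \<in> Q" "c \<in> Q" "d \<in> Q" by (auto simp: Q_def)
  note Lda = L [OF Q(4,1) ne(3)[symmetric]] and Lbc = L [OF Q(2,3) ne(4)]
    and Ldc = L [OF Q(4,3) ne(6)[symmetric]] and Lba = L [OF Q(2,1) ne(1)[symmetric]]
  have g1L: "path_image g1 \<inter> path_image (L x y) \<subseteq> {\<phi> a, \<phi> d}"
    and g2L: "path_image g2 \<inter> path_image (L x y) \<subseteq> {\<phi> c, \<phi> b}"
    if "x \<in> Q" "y \<in> Q" "x \<noteq> y" for x y
    using L(6) [OF that] g1(4) g2(4) by (metis Int_mono order_refl)+
  obtain u where u: "winding_number g1 p + winding_number (L d a) p = of_int u"
      "p \<in> inside (path_image g1 \<union> path_image (L d a)) \<longleftrightarrow> odd u"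
    by (rule inside_join_iff_odd [of g1 "L d a" p]) (use g1 Lda g1L [OF Q(4,1) ne(3)[symmetric]] p in auto)
  obtain v where v: "winding_number g2 p + winding_number (L b c) p = of_int v"
      "p \<in> inside (path_image g2 \<union> path_image (L b c)) \<longleftrightarrow> odd v"
    by (rule inside_join_iff_odd [of g2 "L b c" p]) (use g2 Lbc g2L [OF Q(2,3) ne(4)] p in auto)
  \<comment> \<open>The merged curve runs along \<open>g1\<close>, over the chord from
    \<open>d\<close> to \<open>c\<close>, along \<open>g2\<close>, and back over the chord from
    \<open>b\<close> to \<open>a\<close>. It is assembled in stages, each of them an arc until the
    last chord closes it.\<close>
  define h where "h = g1 +++ L d c"
  have notin: "\<phi> c \<notin> path_image g1" "\<phi> a \<notin> path_image g2" "\<phi> b \<notin> path_image g1" "\<phi> d \<notin> path_image g2"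
  proof -
    have "\<phi> a \<in> path_image g1" "\<phi> d \<in> path_image g1" using g1 by (metis pathstart_in_path_image pathfinish_in_path_image)+
    moreover have "\<phi> c \<in> path_image g2" "\<phi> b \<in> path_image g2" using g2 by (metis pathstart_in_path_image pathfinish_in_path_image)+
    ultimately show "\<phi> c \<notin> path_image g1" "\<phi> a \<notin> path_image g2" "\<phi> b \<notin> path_image g1" "\<phi> d \<notin> path_image g2"
      using dis by blast+
  qed
  have cd_ab: "path_image (L d c) \<inter> path_image (L b a) = {}"
    using q(4) by (intro LL Q ne [symmetric]) (simp add: closed_segment_commute [of d] closed_segment_commute [of b] Int_commute)
  have notin2: "\<phi> a \<notin> path_image (L d c)" "\<phi> b \<notin> path_image (L d c)" "\<phi> c \<notin> path_image (L b a)" "\<phi> d \<notin> path_image (L b a)"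
    using cd_ab ends_in [OF Q(2,1) ne(1)[symmetric]] ends_in [OF Q(4,3) ne(6)[symmetric]] by blast+
  have i1: "path_image g1 \<inter> path_image (L d c) \<subseteq> {\<phi> d}"
    using g1L [OF Q(4,3) ne(6)[symmetric]] notin2 by blast
  have h: "arc h" "pathstart h = \<phi> a" "pathfinish h = \<phi> c" "path_image h = path_image g1 \<union> path_image (L d c)"
    "winding_number h p = winding_number g1 p + winding_number (L d c) p"
    unfolding h_def using g1 Ldc i1 p
    by (auto intro!: arc_join simp: path_image_join winding_number_join arc_imp_path)
  define h2 where "h2 = h +++ g2"
  have i2: "path_image h \<inter> path_image g2 \<subseteq> {\<phi> c}"
    unfolding h(4) using dis g2L [OF Q(4,3) ne(6)[symmetric]] notin notin2 by blast
  have ph: "p \<notin> path_image h" using h(4) p Ldc(5) by auto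
  have h2: "arc h2" "pathstart h2 = \<phi> a" "pathfinish h2 = \<phi> b" "path_image h2 = path_image h \<union> path_image g2"
    "winding_number h2 p = winding_number h p + winding_number g2 p"
    unfolding h2_def using h(1-3) g2 i2 p ph
    by (auto intro!: arc_join simp: path_image_join winding_number_join arc_imp_path)
  have i3: "path_image h2 \<inter> path_image (L b a) \<subseteq> {\<phi> a, \<phi> b}"
  proof -
    have "path_image g1 \<inter> path_image (L b a) \<subseteq> {\<phi> a}" using g1L [OF Q(2,1) ne(1)[symmetric]] notin2 by blast
    moreover have "path_image g2 \<inter> path_image (L b a) \<subseteq> {\<phi> b}" using g2L [OF Q(2,1) ne(1)[symmetric]] notin2 by blast
    ultimately show ?thesis unfolding h2(4) h(4) using cd_ab by blast
  qed
  obtain w where w: "winding_number h2 p + winding_number (L b a) p = of_int w"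
      "p \<in> inside (path_image h2 \<union> path_image (L b a)) \<longleftrightarrow> odd w"
    by (rule inside_join_iff_odd [of h2 "L b a" p])
      (use h2(1-4) ph Lba i3 p in auto)
  have "complex_of_int w = of_int (u + v)"
    unfolding of_int_add u(1) [symmetric] v(1) [symmetric] w(1) [symmetric] h(5) h2(5) L_def
    using winding_number_quadrilateral [OF \<phi>(1) q(1) p(1)] by (simp add: algebra_simps)
  then have "w = u + v" by (simp only: of_int_eq_iff)
  moreover have "path_image h2 \<union> path_image (L b a) =
      path_image g1 \<union> \<phi> ` closed_segment c d \<union> path_image g2 \<union> \<phi> ` closed_segment a b"
    using Lba(2) Ldc(2) h2(4) h(4) by (simp add: closed_segment_commute [of d] closed_segment_commute [of b])
  ultimately show ?thesis
    using u(2) v(2) w(2) Lda(2) Lbc(2) by (simp add: closed_segment_commute [of d])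
qed

text \<open>
  If both arcs existed, closing the first by the real diameter would give a loop with the same
  winding number about the ends of the second. Pushing the diameter to either half of the unit
  circle changes one of these to the winding number about the centre of the disk,
  and the two results differ by the winding number of the whole circle.
\<close>
lemma no_linked_arcs:
  fixes \<phi> :: "complex \<Rightarrow> complex"
  assumes \<phi>: "continuous_on (cball 0 1) \<phi>" "inj_on \<phi> (cball 0 1)"
      "winding_number (\<phi> \<circ> circlepath 0 1) (\<phi> 0) = 1"
    and g: "path g" "pathstart g = \<phi> 1" "pathfinish g = \<phi> (-1)" "path_image g \<inter> \<phi> ` cball 0 1 = {\<phi> 1, \<phi> (-1)}"
    and B: "connected B" "\<phi> \<i> \<in> B" "\<phi> (-\<i>) \<in> B" "B \<inter> \<phi> ` cball 0 1 \<subseteq> {\<phi> \<i>, \<phi> (-\<i>)}"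
    and dis: "path_image g \<inter> B = {}"
  shows False
proof -
  define \<delta> where "\<delta> = \<phi> \<circ> linepath (-1) 1"
  define up where "up = \<phi> \<circ> part_circlepath 0 1 0 pi"
  define dn where "dn = \<phi> \<circ> part_circlepath 0 1 pi (2 * pi)"
  have pin: "path_image (part_circlepath 0 1 s t) \<subseteq> sphere (0::complex) 1" if "s \<le> t" for s t
    using that by (intro path_image_part_circlepath_subset) auto
  have sc: "sphere (0::complex) 1 \<subseteq> cball 0 1" by auto
  have inj: "\<phi> x = \<phi> y \<longleftrightarrow> x = y" if "x \<in> cball 0 1" "y \<in> cball 0 1" for x y
    using \<phi>(2) that by (meson inj_on_eq_iff)
  have up: "path up" "pathstart up = \<phi> 1" "pathfinish up = \<phi> (-1)"
    "path_image up = \<phi> ` {cis t |t. t \<in> {0..pi}}"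
    unfolding up_def using pin [of 0 pi] sc
    by (auto intro!: path_compose_cball [OF \<phi>(1)]
         simp: pathstart_compose pathfinish_compose path_image_compose path_image_part_circlepath cis_conv_exp image_image Setcompr_eq_image mult.commute)
  have dn: "path dn" "pathstart dn = \<phi> (-1)" "pathfinish dn = \<phi> 1"
    "path_image dn = \<phi> ` {cis t |t. t \<in> {pi..2*pi}}"
    unfolding dn_def using pin [of pi "2*pi"] sc
    by (auto intro!: path_compose_cball [OF \<phi>(1)]
         simp: pathstart_compose pathfinish_compose path_image_compose path_image_part_circlepath cis_conv_exp image_image Setcompr_eq_image mult.commute)
  have \<delta>: "path \<delta>" "pathstart \<delta> = \<phi> (-1)" "pathfinish \<delta> = \<phi> 1" "path_image \<delta> = \<phi> ` closed_segment (-1) 1"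
    unfolding \<delta>_def using linepath_in_cball [of "-1" 1]
    by (auto intro!: path_compose_cball [OF \<phi>(1)] simp: pathstart_compose pathfinish_compose path_image_compose)
  have e2pi: "exp (\<i> * (2 * complex_of_real pi)) = 1"
    using exp_two_pi_i by (simp only: mult_ac)
  have circ: "\<phi> \<circ> circlepath 0 1 = up +++ dn"
  proof -
    have "circlepath 0 1 = part_circlepath 0 1 0 pi +++ part_circlepath (0::complex) 1 pi (2 * pi)"
      by (auto simp: fun_eq_iff circlepath_def part_circlepath_def joinpaths_def linepath_def algebra_simps)
    then show ?thesis by (simp add: up_def dn_def path_compose_join)
  qed
  have arc_eq: "path_image (part_circlepath 0 1 s t) = {cis x |x. x \<in> {s..t}}" if "s \<le> t" for s t
    by (simp add: path_image_part_circlepath [OF that] cis_conv_exp)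
  have upper: "z \<in> cball 0 1" "0 \<le> Im z" if "z \<in> {cis t |t. t \<in> {0..pi}}" for z
    using that by (auto simp: sin_ge_zero)
  have lower: "z \<in> cball 0 1" "Im z \<le> 0" if "z \<in> {cis t |t. t \<in> {pi..2*pi}}" for z
    
  proof -
    from that obtain t where t: "z = cis t" "pi \<le> t" "t \<le> 2 * pi" by auto
    then have "0 \<le> sin (t - pi)" by (intro sin_ge_zero) auto
    then show "z \<in> cball 0 1" "Im z \<le> 0" using t by (auto simp: sin_diff)
  qed
  have real: "z \<in> cball 0 1" "Im z = 0" if "z \<in> closed_segment (-1) 1" for z :: complex
  proof -
    show "z \<in> cball 0 1" using that linepath_in_cball [of "-1" 1] subsetD by fastforce
    show "Im z = 0" using that by (auto simp: in_segment)
  qed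
  have norm1: "norm z = 1" if "z \<in> {cis t |t. t \<in> T}" for z T using that by auto
  have mem: "\<phi> z \<in> \<phi> ` T \<longleftrightarrow> z \<in> T" if "z \<in> cball 0 1" "\<And>w. w \<in> T \<Longrightarrow> w \<in> cball 0 1" for z T
    by (rule inj_on_image_mem_iff [OF \<phi>(2) that(1)]) (use that(2) in blast)
  have notup: "\<phi> z \<notin> path_image up" if "z \<in> cball 0 1" "z = 0 \<or> Im z < 0" for z
  proof
    assume "\<phi> z \<in> path_image up"
    then have "z \<in> {cis t |t. t \<in> {0..pi}}" using mem [OF that(1) upper(1)] unfolding up(4) by blast
    then show False using norm1 upper(2) that(2) by fastforce
  qed
  have notdn: "\<phi> z \<notin> path_image dn" if "z \<in> cball 0 1" "z = 0 \<or> 0 < Im z" for z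
  proof
    assume "\<phi> z \<in> path_image dn"
    then have "z \<in> {cis t |t. t \<in> {pi..2*pi}}" using mem [OF that(1) lower(1)] unfolding dn(4) by blast
    then show False using norm1 lower(2) that(2) by fastforce
  qed
  have not\<delta>: "\<phi> z \<notin> path_image \<delta>" if "z \<in> cball 0 1" "Im z \<noteq> 0" for z
    using mem [OF that(1) real(1)] real(2) that(2) unfolding \<delta>(4) by blast
  have 0: "\<phi> 0 \<notin> path_image up" "\<phi> 0 \<notin> path_image dn"
    by (simp_all add: notup notdn)
  have i: "\<phi> \<i> \<notin> path_image dn" "\<phi> (-\<i>) \<notin> path_image up" "\<phi> \<i> \<notin> path_image \<delta>" "\<phi> (-\<i>) \<notin> path_image \<delta>"
    by (simp_all add: notup notdn not\<delta>)
  have gz: "\<phi> z \<notin> path_image g" if "z \<in> cball 0 1" "Re z = 0" for z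
  proof
    assume "\<phi> z \<in> path_image g"
    then have "\<phi> z \<in> {\<phi> 1, \<phi> (-1)}" using that(1) unfolding g(4) [symmetric] by simp
    then show False using that by (simp add: inj) (metis one_complex.sel(1) uminus_complex.sel(1) zero_neq_neg_one zero_neq_one)
  qed
  then have gi: "\<phi> 0 \<notin> path_image g" "\<phi> \<i> \<notin> path_image g" "\<phi> (-\<i>) \<notin> path_image g"
    by simp_all
  have wn: "winding_number (k +++ l) p = winding_number k p + winding_number l p"
    if "path k" "path l" "p \<notin> path_image k" "p \<notin> path_image l" "pathfinish k = pathstart l" for k l p
    using that by (simp add: winding_number_join)
  have one: "winding_number up (\<phi> 0) + winding_number dn (\<phi> 0) = 1"
    using \<phi>(3) wn [OF up(1) dn(1) 0] up dn by (simp add: circ)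
  \<comment> \<open>The connected set \<open>B\<close> joins the two points without meeting the
    loop.\<close>
  have "winding_number (g +++ \<delta>) (\<phi> \<i>) = winding_number (g +++ \<delta>) (\<phi> (-\<i>))"
  proof (rule winding_number_eq [OF _ _ B(2,3,1)])
    have "B \<inter> path_image \<delta> = {}"
    proof -
      have "path_image \<delta> \<subseteq> \<phi> ` cball 0 1" unfolding \<delta>(4) using real(1) by (rule image_mono [OF subsetI])
      then have "B \<inter> path_image \<delta> \<subseteq> {\<phi> \<i>, \<phi> (-\<i>)} \<inter> path_image \<delta>" using B(4) by blast
      then show ?thesis using i(3,4) by simp
    qed
    then show "B \<inter> path_image (g +++ \<delta>) = {}" using dis g(3) \<delta>(2) by (auto simp: path_image_join)
  qed (use g(1-3) \<delta>(1-3) in auto)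
  then have A: "winding_number g (\<phi> \<i>) + winding_number \<delta> (\<phi> \<i>) = winding_number g (\<phi> (-\<i>)) + winding_number \<delta> (\<phi> (-\<i>))"
    using wn [OF g(1) \<delta>(1)] g(3) \<delta>(2) gi i by simp
  \<comment> \<open>In the lower half disk the diameter can be pushed to the lower half circle, away
    from the point on top.\<close>
  have B1: "winding_number \<delta> (\<phi> \<i>) = winding_number dn (\<phi> \<i>)"
    unfolding \<delta>_def dn_def
  proof (rule winding_number_chord [of "cball 0 1 \<inter> {z. Im z \<le> 0}"])
    show "convex (cball 0 1 \<inter> {z. Im z \<le> 0})" by (intro convex_Int convex_cball convex_halfspace_Im_le)
    show "path_image (linepath (-1) 1) \<subseteq> cball 0 1 \<inter> {z. Im z \<le> 0}"
    proof
      fix x :: complex assume "x \<in> path_image (linepath (-1) 1)"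
      from real [OF this [unfolded path_image_linepath]] show "x \<in> cball 0 1 \<inter> {z. Im z \<le> 0}" by simp
    qed
    show "path_image (part_circlepath 0 1 pi (2*pi)) \<subseteq> cball 0 1 \<inter> {z. Im z \<le> 0}"
    proof
      fix x :: complex assume "x \<in> path_image (part_circlepath 0 1 pi (2*pi))"
      moreover have "pi \<le> 2 * pi" by simp
      ultimately have "x \<in> {cis t |t. t \<in> {pi..2*pi}}" by (simp only: arc_eq)
      from lower [OF this] show "x \<in> cball 0 1 \<inter> {z. Im z \<le> 0}" by simp
    qed
    show "\<phi> \<i> \<notin> \<phi> ` (cball 0 1 \<inter> {z. Im z \<le> 0})" by (subst mem) auto
    show "continuous_on (cball 0 1 \<inter> {z. Im z \<le> 0}) \<phi>" using \<phi>(1) continuous_on_subset by blast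
  qed (auto simp: e2pi)
  have "winding_number \<delta> (\<phi> (-\<i>)) = winding_number (reversepath up) (\<phi> (-\<i>))"
    unfolding \<delta>_def up_def reversepath_compose
  proof (rule winding_number_chord [of "cball 0 1 \<inter> {z. 0 \<le> Im z}"])
    show "convex (cball 0 1 \<inter> {z. 0 \<le> Im z})" by (intro convex_Int convex_cball convex_halfspace_Im_ge)
    show "path_image (linepath (-1) 1) \<subseteq> cball 0 1 \<inter> {z. 0 \<le> Im z}"
    proof
      fix x :: complex assume "x \<in> path_image (linepath (-1) 1)"
      from real [OF this [unfolded path_image_linepath]] show "x \<in> cball 0 1 \<inter> {z. 0 \<le> Im z}" by simp
    qed
    show "path_image (reversepath (part_circlepath 0 1 0 pi)) \<subseteq> cball 0 1 \<inter> {z. 0 \<le> Im z}"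
      unfolding path_image_reversepath
    proof
      fix x :: complex assume "x \<in> path_image (part_circlepath 0 1 0 pi)"
      then have "x \<in> {cis t |t. t \<in> {0..pi}}" by (simp only: arc_eq pi_ge_zero)
      from upper [OF this] show "x \<in> cball 0 1 \<inter> {z. 0 \<le> Im z}" by simp
    qed
    show "\<phi> (-\<i>) \<notin> \<phi> ` (cball 0 1 \<inter> {z. 0 \<le> Im z})" by (subst mem) auto
    show "continuous_on (cball 0 1 \<inter> {z. 0 \<le> Im z}) \<phi>" using \<phi>(1) continuous_on_subset by blast
  qed auto
  then have B2: "winding_number \<delta> (\<phi> (-\<i>)) = - winding_number up (\<phi> (-\<i>))"
    using up(1) i(2) by (simp add: winding_number_reversepath)
  have segm: "z \<in> cball 0 1" "Re z = 0" "0 \<le> Im z" if "z \<in> closed_segment 0 \<i>" for z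
  proof -
    show "z \<in> cball 0 1" using that linepath_in_cball [of 0 \<i>] subsetD by fastforce
    show "Re z = 0" "0 \<le> Im z" using that by (auto simp: in_segment)
  qed
  have segm': "z \<in> cball 0 1" "Re z = 0" "Im z \<le> 0" if "z \<in> closed_segment 0 (-\<i>)" for z
  proof -
    show "z \<in> cball 0 1" using that linepath_in_cball [of 0 "-\<i>"] subsetD by fastforce
    show "Re z = 0" "Im z \<le> 0" using that by (auto simp: in_segment)
  qed
  have conn: "connected (\<phi> ` closed_segment 0 x)" if "x \<in> cball 0 1" for x
    using continuous_on_subset [OF \<phi>(1)] linepath_in_cball [of 0 x] that
    by (intro connected_continuous_image) auto
  \<comment> \<open>The radius from the centre to \<open>\<i>\<close> avoids the lower half circle
    and, in the image, also \<open>g\<close>, so the winding number is constant along it.\<close>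
  have C1: "winding_number (g +++ dn) (\<phi> \<i>) = winding_number (g +++ dn) (\<phi> 0)"
  proof (rule winding_number_eq [where S = "\<phi> ` closed_segment 0 \<i>"])
    have "\<phi> z \<notin> path_image dn" "\<phi> z \<notin> path_image g" if z: "z \<in> closed_segment 0 \<i>" for z
    proof -
      have "z = 0 \<or> 0 < Im z" using segm(2,3) [OF z] by (auto simp: complex_eq_iff)
      then show "\<phi> z \<notin> path_image dn" by (rule notdn [OF segm(1) [OF z]])
      show "\<phi> z \<notin> path_image g" by (rule gz [OF segm(1,2) [OF z]])
    qed
    then show "\<phi> ` closed_segment 0 \<i> \<inter> path_image (g +++ dn) = {}"
      using g(1-3) dn(1-3) by (auto simp: path_image_join)
  qed (use g(1-3) dn(1-3) conn in auto)
  have C2: "winding_number (g +++ reversepath up) (\<phi> (-\<i>)) = winding_number (g +++ reversepath up) (\<phi> 0)"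
  proof (rule winding_number_eq [where S = "\<phi> ` closed_segment 0 (-\<i>)"])
    have "\<phi> z \<notin> path_image up" "\<phi> z \<notin> path_image g" if z: "z \<in> closed_segment 0 (-\<i>)" for z
    proof -
      have "z = 0 \<or> Im z < 0" using segm'(2,3) [OF z] by (auto simp: complex_eq_iff)
      then show "\<phi> z \<notin> path_image up" by (rule notup [OF segm'(1) [OF z]])
      show "\<phi> z \<notin> path_image g" by (rule gz [OF segm'(1,2) [OF z]])
    qed
    then show "\<phi> ` closed_segment 0 (-\<i>) \<inter> path_image (g +++ reversepath up) = {}"
      using g(1-3) up(1-3) by (auto simp: path_image_join)
  qed (use g(1-3) up(1-3) conn in auto)
  have "winding_number (g +++ dn) p = winding_number g p + winding_number dn p" if "p \<in> {\<phi> 0, \<phi> \<i>}" for p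
    using that g(1-3) dn(1-3) gi i 0 by (subst wn) auto
  moreover have "winding_number (g +++ reversepath up) p = winding_number g p - winding_number up p" if "p \<in> {\<phi> 0, \<phi> (-\<i>)}" for p
    using that g(1-3) up(1-3) gi i 0 by (subst wn) (auto simp: winding_number_reversepath)
  \<comment> \<open>The contribution of \<open>g\<close> at the centre cancels, so the two half
    circles cancel each other there, although together they wind once.\<close>
  ultimately have "winding_number dn (\<phi> 0) = - winding_number up (\<phi> 0)"
    using A B1 B2 C1 C2 by simp
  then show False using one by simp
qed

section \<open>Resolutions of a link diagram\<close>

lemma arc_between_segment: "a \<noteq> b \<Longrightarrow> arc_between (closed_segment a b) a b"
  unfolding arc_between_def by (intro exI [of _ "linepath a b"]) (simp add: arc_linepath)

lemma closed_segment_unit: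
  fixes u v :: complex
  assumes "norm u = 1" "norm v = 1" "z \<in> closed_segment u v"
  shows "z = u \<or> z = v \<or> norm z < 1"
proof (cases "z = u \<or> z = v")
  case False
  then have "z \<in> open_segment u v" using assms by (simp add: open_segment_def)
  from dist_decreases_open_segment [OF this, of 0] show ?thesis using assms by simp
qed auto

lemma closed_segment_cball:
  fixes u v :: complex
  assumes "norm u = 1" "norm v = 1"
  shows "closed_segment u v \<subseteq> cball 0 1"
  using assms by (intro closed_segment_subset) auto

text \<open>The three ways to pair four points: \<open>x\<close> is the partner of \<open>a\<close>,
  and \<open>y\<close> is the earlier of \<open>b\<close> and \<open>c\<close> that is still free.
  For ends in cyclic order, the last triple is the pairing of opposite ends.\<close>

lemma curves_four_ends:
  assumes R: "curves R {a, b, c, d}" and d: "distinct [a, b, c, d]"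
  obtains A A2 x y z where "A \<in> components R" "A2 \<in> components R" "A \<noteq> A2" "arc_between A a x" "arc_between A2 y z"
    "(x, y, z) \<in> {(b, c, d), (d, b, c), (c, b, d)}"
proof -
  obtain A x where A: "A \<in> components R" "arc_between A a x" "x \<in> {a, b, c, d}"
    using curves_end_arc [OF R, of a] by blast
  have x: "x \<in> {b, c, d}" using A(3) arc_betweenD(1) [OF A(2)] by auto
  define y where "y = (if x = b then c else b)"
  have y: "y \<in> {a, b, c, d}" "y \<noteq> a" "y \<noteq> x" using x d by (auto simp: y_def)
  obtain A2 z where A2: "A2 \<in> components R" "arc_between A2 y z" "z \<in> {a, b, c, d}"
    using curves_end_arc [OF R y(1)] by blast
  have ne: "A \<noteq> A2"
  proof
    assume "A = A2"
    then have "{a, x} = {y, z}" using arc_between_ends_unique [OF A(2)] A2(2) by simp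
    then show False using y(2,3) by (auto simp: doubleton_eq_iff)
  qed
  have dis: "A \<inter> A2 = {}" by (rule disjointD [OF disjoint_components A(1) A2(1) ne])
  have "z \<noteq> a" "z \<noteq> x" using dis arc_betweenD(2,3) [OF A(2)] arc_betweenD(3) [OF A2(2)] by auto
  moreover have "z \<noteq> y" using arc_betweenD(1) [OF A2(2)] by simp
  ultimately have "(x, y, z) \<in> {(b, c, d), (d, b, c), (c, b, d)}"
    using x A2(3) d by (auto simp: y_def split: if_splits)
  then show ?thesis using that A(1,2) A2(1,2) ne by blast
qed

text \<open>A fusion together with its trace on the points of \<open>Q\<close>, which will be the
  punctures. The exclusive or is symmetric in \<open>U\<close>, \<open>V\<close> and
  \<open>W\<close>, so it serves merges and splits alike.\<close>

definition planar_fusion ::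
    "complex set \<Rightarrow> complex set set \<Rightarrow> complex set set \<Rightarrow> complex \<Rightarrow> complex \<Rightarrow> bool" where
  "planar_fusion Q K K' a b \<longleftrightarrow> (\<exists>U V W. U \<noteq> V \<and> K - K' = {U, V} \<and> K' - K = {W} \<and>
     a \<in> U \<and> b \<in> V \<and> a \<in> W \<and> b \<in> W \<and>
     (\<forall>p\<in>Q. p \<in> inside W \<longleftrightarrow> (p \<in> inside U) \<noteq> (p \<in> inside V)))"

lemma set_replace_diff:
  assumes "U \<notin> C" "V \<notin> C" "W \<notin> C" "W \<noteq> U" "W \<noteq> V"
  shows "(C \<union> {U, V}) - (C \<union> {W}) = {U, V}" "(C \<union> {W}) - (C \<union> {U, V}) = {W}"
  using assms by auto

text \<open>The outer arcs join \<open>a\<close> to \<open>d\<close> and \<open>b\<close> to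
  \<open>c\<close>. Chords between the same pairs close each arc into a circle of its own; the
  chords from \<open>a\<close> to \<open>b\<close> and from \<open>c\<close> to \<open>d\<close>
  string both arcs into one circle.\<close>

lemma planar_fusion_at_crossing:
  fixes \<phi> :: "complex \<Rightarrow> complex"
  assumes \<phi>: "continuous_on (cball 0 1) \<phi>" "inj_on \<phi> (cball 0 1)"
    and u: "norm a = 1" "norm b = 1" "norm c = 1" "norm d = 1" and dist: "distinct [a, b, c, d]"
    and seg: "closed_segment a d \<inter> closed_segment b c = {}" "closed_segment a b \<inter> closed_segment c d = {}"
    and R: "curves R (\<phi> ` {a, b, c, d})" "R \<inter> \<phi> ` cball 0 1 = \<phi> ` {a, b, c, d}"
    and A1: "A1 \<in> components R" "arc_between A1 (\<phi> a) (\<phi> d)"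
    and A2: "A2 \<in> components R" "arc_between A2 (\<phi> b) (\<phi> c)" and ne: "A1 \<noteq> A2"
    and Q: "Q \<inter> (R \<union> \<phi> ` cball 0 1) = {}"
  shows "planar_fusion Q (components (R \<union> \<phi> ` closed_segment a d \<union> \<phi> ` closed_segment b c))
     (components (R \<union> \<phi> ` closed_segment a b \<union> \<phi> ` closed_segment c d)) (\<phi> a) (\<phi> c)"
proof -
  define N where "N = {a, b, c, d}"
  have uN: "norm x = 1" if "x \<in> N" for x using that u by (auto simp: N_def)
  have N: "a \<in> N" "b \<in> N" "c \<in> N" "d \<in> N" by (auto simp: N_def)
  have neq: "a \<noteq> b" "a \<noteq> c" "a \<noteq> d" "b \<noteq> c" "b \<noteq> d" "c \<noteq> d" using dist by auto
  define e where "e x y = \<phi> ` closed_segment x y" for x y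
  have inball: "x \<in> cball 0 1" if "x \<in> N" for x using uN [OF that] by simp
  have sb: "closed_segment x y \<subseteq> cball 0 1" if "x \<in> N" "y \<in> N" for x y
    by (rule closed_segment_cball [OF uN [OF that(1)] uN [OF that(2)]])
  have arc: "arc_between (e x y) (\<phi> x) (\<phi> y)" if "x \<in> N" "y \<in> N" "x \<noteq> y" for x y
    unfolding e_def using sb [OF that(1,2)]
    by (intro arc_between_image arc_between_segment that(3) continuous_on_subset [OF \<phi>(1)] inj_on_subset [OF \<phi>(2)])
  have \<phi>eq: "\<phi> x = \<phi> y \<longleftrightarrow> x = y" if "x \<in> cball 0 1" "y \<in> cball 0 1" for x y
    using \<phi>(2) that by (meson inj_on_eq_iff)
  have mem_e: "\<phi> z \<in> e x y \<longleftrightarrow> z = x \<or> z = y" if "x \<in> N" "y \<in> N" "z \<in> N" for x y z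
  proof
    assume "\<phi> z \<in> e x y"
    then obtain w where "w \<in> closed_segment x y" "\<phi> z = \<phi> w" unfolding e_def by blast
    then have "w \<in> cball 0 1" using sb [OF that(1,2)] by blast
    from \<phi>eq [OF inball [OF that(3)] this] have "z \<in> closed_segment x y"
      using \<open>\<phi> z = \<phi> w\<close> \<open>w \<in> closed_segment x y\<close> by blast
    from closed_segment_unit [OF uN [OF that(1)] uN [OF that(2)] this] show "z = x \<or> z = y"
      using uN [OF that(3)] by simp
  qed (auto simp: e_def)
  have eR: "e x y \<inter> R = {\<phi> x, \<phi> y}" if "x \<in> N" "y \<in> N" for x y
  proof
    show "e x y \<inter> R \<subseteq> {\<phi> x, \<phi> y}"
    proof
      fix w assume w: "w \<in> e x y \<inter> R"
      then have "w \<in> R \<inter> \<phi> ` cball 0 1" using sb [OF that] by (auto simp: e_def)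
      then obtain z where "z \<in> N" "w = \<phi> z" unfolding R(2) N_def by blast
      then show "w \<in> {\<phi> x, \<phi> y}" using w mem_e [OF that \<open>z \<in> N\<close>] by auto
    qed
    show "{\<phi> x, \<phi> y} \<subseteq> e x y \<inter> R" using R(2) that by (auto simp: e_def N_def)
  qed
  have ee: "e x y \<inter> e z w = {}" if "closed_segment x y \<inter> closed_segment z w = {}" "x \<in> N" "y \<in> N" "z \<in> N" "w \<in> N" for x y z w
    unfolding e_def using inj_on_image_Int [OF \<phi>(2) sb [OF that(2,3)] sb [OF that(4,5)]] that(1) by simp
  have e0: "e a d \<inter> e b c = {}" "e a b \<inter> e c d = {}" by (rule ee; use seg N in blast)+
  have comm: "e x y = e y x" for x y by (simp add: e_def closed_segment_commute)
  have R1: "curves R (\<phi> ` N)" using R(1) by (simp add: N_def)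
  let ?C = "components R - {A1, A2}"
  note A1' = arc_betweenD [OF A1(2)] and A2' = arc_betweenD [OF A2(2)]
  have dis: "A1 \<inter> A2 = {}" by (rule disjointD [OF disjoint_components A1(1) A2(1) ne])
  have not_C: "M \<notin> ?C" if "A1 \<subseteq> M \<or> A2 \<subseteq> M" for M
  proof
    assume M: "M \<in> ?C"
    then have "M \<inter> A1 = {}" "M \<inter> A2 = {}"
      using disjointD [OF disjoint_components _ A1(1), of M] disjointD [OF disjoint_components _ A2(1), of M] by auto
    then show False using that A1'(2) A2'(2) by blast
  qed
  have K: "components (R \<union> e a d \<union> e b c) = ?C \<union> {A1 \<union> e a d, A2 \<union> e b c}"
  proof -
    note g1 = components_glue_same [OF R1 A1 arc [OF N(1,4) neq(3)] eR [OF N(1,4)]]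
    have 1: "A2 \<in> components (R \<union> e a d)" using g1(1) A2(1) ne by auto
    have 2: "e b c \<inter> (R \<union> e a d) = {\<phi> b, \<phi> c}" using eR [OF N(2,3)] e0(1) by auto
    note g2 = components_glue_same(1) [OF g1(3) 1 A2(2) arc [OF N(2,3) neq(4)] 2]
    have "A1 \<union> e a d \<noteq> A2" using dis A1'(2) by auto
    then show ?thesis unfolding g2 g1(1) by auto
  qed
  define W where "W = A1 \<union> e a b \<union> A2 \<union> e c d"
  have K': "components (R \<union> e a b \<union> e c d) = ?C \<union> {W}"
  proof -
    have A1d: "arc_between A1 (\<phi> d) (\<phi> a)" using A1(2) arc_between_commute by blast
    note g1 = components_glue_distinct [OF R1 A1(1) A1d A2 ne arc [OF N(1,2) neq(1)] eR [OF N(1,2)]]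
    let ?M = "A1 \<union> e a b \<union> A2"
    have 1: "?M \<in> components (R \<union> e a b)" using g1(1) by auto
    have "e c d \<inter> (R \<union> e a b) = {\<phi> c, \<phi> d}" using eR [OF N(3,4)] e0(2) by auto
    then have 2: "e d c \<inter> (R \<union> e a b) = {\<phi> d, \<phi> c}" by (simp add: comm insert_commute)
    note g2 = components_glue_same(1) [OF g1(3) 1 g1(2) arc [OF N(4,3) neq(6)[symmetric]] 2]
    have "?M \<notin> ?C" by (rule not_C) blast
    then have "?C \<union> {?M} - {?M} = ?C" by blast
    then show ?thesis using g2 unfolding g1(1) W_def by (simp add: comm)
  qed
  have "\<phi> b \<notin> A1 \<union> e a d" using mem_e [OF N(1,4,2)] neq dis A2'(2) by auto
  then have W1: "W \<noteq> A1 \<union> e a d" unfolding W_def using A2'(2) by blast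
  have "\<phi> a \<notin> A2 \<union> e b c" using mem_e [OF N(2,3,1)] neq dis A1'(2) by auto
  then have W2: "W \<noteq> A2 \<union> e b c" unfolding W_def using A1'(2) by blast
  have UV: "A1 \<union> e a d \<noteq> A2 \<union> e b c" using \<open>\<phi> a \<notin> A2 \<union> e b c\<close> A1'(2) by blast
  have notC: "A1 \<union> e a d \<notin> ?C" "A2 \<union> e b c \<notin> ?C" "W \<notin> ?C"
    by (rule not_C; simp add: W_def le_supI1)+
  note diffs = set_replace_diff [OF notC W1 W2]
  have xor: "p \<in> inside W \<longleftrightarrow> (p \<in> inside (A1 \<union> e a d)) \<noteq> (p \<in> inside (A2 \<union> e b c))" if p: "p \<in> Q" for p
  proof -
    obtain g1 where g1: "arc g1" "path_image g1 = A1" "pathstart g1 = \<phi> a" "pathfinish g1 = \<phi> d"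
      using A1(2) unfolding arc_between_def by blast
    have "arc_between A2 (\<phi> c) (\<phi> b)" using A2(2) arc_between_commute by blast
    then obtain g2 where g2: "arc g2" "path_image g2 = A2" "pathstart g2 = \<phi> c" "pathfinish g2 = \<phi> b"
      unfolding arc_between_def by blast
    have AR: "A1 \<subseteq> R" "A2 \<subseteq> R" using A1(1) A2(1) by (simp_all add: in_components_subset)
    have "A1 \<inter> \<phi> ` cball 0 1 = {\<phi> a, \<phi> d}"
    proof
      show "A1 \<inter> \<phi> ` cball 0 1 \<subseteq> {\<phi> a, \<phi> d}"
      proof
        fix x assume x: "x \<in> A1 \<inter> \<phi> ` cball 0 1"
        then have "x \<in> \<phi> ` {a, b, c, d}" using AR(1) R(2) by blast
        moreover have "x \<noteq> \<phi> b" "x \<noteq> \<phi> c" using x dis A2'(2,3) by auto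
        ultimately show "x \<in> {\<phi> a, \<phi> d}" by auto
      qed
      show "{\<phi> a, \<phi> d} \<subseteq> A1 \<inter> \<phi> ` cball 0 1" using A1'(2,3) inball N by auto
    qed
    then have c1: "path_image g1 \<inter> \<phi> ` cball 0 1 = {\<phi> a, \<phi> d}" by (simp add: g1)
    have "A2 \<inter> \<phi> ` cball 0 1 = {\<phi> c, \<phi> b}"
    proof
      show "A2 \<inter> \<phi> ` cball 0 1 \<subseteq> {\<phi> c, \<phi> b}"
      proof
        fix x assume x: "x \<in> A2 \<inter> \<phi> ` cball 0 1"
        then have "x \<in> \<phi> ` {a, b, c, d}" using AR(2) R(2) by blast
        moreover have "x \<noteq> \<phi> a" "x \<noteq> \<phi> d" using x dis A1'(2,3) by auto
        ultimately show "x \<in> {\<phi> c, \<phi> b}" by auto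
      qed
      show "{\<phi> c, \<phi> b} \<subseteq> A2 \<inter> \<phi> ` cball 0 1" using A2'(2,3) inball N by auto
    qed
    then have c2: "path_image g2 \<inter> \<phi> ` cball 0 1 = {\<phi> c, \<phi> b}" by (simp add: g2)
    have pQ: "p \<notin> \<phi> ` cball 0 1" "p \<notin> path_image g1" "p \<notin> path_image g2"
      using p Q AR g1(2) g2(2) by blast+
    have q: "{a, b, c, d} \<subseteq> cball 0 1" using inball N by blast
    have "path_image g1 \<inter> path_image g2 = {}" using dis by (simp add: g1 g2)
    from inside_merge [OF \<phi> q dist seg g1(1,3,4) c1 g2(1,3,4) c2 this pQ]
    show ?thesis unfolding W_def g1(2) g2(2) e_def by (simp add: Un_ac)
  qed
  have mems: "\<phi> a \<in> A1 \<union> e a d" "\<phi> c \<in> A2 \<union> e b c" "\<phi> a \<in> W" "\<phi> c \<in> W"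
    using A1' A2' by (auto simp: W_def)
  show ?thesis
    unfolding planar_fusion_def e_def [symmetric] K K'
    by (intro exI [of _ "A1 \<union> e a d"] exI [of _ "A2 \<union> e b c"] exI [of _ W] conjI UV diffs mems ballI xor)
qed


lemma components_closed_curve:
  assumes "curves R {}" "C \<in> components R" shows "closed_curve C"
proof -
  have "curve_or_arc C" "ends C = {}" using assms by (auto simp: curves_def)
  then show ?thesis unfolding curve_or_arc_def using ends_arc by blast
qed

lemma strandE:
  assumes L: "is_link P L" and \<phi>: "inj_on \<phi> (cball 0 1)" and v: "norm v = 1" and s: "strand L \<phi> v T"
  obtains p q where "arc_between T p q" "T \<subseteq> link_set L" "fst p = \<phi> (-v)" "fst q = \<phi> v"
    "fst ` T = \<phi> ` closed_segment (-v) v" "inj_on fst T"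
proof -
  obtain l a b where l: "l \<in> set L" "a < b" "T = (\<lambda>t. l (cis t)) ` {a..b}"
     "bij_betw (\<lambda>t. fst (l (cis t))) {a..b} (\<phi> ` closed_segment (-v) v)"
     "fst (l (cis a)) = \<phi> (-v)" "fst (l (cis b)) = \<phi> v"
    using s unfolding strand_def by blast
  let ?f = "\<lambda>t. l (cis t)"
  have inj: "inj_on (\<lambda>t. fst (?f t)) {a..b}" using l(4) by (simp add: bij_betw_def)
  have cont_l: "continuous_on (sphere 0 1) l" using L l(1) by (simp add: is_link_def)
  have cont: "continuous_on {a..b} ?f"
    by (rule continuous_on_compose2 [OF cont_l]) (auto intro!: continuous_intros)
  have inj': "inj_on ?f {a..b}"
    using inj by (auto simp: inj_on_def)
  have "arc_between (closed_segment a b) a b" using l(2) by (intro arc_between_segment) simp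
  then have "arc_between {a..b} a b" using l(2) by (simp add: closed_segment_eq_real_ivl)
  from arc_between_image [OF this cont inj'] have 1: "arc_between T (?f a) (?f b)" by (simp add: l(3))
  have 2: "T \<subseteq> link_set L"
    unfolding l(3) link_set_def using l(1) by auto
  have 3: "fst ` T = \<phi> ` closed_segment (-v) v"
    using l(4) unfolding l(3) bij_betw_def by (simp add: image_image)
  have 4: "inj_on fst T"
    unfolding l(3) using inj by (auto simp: inj_on_def)
  show ?thesis by (rule that [OF 1 2 l(5,6) 3 4])
qed

text \<open>The points where the strands enter and leave the disk of a chart.\<close>

definition corners :: "complex set" where "corners = {1, \<i>, -1, -\<i>}"

lemma corner_norm: "v \<in> corners \<Longrightarrow> norm v = 1"
  by (auto simp: corners_def)

section \<open>From the link to its resolutions\<close>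

locale link_diagram =
  fixes P :: "complex list" and L :: link and X :: "(complex \<Rightarrow> complex) list"
  assumes link: "is_link P L" and diagram: "is_diagram P L X"
begin

abbreviation "n \<equiv> length X"
abbreviation ch :: "nat \<Rightarrow> complex \<Rightarrow> complex" where "ch i \<equiv> X ! i"

definition Outer :: "complex set" where
  "Outer = fst ` link_set L - (\<Union>i<n. ch i ` ball 0 1)"

definition Ends :: "nat \<Rightarrow> complex set" where
  "Ends i = ch i ` corners"

lemma chart:
  assumes "i < n"
  shows "continuous_on (cball 0 1) (ch i)" "inj_on (ch i) (cball 0 1)"
    "ch i ` cball 0 1 \<subseteq> punctured_disk P" "winding_number (ch i \<circ> circlepath 0 1) (ch i 0) = 1"
  using assms diagram unfolding is_diagram_def crossing_chart_def by auto

lemma chart_eq: "i < n \<Longrightarrow> x \<in> cball 0 1 \<Longrightarrow> y \<in> cball 0 1 \<Longrightarrow> ch i x = ch i y \<longleftrightarrow> x = y"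
  using chart(2) by (meson inj_on_eq_iff)

lemma chart_disjoint: "i < n \<Longrightarrow> j < n \<Longrightarrow> i \<noteq> j \<Longrightarrow> ch i ` cball 0 1 \<inter> ch j ` cball 0 1 = {}"
  using diagram unfolding is_diagram_def disjoint_family_on_def by auto

lemma crossingE:
  assumes "i < n"
  obtains w T U where "w \<in> {\<i>, -\<i>}" "strand L (ch i) 1 T" "strand L (ch i) w U"
    "{x \<in> link_set L. fst x \<in> ch i ` cball 0 1} = T \<union> U"
    "\<And>s t. (ch i 0, s) \<in> T \<Longrightarrow> (ch i 0, t) \<in> U \<Longrightarrow> t < s"
proof -
  have "crossing L (ch i) \<i> \<or> crossing L (ch i) (-\<i>)"
    using assms diagram unfolding is_diagram_def by auto
  then show ?thesis unfolding crossing_def using that by blast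
qed

text \<open>The strands are disjoint in space: their projections meet only at the centre of the
  chart, where the heights differ. Removing the part over the open disk removes both arcs except for
  their ends.\<close>

lemma crossing_strandsE:
  assumes i: "i < n"
  obtains T U p q p' q' where "arc_between T p q" "arc_between U p' q'" "T \<inter> U = {}"
    "{x \<in> link_set L. fst x \<in> ch i ` cball 0 1} = T \<union> U"
    "fst ` {p, q, p', q'} = Ends i"
    "{x \<in> link_set L. fst x \<in> ch i ` ball 0 1} = (T - {p, q}) \<union> (U - {p', q'})"
    "fst ` (T \<union> U) \<inter> (ch i ` sphere 0 1) = Ends i"
proof -
  obtain w T U where w: "w \<in> {\<i>, -\<i>}" and T: "strand L (ch i) 1 T" and U: "strand L (ch i) w U"
    and TU: "{x \<in> link_set L. fst x \<in> ch i ` cball 0 1} = T \<union> U"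
    and over: "\<And>s t. (ch i 0, s) \<in> T \<Longrightarrow> (ch i 0, t) \<in> U \<Longrightarrow> t < s"
    using crossingE [OF i] by blast
  have nw: "norm w = 1" using w by auto
  obtain p q where T': "arc_between T p q" "T \<subseteq> link_set L" "fst p = ch i (-1)" "fst q = ch i 1"
    "fst ` T = ch i ` closed_segment (-1) 1" "inj_on fst T"
    by (rule strandE [OF link chart(2) [OF i] norm_one T])
  obtain p' q' where U': "arc_between U p' q'" "U \<subseteq> link_set L" "fst p' = ch i (-w)" "fst q' = ch i w"
    "fst ` U = ch i ` closed_segment (-w) w" "inj_on fst U"
    by (rule strandE [OF link chart(2) [OF i] nw U])
  have cb: "closed_segment (-v) v \<subseteq> cball 0 1" if "norm v = 1" for v :: complex
    using that by (intro closed_segment_cball) auto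
  have dis: "T \<inter> U = {}"
  proof (rule ccontr)
    assume "T \<inter> U \<noteq> {}"
    then obtain x where x: "x \<in> T" "x \<in> U" by blast
    obtain z where z: "z \<in> closed_segment (-1) 1" "fst x = ch i z" using x(1) T'(5) by (metis (no_types, lifting) imageE imageI)
    obtain z' where z': "z' \<in> closed_segment (-w) w" "fst x = ch i z'" using x(2) U'(5) by (metis (no_types, lifting) imageE imageI)
    have "z = z'" using chart_eq [OF i] cb [of 1] cb [OF nw] z z' by (metis norm_one subsetD)
    moreover have "Im z = 0" using z(1) by (auto simp: in_segment)
    moreover have "Re z' = 0" using z'(1) w by (auto simp: in_segment)
    ultimately have "z = 0" by (simp add: complex_eq_iff)
    then have "x = (ch i 0, snd x)" using z(2) by (metis prod.collapse)
    then show False using over [of "snd x" "snd x"] x by simp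
  qed
  have en: "fst ` {p, q, p', q'} = Ends i"
    using T'(3,4) U'(3,4) w by (auto simp: Ends_def corners_def)
  have open_arc: "{x \<in> A. fst x \<in> ch i ` ball 0 1} = A - {a, b}"
    if A: "arc_between A a b" "fst a = ch i (-v)" "fst b = ch i v" "fst ` A = ch i ` closed_segment (-v) v"
      "inj_on fst A" and v: "norm v = 1" for A a b v
  proof -
    have ab: "a \<in> A" "b \<in> A" using arc_betweenD [OF A(1)] by auto
    have "fst x \<in> ch i ` ball 0 1 \<longleftrightarrow> x \<noteq> a \<and> x \<noteq> b" if x: "x \<in> A" for x
    proof
      assume "fst x \<in> ch i ` ball 0 1"
      then obtain z where z: "z \<in> ball 0 1" "fst x = ch i z" by blast
      have "norm z < 1" using z(1) by simp
      then have "z \<noteq> v" "z \<noteq> -v" using v by auto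
      moreover have "z \<in> cball 0 1" "v \<in> cball 0 1" "-v \<in> cball 0 1" using \<open>norm z < 1\<close> v by auto
      ultimately have "fst x \<noteq> fst b" "fst x \<noteq> fst a"
        unfolding z(2) A(2,3) using chart_eq [OF i] by blast+
      then show "x \<noteq> a \<and> x \<noteq> b" by blast
    next
      assume ne: "x \<noteq> a \<and> x \<noteq> b"
      obtain z where z: "z \<in> closed_segment (-v) v" "fst x = ch i z" using x A(4) by (metis (no_types, lifting) imageE imageI)
      have "fst x \<noteq> fst a" "fst x \<noteq> fst b" using ne ab x inj_onD [OF A(5)] by blast+
      then have "z \<noteq> -v" "z \<noteq> v" using z(2) A(2,3) by auto
      then have "norm z < 1" using closed_segment_unit [OF _ v z(1)] v by simp
      then show "fst x \<in> ch i ` ball 0 1" using z(2) by simp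
    qed
    then show ?thesis using ab by blast
  qed
  have "{x \<in> link_set L. fst x \<in> ch i ` ball 0 1} = {x \<in> T \<union> U. fst x \<in> ch i ` ball 0 1}"
    unfolding TU [symmetric] by auto
  also have "\<dots> = {x \<in> T. fst x \<in> ch i ` ball 0 1} \<union> {x \<in> U. fst x \<in> ch i ` ball 0 1}" by blast
  also have "\<dots> = (T - {p, q}) \<union> (U - {p', q'})"
    using open_arc [OF T'(1,3-6)] open_arc [OF U'(1,3-6) nw] by simp
  finally have op: "{x \<in> link_set L. fst x \<in> ch i ` ball 0 1} = (T - {p, q}) \<union> (U - {p', q'})" .
  have "fst ` (T \<union> U) \<inter> (ch i ` sphere 0 1) = Ends i"
  proof
    show "fst ` (T \<union> U) \<inter> (ch i ` sphere 0 1) \<subseteq> Ends i"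
    proof
      fix y assume "y \<in> fst ` (T \<union> U) \<inter> (ch i ` sphere 0 1)"
      then have y: "y \<in> ch i ` (closed_segment (-1) 1 \<union> closed_segment (-w) w)" "y \<in> ch i ` sphere 0 1"
        by (simp_all only: image_Un T'(5) U'(5) Int_iff)
      obtain z where z: "z \<in> closed_segment (-1) 1 \<or> z \<in> closed_segment (-w) w" "y = ch i z"
        using y(1) by blast
      obtain z' where z': "z' \<in> sphere 0 1" "y = ch i z'" using y(2) by blast
      have "z \<in> cball 0 1" using z(1) cb [of 1] cb [OF nw] by auto
      then have "z = z'" using chart_eq [OF i, of z z'] z z' by simp
      then have "norm z = 1" using z' by simp
      then have "z \<in> {1, -1, w, -w}"
        using z(1) closed_segment_unit [of "-1" 1 z] closed_segment_unit [of "-w" w z] nw by auto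
      then show "y \<in> Ends i" using w z(2) by (auto simp: Ends_def corners_def)
    qed
    have "{p, q, p', q'} \<subseteq> T \<union> U" using arc_betweenD [OF T'(1)] arc_betweenD [OF U'(1)] by auto
    then have "Ends i \<subseteq> fst ` (T \<union> U)" unfolding en [symmetric] by blast
    moreover have "Ends i \<subseteq> ch i ` sphere 0 1" by (auto simp: Ends_def corners_def)
    ultimately show "Ends i \<subseteq> fst ` (T \<union> U) \<inter> (ch i ` sphere 0 1)" by simp
  qed
  from that [OF T'(1) U'(1) dis TU en op this] show ?thesis .
qed

lemma Ends_cball: "Ends i \<subseteq> ch i ` cball 0 1"
  unfolding Ends_def by (intro image_mono subsetI) (simp add: corner_norm)

lemma Outer_chart:
  assumes i: "i < n" shows "Outer \<inter> ch i ` cball 0 1 = Ends i"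
proof -
  obtain T U p q p' q' where TU: "arc_between T p q" "arc_between U p' q'" "T \<inter> U = {}"
    "{x \<in> link_set L. fst x \<in> ch i ` cball 0 1} = T \<union> U"
    "fst ` {p, q, p', q'} = Ends i"
    "{x \<in> link_set L. fst x \<in> ch i ` ball 0 1} = (T - {p, q}) \<union> (U - {p', q'})"
    "fst ` (T \<union> U) \<inter> (ch i ` sphere 0 1) = Ends i"
    by (rule crossing_strandsE [OF i])
  have link_im: "fst ` link_set L \<inter> ch i ` cball 0 1 = fst ` (T \<union> U)"
    unfolding TU(4) [symmetric] by blast
  have cs: "ch i ` cball 0 1 - ch i ` ball 0 1 = ch i ` sphere 0 1"
  proof -
    have "ch i ` (cball 0 1 - ball 0 1) = ch i ` cball 0 1 - ch i ` ball 0 1"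
      by (rule inj_on_image_set_diff [OF chart(2) [OF i]]) (use ball_subset_cball in auto)
    then show ?thesis by (simp add: cball_diff_eq_sphere)
  qed
  have "y \<in> Outer \<inter> ch i ` cball 0 1 \<longleftrightarrow> y \<in> Ends i" for y
  proof
    assume y: "y \<in> Outer \<inter> ch i ` cball 0 1"
    then have "y \<in> fst ` (T \<union> U)" unfolding link_im [symmetric] Outer_def by (simp only: Int_iff Diff_iff simp_thms)
    moreover have "y \<notin> (\<Union>i<n. ch i ` ball 0 1)" using y unfolding Outer_def by (simp only: Int_iff Diff_iff simp_thms)
    then have "y \<notin> ch i ` ball 0 1" using i by blast
    then have "y \<in> ch i ` sphere 0 1" using y unfolding cs [symmetric] by (simp only: Int_iff Diff_iff simp_thms)
    ultimately show "y \<in> Ends i" unfolding TU(7) [symmetric] by (rule IntI)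
  next
    assume y: "y \<in> Ends i"
    then have "y \<in> fst ` (T \<union> U)" "y \<in> ch i ` sphere 0 1" unfolding TU(7) [symmetric] by simp_all
    then have 1: "y \<in> fst ` link_set L" "y \<in> ch i ` cball 0 1" "y \<notin> ch i ` ball 0 1"
      unfolding link_im [symmetric] cs [symmetric] by simp_all
    have "y \<notin> ch j ` ball 0 1" if "j < n" for j
    proof (cases "j = i")
      case False
      have "y \<notin> ch j ` cball 0 1" using chart_disjoint [OF that i False] 1(2) by blast
      then show ?thesis using ball_subset_cball by blast
    qed (use 1 in simp)
    then show "y \<in> Outer \<inter> ch i ` cball 0 1" using 1 unfolding Outer_def by blast
  qed
  then show ?thesis by blast
qed

lemma curves_link_set: "curves (link_set L) {}"
proof (rule curvesI(2) [of "(\<lambda>l. l ` sphere 0 1) ` set L"])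
  have l: "continuous_on (sphere 0 1) l" "inj_on l (sphere 0 1)" if "l \<in> set L" for l
    using that link by (auto simp: is_link_def)
  have cc: "closed_curve (l ` sphere 0 1)" if "l \<in> set L" for l
    by (rule closed_curve_embedding [OF l [OF that]])
  show "disjoint ((\<lambda>l. l ` sphere 0 1) ` set L)"
    unfolding disjoint_def
  proof (intro ballI impI)
    fix A B assume "A \<in> (\<lambda>l. l ` sphere 0 1) ` set L" "B \<in> (\<lambda>l. l ` sphere 0 1) ` set L" "A \<noteq> B"
    then obtain l l' where l: "l \<in> set L" "l' \<in> set L" "A = l ` sphere 0 1" "B = l' ` sphere 0 1" by blast
    obtain i j where ij: "i < length L" "j < length L" "l = L ! i" "l' = L ! j"
      using l(1,2) unfolding in_set_conv_nth by blast
    have "disjoint_family_on (\<lambda>i. (L ! i) ` sphere 0 1) {..<length L}" using link by (simp add: is_link_def)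
    moreover have "i \<noteq> j" using \<open>A \<noteq> B\<close> l(3,4) ij(3,4) by auto
    ultimately show "A \<inter> B = {}" using ij l(3,4) unfolding disjoint_family_on_def by simp
  qed
  show "curve_or_arc A" if "A \<in> (\<lambda>l. l ` sphere 0 1) ` set L" for A
    using that cc unfolding curve_or_arc_def by blast
  show "link_set L = \<Union> ((\<lambda>l. l ` sphere 0 1) ` set L)" by (simp add: link_set_def)
  show "{} = (\<Union>C\<in>(\<lambda>l. l ` sphere 0 1) ` set L. ends C)" using cc ends_closed_curve by auto
qed simp

text \<open>Cutting takes place in the link itself, whose components are embedded circles, and not
  in the projection, which has double points. Once all crossings are cut out, the rest projects
  injectively.\<close>

lemma curves_cut_link:
  assumes "m \<le> n"
  shows "\<exists>B. curves {x \<in> link_set L. fst x \<notin> (\<Union>i<m. ch i ` ball 0 1)} B \<and> fst ` B = (\<Union>i<m. Ends i)"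
  using assms
proof (induction m)
  case 0
  then show ?case using curves_link_set by (intro exI [of _ "{}"]) simp
next
  case (Suc m)
  let ?R = "\<lambda>m. {x \<in> link_set L. fst x \<notin> (\<Union>i<m. ch i ` ball 0 1)}"
  obtain B where B: "curves (?R m) B" "fst ` B = (\<Union>i<m. Ends i)" using Suc by auto
  have m: "m < n" using Suc.prems by simp
  obtain T U p q p' q' where TU: "arc_between T p q" "arc_between U p' q'" "T \<inter> U = {}"
    "{x \<in> link_set L. fst x \<in> ch m ` cball 0 1} = T \<union> U"
    "fst ` {p, q, p', q'} = Ends m"
    "{x \<in> link_set L. fst x \<in> ch m ` ball 0 1} = (T - {p, q}) \<union> (U - {p', q'})"
    by (rule crossing_strandsE [OF m])
  have TUc: "x \<in> link_set L" "fst x \<in> ch m ` cball 0 1" if "x \<in> T \<union> U" for x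
    using that unfolding TU(4) [symmetric] by auto
  have other: "y \<notin> ch i ` cball 0 1" if "y \<in> ch m ` cball 0 1" "i < m" for y i
  proof -
    have "ch i ` cball 0 1 \<inter> ch m ` cball 0 1 = {}"
      by (rule chart_disjoint) (use that(2) m in simp_all)
    then show ?thesis using that(1) by blast
  qed
  have ball_im: "ch i ` ball 0 1 \<subseteq> ch i ` cball 0 1" for i by (intro image_mono ball_subset_cball)
  have TUR: "x \<in> ?R m" if "x \<in> T \<union> U" for x
  proof -
    have "fst x \<notin> ch i ` ball 0 1" if "i < m" for i
      using other [OF TUc(2) [OF \<open>x \<in> T \<union> U\<close>] that] ball_im [of i] by (meson subsetD)
    then show ?thesis using TUc(1) [OF that] by simp
  qed
  have TUB: "x \<notin> B" if "x \<in> T \<union> U" for x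
  proof
    assume "x \<in> B"
    then have "fst x \<in> (\<Union>i<m. Ends i)" unfolding B(2) [symmetric] by (rule imageI)
    then obtain i where "i < m" "fst x \<in> Ends i" by blast
    then show False using other [OF TUc(2) [OF that], of i] subsetD [OF Ends_cball [of i]] by simp
  qed
  note ends = arc_betweenD [OF TU(1)] arc_betweenD [OF TU(2)]
  let ?R1 = "(?R m - T) \<union> {p, q}"
  have c1: "curves ?R1 (B \<union> {p, q})"
    by (rule curves_cut [OF B(1) TU(1)]) (use TUR TUB in blast)+
  have "U \<subseteq> ?R1" using TUR TU(3) by blast
  moreover have "p \<notin> U" "q \<notin> U" using TU(3) ends(2,3) by blast+
  then have "U \<inter> (B \<union> {p, q}) = {}" using TUB by auto
  ultimately have c2: "curves ((?R1 - U) \<union> {p', q'}) (B \<union> {p, q} \<union> {p', q'})"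
    by (rule curves_cut [OF c1 TU(2)])
  have "?R (Suc m) = ?R m - {x \<in> link_set L. fst x \<in> ch m ` ball 0 1}"
    unfolding lessThan_Suc UN_insert by blast
  also have "\<dots> = ?R m - ((T - {p, q}) \<union> (U - {p', q'}))" unfolding TU(6) ..
  also have "\<dots> = (?R1 - U) \<union> {p', q'}"
  proof -
    have in_R: "p \<in> ?R m" "q \<in> ?R m" "p' \<in> ?R m" "q' \<in> ?R m" using TUR ends by auto
    have "p \<notin> U" "q \<notin> U" "p' \<notin> T" "q' \<notin> T" using TU(3) ends by auto
    then show ?thesis using in_R by auto
  qed
  finally have "curves (?R (Suc m)) (B \<union> {p, q} \<union> {p', q'})" using c2 by simp
  moreover have "fst ` (B \<union> {p, q} \<union> {p', q'}) = (\<Union>i<Suc m. Ends i)"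
  proof -
    have "fst ` (B \<union> {p, q} \<union> {p', q'}) = fst ` B \<union> fst ` {p, q, p', q'}" by auto
    then show ?thesis unfolding B(2) TU(5) lessThan_Suc by auto
  qed
  ultimately show ?case by blast
qed

lemma curves_Outer: "curves Outer (\<Union>i<n. Ends i)"
proof -
  let ?R = "{x \<in> link_set L. fst x \<notin> (\<Union>i<n. ch i ` ball 0 1)}"
  obtain B where B: "curves ?R B" "fst ` B = (\<Union>i<n. Ends i)"
    using curves_cut_link [of n] by auto
  have "(\<Union>\<phi>\<in>set X. \<phi> ` ball 0 1) = (\<Union>i<n. ch i ` ball 0 1)"
  proof -
    have "set X = (!) X ` {..<n}" by (auto simp: set_conv_nth)
    then show ?thesis by simp
  qed
  then have "inj_on fst ?R" using diagram by (simp add: is_diagram_def)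
  then have "curves (fst ` ?R) (fst ` B)"
    by (intro curves_image [OF B(1)]) (auto intro!: continuous_intros)
  moreover have "fst ` ?R = Outer" by (auto simp: Outer_def)
  ultimately show ?thesis using B(2) by simp
qed


text \<open>A partial resolution: only the crossings in \<open>J\<close> are smoothed, the others
  keep four free ends. It supports the induction over crossings and, with one crossing left out, the
  comparison of two resolutions.\<close>

definition Rs :: "nat set \<Rightarrow> nat set \<Rightarrow> complex set" where
  "Rs J S = Outer \<union> (\<Union>i\<in>J. ch i ` smoothing (i \<in> S))"

lemma resolution_Rs: "resolution L X S = Rs {..<n} S"
  by (simp add: resolution_def Rs_def Outer_def)

lemma smoothing_cball: "smoothing b \<subseteq> cball 0 1"
  unfolding smoothing_def by (cases b) (simp_all add: closed_segment_cball)

lemma Ends_disjoint: "i < n \<Longrightarrow> j < n \<Longrightarrow> i \<noteq> j \<Longrightarrow> Ends i \<inter> Ends j = {}"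
  using chart_disjoint [of i j] Ends_cball [of i] Ends_cball [of j] by blast

lemma Rs_chart:
  assumes "J \<subseteq> {..<n}" "i < n" "i \<notin> J"
  shows "Rs J S \<inter> ch i ` cball 0 1 = Ends i"
proof -
  have "ch j ` smoothing (j \<in> S) \<inter> ch i ` cball 0 1 = {}" if j: "j \<in> J" for j
  proof -
    have "ch j ` cball 0 1 \<inter> ch i ` cball 0 1 = {}"
      by (rule chart_disjoint) (use assms j in auto)
    then show ?thesis using image_mono [OF smoothing_cball [of "j \<in> S"], of "ch j"] by blast
  qed
  then have "(\<Union>j\<in>J. ch j ` smoothing (j \<in> S)) \<inter> ch i ` cball 0 1 = {}" by blast
  then show ?thesis unfolding Rs_def using Outer_chart [OF assms(2)] by blast
qed

lemma chart_segment:
  assumes i: "i < n" and xy: "x \<in> corners" "y \<in> corners" "x \<noteq> y"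
  shows "arc_between (ch i ` closed_segment x y) (ch i x) (ch i y)"
    "ch i ` closed_segment x y \<inter> Ends i = {ch i x, ch i y}"
    "ch i ` closed_segment x y \<subseteq> ch i ` cball 0 1"
proof -
  have sb: "closed_segment x y \<subseteq> cball 0 1" by (intro closed_segment_cball corner_norm xy)
  show "arc_between (ch i ` closed_segment x y) (ch i x) (ch i y)"
    by (intro arc_between_image arc_between_segment xy(3) continuous_on_subset [OF chart(1) [OF i] sb]
        inj_on_subset [OF chart(2) [OF i] sb])
  show "ch i ` closed_segment x y \<subseteq> ch i ` cball 0 1" by (rule image_mono [OF sb])
  have cc: "corners \<subseteq> cball 0 1" by (rule subsetI) (simp add: corner_norm)
  have "closed_segment x y \<inter> corners = {x, y}"
  proof
    show "closed_segment x y \<inter> corners \<subseteq> {x, y}"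
    proof
      fix z assume "z \<in> closed_segment x y \<inter> corners"
      then show "z \<in> {x, y}"
        using closed_segment_unit [OF corner_norm [OF xy(1)] corner_norm [OF xy(2)], of z] corner_norm [of z] by auto
    qed
  qed (use xy in auto)
  then show "ch i ` closed_segment x y \<inter> Ends i = {ch i x, ch i y}"
    unfolding Ends_def using inj_on_image_Int [OF chart(2) [OF i] sb cc] by simp
qed

lemma segments_disjoint:
  "closed_segment 1 (-\<i>) \<inter> closed_segment \<i> (-1) = {}"
  "closed_segment 1 \<i> \<inter> closed_segment (-1) (-\<i>) = {}"
proof -
  have "Re z - Im z = 1" if "z \<in> closed_segment 1 (-\<i>)" for z using that by (auto simp: in_segment)
  moreover have "Re z - Im z = -1" if "z \<in> closed_segment \<i> (-1)" for z using that by (auto simp: in_segment)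
  ultimately show "closed_segment 1 (-\<i>) \<inter> closed_segment \<i> (-1) = {}" by force
  have "Re z + Im z = 1" if "z \<in> closed_segment 1 \<i>" for z using that by (auto simp: in_segment)
  moreover have "Re z + Im z = -1" if "z \<in> closed_segment (-1) (-\<i>)" for z using that by (auto simp: in_segment)
  ultimately show "closed_segment 1 \<i> \<inter> closed_segment (-1) (-\<i>) = {}" by force
qed

lemma smoothingE:
  obtains x y z w where "smoothing b = closed_segment x y \<union> closed_segment z w"
    "closed_segment x y \<inter> closed_segment z w = {}" "{x, y, z, w} = corners" "distinct [x, y, z, w]"
proof (cases b)
  case True
  show ?thesis
    by (rule that [of 1 \<i> "-1" "-\<i>"])
       (use True segments_disjoint in \<open>auto simp: smoothing_def corners_def complex_eq_iff\<close>)
next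
  case False
  show ?thesis
    by (rule that [of 1 "-\<i>" \<i> "-1"])
       (use False segments_disjoint in \<open>auto simp: smoothing_def corners_def complex_eq_iff\<close>)
qed

lemma chart_image_disjoint:
  assumes "i < n" "A \<subseteq> cball 0 1" "B \<subseteq> cball 0 1" "A \<inter> B = {}"
  shows "ch i ` A \<inter> ch i ` B = {}"
  using inj_on_image_Int [OF chart(2) [OF assms(1)] assms(2,3)] assms(4) by simp

lemma Int_via_superset: "A \<subseteq> C \<Longrightarrow> R \<inter> C = E \<Longrightarrow> A \<inter> E = F \<Longrightarrow> A \<inter> R = F"
  by (metis inf.absorb1 inf_assoc inf_commute)

text \<open>The two chords are glued in succession; as they are disjoint, the ends of the second are
  still free after the first.\<close>

lemma curves_add_smoothing:
  assumes i: "i < n" and R: "curves R B" "R \<inter> ch i ` cball 0 1 = Ends i" "Ends i \<subseteq> B"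
  shows "curves (R \<union> ch i ` smoothing b) (B - Ends i)"
proof -
  obtain x y z w where s: "smoothing b = closed_segment x y \<union> closed_segment z w"
    "closed_segment x y \<inter> closed_segment z w = {}" "{x, y, z, w} = corners" "distinct [x, y, z, w]"
    by (rule smoothingE)
  have c: "x \<in> corners" "y \<in> corners" "z \<in> corners" "w \<in> corners"
    unfolding s(3) [symmetric] by simp_all
  have ne: "x \<noteq> y" "z \<noteq> w"
    using s(4) by simp_all
  note e1 = chart_segment [OF i c(1,2) ne(1)] and e2 = chart_segment [OF i c(3,4) ne(2)]
  let ?e1 = "ch i ` closed_segment x y" and ?e2 = "ch i ` closed_segment z w"
  have eR: "?e1 \<inter> R = {ch i x, ch i y}" "?e2 \<inter> R = {ch i z, ch i w}"
    by (rule Int_via_superset [OF e1(3) R(2) e1(2)], rule Int_via_superset [OF e2(3) R(2) e2(2)])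
  have "ch i v \<in> B" if "v \<in> corners" for v using R(3) that unfolding Ends_def by blast
  then have in_B: "ch i x \<in> B" "ch i y \<in> B" "ch i z \<in> B" "ch i w \<in> B" using c by simp_all
  have ee: "?e1 \<inter> ?e2 = {}"
    by (rule chart_image_disjoint [OF i _ _ s(2)]) (intro closed_segment_cball corner_norm c)+
  have c1: "curves (R \<union> ?e1) (B - {ch i x, ch i y})"
    by (rule curves_glue [OF R(1) e1(1) eR(1) in_B(1,2)])
  have zw: "ch i z \<in> ?e2" "ch i w \<in> ?e2" using arc_betweenD [OF e2(1)] by auto
  have xy: "ch i x \<in> ?e1" "ch i y \<in> ?e1" using arc_betweenD [OF e1(1)] by auto
  have "ch i v \<in> B - {ch i x, ch i y}" if "ch i v \<in> B" "ch i v \<in> ?e2" for v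
  proof -
    have "ch i v \<notin> ?e1" using ee that(2) unfolding disjoint_iff by metis
    then have "ch i v \<noteq> ch i x" "ch i v \<noteq> ch i y" using xy by metis+
    then show ?thesis using that(1) by simp
  qed
  then have "ch i z \<in> B - {ch i x, ch i y}" "ch i w \<in> B - {ch i x, ch i y}"
    using in_B zw by simp_all
  moreover have "?e2 \<inter> (R \<union> ?e1) = {ch i z, ch i w}"
    using eR(2) ee by (simp add: Int_Un_distrib Int_commute)
  ultimately have "curves (R \<union> ?e1 \<union> ?e2) (B - {ch i x, ch i y} - {ch i z, ch i w})"
    by (intro curves_glue [OF c1 e2(1)])
  moreover have "Ends i = {ch i x, ch i y, ch i z, ch i w}" unfolding Ends_def s(3) [symmetric] by simp
  then have "B - {ch i x, ch i y} - {ch i z, ch i w} = B - Ends i" by blast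
  moreover have "R \<union> ?e1 \<union> ?e2 = R \<union> ch i ` smoothing b" unfolding s(1) image_Un by blast
  ultimately show ?thesis by simp
qed

lemma curves_Rs:
  assumes "J \<subseteq> {..<n}"
  shows "curves (Rs J S) (\<Union>i\<in>{..<n} - J. Ends i)"
proof -
  have "finite J" using assms finite_subset by blast
  then show ?thesis using assms
  proof (induction J)
    case empty
    then show ?case using curves_Outer by (simp add: Rs_def)
  next
    case (insert i J)
    then have i: "i < n" "i \<notin> J" and J: "J \<subseteq> {..<n}" by auto
    have IH: "curves (Rs J S) (\<Union>k\<in>{..<n} - J. Ends k)" using insert.IH J by simp
    have "Ends i \<subseteq> (\<Union>k\<in>{..<n} - J. Ends k)" using i by blast
    from curves_add_smoothing [OF i(1) IH Rs_chart [OF J i] this, of "i \<in> S"]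
    have "curves (Rs J S \<union> ch i ` smoothing (i \<in> S)) ((\<Union>k\<in>{..<n} - J. Ends k) - Ends i)" .
    moreover have "Rs J S \<union> ch i ` smoothing (i \<in> S) = Rs (insert i J) S"
      unfolding Rs_def UN_insert by blast
    moreover have "(\<Union>k\<in>{..<n} - J. Ends k) - Ends i = (\<Union>k\<in>{..<n} - insert i J. Ends k)"
    proof -
      have "{..<n} - J - {i} = {..<n} - insert i J" by blast
      moreover have "(\<Union>k\<in>{..<n} - J. Ends k) - (\<Union>k\<in>{i}. Ends k) = (\<Union>k\<in>{..<n} - J - {i}. Ends k)"
        by (rule UN_diff_disjoint) (use i Ends_disjoint in auto)
      ultimately show ?thesis by simp
    qed
    ultimately show ?case by simp
  qed
qed

lemma curves_resolution: "curves (resolution L X S) {}"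
  using curves_Rs [OF order_refl, of S] by (simp add: resolution_Rs)

section \<open>The circles of a resolution\<close>

lemma finite_circles: "finite (circles L X S)"
  using curves_resolution [of S] by (simp add: curves_def circles_def)

lemma circle_closed_curve: "C \<in> circles L X S \<Longrightarrow> closed_curve C"
  using components_closed_curve [OF curves_resolution] by (simp add: circles_def)

text \<open>No circle hides inside a chart: with one point of a chord a component contains the whole
  chord, and the ends of the chord lie in \<open>Outer\<close>. Hence every circle has a base point
  there.\<close>

lemma circle_meets_Outer:
  assumes C: "C \<in> circles L X S" shows "C \<inter> Outer \<noteq> {}"
proof -
  have C': "C \<in> components (Rs {..<n} S)" using C by (simp add: circles_def resolution_Rs)
  obtain x where x: "x \<in> C" using in_components_nonempty [OF C'] by blast
  then have "x \<in> Rs {..<n} S" using in_components_subset [OF C'] by blast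
  then consider "x \<in> Outer" | i where "i < n" "x \<in> ch i ` smoothing (i \<in> S)" unfolding Rs_def by blast
  then show ?thesis
  proof cases
    case 2
    obtain a b c d where s: "smoothing (i \<in> S) = closed_segment a b \<union> closed_segment c d"
      "closed_segment a b \<inter> closed_segment c d = {}" "{a, b, c, d} = corners" "distinct [a, b, c, d]"
      by (rule smoothingE)
    then have "\<exists>u v. u \<in> corners \<and> v \<in> corners \<and> u \<noteq> v \<and> x \<in> ch i ` closed_segment u v \<and> closed_segment u v \<subseteq> smoothing (i \<in> S)"
    proof -
      from 2(2) have "x \<in> ch i ` closed_segment a b \<or> x \<in> ch i ` closed_segment c d" unfolding s(1) by blast
      then show ?thesis
      proof
        assume "x \<in> ch i ` closed_segment a b"
        then show ?thesis using s(4) unfolding s(1) s(3) [symmetric] by (intro exI [of _ a] exI [of _ b]) simp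
      next
        assume "x \<in> ch i ` closed_segment c d"
        then show ?thesis using s(4) unfolding s(1) s(3) [symmetric] by (intro exI [of _ c] exI [of _ d]) simp
      qed
    qed
    then obtain u v where uv: "u \<in> corners" "v \<in> corners" "u \<noteq> v" "x \<in> ch i ` closed_segment u v" "closed_segment u v \<subseteq> smoothing (i \<in> S)"
      by blast
    note e = chart_segment [OF 2(1) uv(1-3)]
    have "ch i ` closed_segment u v \<subseteq> Rs {..<n} S" unfolding Rs_def using uv(5) 2(1) by blast
    then have "ch i ` closed_segment u v \<subseteq> C"
      using components_maximal [OF C' arc_betweenD(5) [OF e(1)]] x uv(4) by blast
    moreover have "ch i u \<in> ch i ` closed_segment u v" by simp
    moreover have "ch i u \<in> Outer" using Outer_chart [OF 2(1)] uv(1) unfolding Ends_def by blast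
    ultimately show ?thesis by blast
  qed (use x in blast)
qed

lemma Outer_circles: "Outer \<subseteq> \<Union>(circles L X S)"
  unfolding circles_def Union_components resolution_Rs Rs_def by blast

lemma disjoint_circles: "disjoint (circles L X S)"
  unfolding circles_def by (rule disjoint_components)

lemma resolution_punctured_disk: "resolution L X S \<subseteq> punctured_disk P"
proof -
  have "fst ` link_set L \<subseteq> punctured_disk P" using link by (auto simp: is_link_def)
  moreover have "ch i ` smoothing b \<subseteq> punctured_disk P" if "i < n" for i b
    using image_mono [OF smoothing_cball [of b], of "ch i"] chart(3) [OF that] by (rule subset_trans)
  ultimately show ?thesis unfolding resolution_def by blast
qed

lemma corner_Outer: "i < n \<Longrightarrow> v \<in> corners \<Longrightarrow> ch i v \<in> Outer"
  using Outer_chart [of i] unfolding Ends_def by blast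

text \<open>With crossing \<open>j\<close> left open, the resolution has exactly four ends, and
  their pairing by the outer arcs decides which of the two smoothings has more circles.\<close>

lemma circles_fusion:
  assumes j: "j < n" "j \<notin> S"
  shows "planar_fusion (set P) (circles L X S) (circles L X (insert j S)) (ch j 1) (ch j (-1)) \<or>
     planar_fusion (set P) (circles L X (insert j S)) (circles L X S) (ch j 1) (ch j (-1))"
proof -
  let ?J = "{..<n} - {j}"
  define R where "R = Rs ?J S"
  have J: "?J \<subseteq> {..<n}" "j \<notin> ?J" by auto
  have RJ: "Rs {..<n} S' = Rs ?J S' \<union> ch j ` smoothing (j \<in> S')" for S'
  proof -
    have "insert j ?J = {..<n}" using j(1) by (simp add: insert_absorb)
    then have "(\<Union>i\<in>insert j ?J. ch i ` smoothing (i \<in> S')) = (\<Union>i\<in>{..<n}. ch i ` smoothing (i \<in> S'))"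
      by (simp only:)
    then show ?thesis unfolding Rs_def UN_insert by (simp only: Un_ac)
  qed
  have "Rs ?J (insert j S) = R" unfolding R_def Rs_def by auto
  then have res: "resolution L X S = R \<union> ch j ` smoothing False" "resolution L X (insert j S) = R \<union> ch j ` smoothing True"
    unfolding resolution_Rs RJ using j(2) by (simp_all add: R_def)
  have "{..<n} - ?J = {j}" using j by auto
  then have cur: "curves R (Ends j)" using curves_Rs [OF J(1), of S] by (simp add: R_def)
  have Rc: "R \<inter> ch j ` cball 0 1 = Ends j" unfolding R_def by (rule Rs_chart [OF J(1) j(1) J(2)])
  note \<phi> = chart(1,2) [OF j(1)]
  have Q: "set P \<inter> (R \<union> ch j ` cball 0 1) = {}"
    using resolution_punctured_disk [of S] chart(3) [OF j(1)] unfolding res punctured_disk_def by blast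
  have corner_ne: "distinct [1::complex, \<i>, -1, -\<i>]" by (auto simp: complex_eq_iff)
  have "distinct [ch j 1, ch j \<i>, ch j (-1), ch j (-\<i>)]"
    using corner_ne chart_eq [OF j(1)] by simp
  moreover have "Ends j = {ch j 1, ch j \<i>, ch j (-1), ch j (-\<i>)}" by (simp add: Ends_def corners_def)
  ultimately obtain A A2 x y z where A: "A \<in> components R" "A2 \<in> components R" "A \<noteq> A2" "arc_between A (ch j 1) x" "arc_between A2 y z"
    "(x, y, z) \<in> {(ch j \<i>, ch j (-1), ch j (-\<i>)), (ch j (-\<i>), ch j \<i>, ch j (-1)), (ch j (-1), ch j \<i>, ch j (-\<i>))}"
    using curves_four_ends [of R "ch j 1" "ch j \<i>" "ch j (-1)" "ch j (-\<i>)"] cur by metis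
  have sm: "ch j ` smoothing False = ch j ` closed_segment 1 (-\<i>) \<union> ch j ` closed_segment \<i> (-1)"
    "ch j ` smoothing True = ch j ` closed_segment 1 \<i> \<union> ch j ` closed_segment (-1) (-\<i>)"
    by (simp_all add: smoothing_def image_Un)
  have E1: "Ends j = ch j ` {1, \<i>, -1, -\<i>}" by (simp add: Ends_def corners_def)
  have E2: "Ends j = ch j ` {1, -\<i>, -1, \<i>}" unfolding E1 by auto
  from A(6) consider
      (a) "x = ch j \<i>" "y = ch j (-1)" "z = ch j (-\<i>)"
    | (b) "x = ch j (-\<i>)" "y = ch j \<i>" "z = ch j (-1)"
    | (c) "x = ch j (-1)" "y = ch j \<i>" "z = ch j (-\<i>)" by blast
  then show ?thesis
  proof cases
    \<comment> \<open>The arcs join neighbours along the chords of the 1-smoothing, which therefore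
      closes them separately: the change is a split.\<close>
    case a
    have A2': "arc_between A2 (ch j (-\<i>)) (ch j (-1))" using A(5) a arc_between_commute by blast
    have "planar_fusion (set P)
      (components (R \<union> ch j ` closed_segment 1 \<i> \<union> ch j ` closed_segment (-\<i>) (-1)))
      (components (R \<union> ch j ` closed_segment 1 (-\<i>) \<union> ch j ` closed_segment (-1) \<i>)) (ch j 1) (ch j (-1))"
    proof (rule planar_fusion_at_crossing [OF \<phi> _ _ _ _ _ _ _ _ _ A(1) _ A(2) A2' A(3) Q])
      show "curves R (ch j ` {1, -\<i>, -1, \<i>})" "R \<inter> ch j ` cball 0 1 = ch j ` {1, -\<i>, -1, \<i>}"
        using cur Rc unfolding E2 by simp_all
      show "arc_between A (ch j 1) (ch j \<i>)" using A(4) a by simp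
    qed (use segments_disjoint corner_ne in \<open>auto simp: closed_segment_commute\<close>)
    then show ?thesis unfolding circles_def res sm by (simp add: closed_segment_commute Un_assoc)
  next
    \<comment> \<open>Here the chords of the 0-smoothing close the arcs separately: the change is a
      merge.\<close>
    case b
    have "planar_fusion (set P)
      (components (R \<union> ch j ` closed_segment 1 (-\<i>) \<union> ch j ` closed_segment \<i> (-1)))
      (components (R \<union> ch j ` closed_segment 1 \<i> \<union> ch j ` closed_segment (-1) (-\<i>))) (ch j 1) (ch j (-1))"
    proof (rule planar_fusion_at_crossing [OF \<phi> _ _ _ _ _ _ _ _ _ A(1) _ A(2) _ A(3) Q])
      show "curves R (ch j ` {1, \<i>, -1, -\<i>})" "R \<inter> ch j ` cball 0 1 = ch j ` {1, \<i>, -1, -\<i>}"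
        using cur Rc unfolding E1 by simp_all
      show "arc_between A (ch j 1) (ch j (-\<i>))" "arc_between A2 (ch j \<i>) (ch j (-1))" using A(4,5) b by simp_all
    qed (use segments_disjoint corner_ne in auto)
    then show ?thesis unfolding circles_def res sm by (simp add: Un_assoc)
  next
    \<comment> \<open>Opposite ends are joined, the configuration that winding numbers
      exclude.\<close>
    case c
    obtain g where g: "arc g" "path_image g = A" "pathstart g = ch j 1" "pathfinish g = ch j (-1)"
      using A(4) c unfolding arc_between_def by blast
    have AR: "A \<subseteq> R" "A2 \<subseteq> R" using A(1,2) by (simp_all add: in_components_subset)
    have dis: "A \<inter> A2 = {}" by (rule disjointD [OF disjoint_components A(1,2,3)])
    note A' = arc_betweenD [OF A(4)] and A2' = arc_betweenD [OF A(5)]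
    have AA: "A \<inter> ch j ` cball 0 1 \<subseteq> ch j ` {1, \<i>, -1, -\<i>}" "A2 \<inter> ch j ` cball 0 1 \<subseteq> ch j ` {1, \<i>, -1, -\<i>}"
      using AR Rc unfolding E1 by blast+
    have A1: "A \<inter> ch j ` cball 0 1 = {ch j 1, ch j (-1)}"
    proof
      have "ch j \<i> \<notin> A" "ch j (-\<i>) \<notin> A" using dis A2'(2,3) c by auto
      then show "A \<inter> ch j ` cball 0 1 \<subseteq> {ch j 1, ch j (-1)}" using AA(1) by auto
      show "{ch j 1, ch j (-1)} \<subseteq> A \<inter> ch j ` cball 0 1" using A'(2,3) c by auto
    qed
    have A3: "A2 \<inter> ch j ` cball 0 1 \<subseteq> {ch j \<i>, ch j (-\<i>)}"
    proof -
      have "ch j 1 \<notin> A2" "ch j (-1) \<notin> A2" using dis A'(2,3) c by auto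
      then show ?thesis using AA(2) by auto
    qed
    show ?thesis
    proof (rule FalseE, rule no_linked_arcs [OF \<phi> chart(4) [OF j(1)]])
      show "path g" by (rule arc_imp_path [OF g(1)])
      show "pathstart g = ch j 1" "pathfinish g = ch j (-1)" by (rule g)+
      show "path_image g \<inter> ch j ` cball 0 1 = {ch j 1, ch j (-1)}" using A1 g(2) by simp
      show "connected A2" by (rule A2')
      show "ch j \<i> \<in> A2" "ch j (-\<i>) \<in> A2" using A2'(2,3) c by simp_all
      show "A2 \<inter> ch j ` cball 0 1 \<subseteq> {ch j \<i>, ch j (-\<i>)}" by (rule A3)
      show "path_image g \<inter> A2 = {}" using dis g(2) by simp
    qed
  qed
qed

end

section \<open>Circles and punctures\<close>

lemma closed_curve_iff_parametrizes: "closed_curve C \<longleftrightarrow> (\<exists>c. parametrizes c C)"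
  unfolding closed_curve_def parametrizes_def by blast

text \<open>The winding number is constantly 1 or constantly -1 inside; in the second case the
  reversed path shows that the choice in \<open>ccw_param\<close> has a witness.\<close>

lemma ccw_param:
  assumes "closed_curve C"
  shows "parametrizes (ccw_param C) C" "z \<in> inside C \<Longrightarrow> winding_number (ccw_param C) z = 1"
proof -
  obtain g where g: "simple_path g" "pathfinish g = pathstart g" "path_image g = C"
    using assms unfolding closed_curve_def by blast
  have "\<exists>c. parametrizes c C \<and> (\<forall>z\<in>inside C. winding_number c z = 1)"
  proof (rule simple_closed_path_winding_number_inside [OF g(1)])
    assume "\<And>z. z \<in> inside (path_image g) \<Longrightarrow> winding_number g z = 1"
    then show ?thesis using g by (intro exI [of _ g]) (auto simp: parametrizes_def)
  next
    assume w: "\<And>z. z \<in> inside (path_image g) \<Longrightarrow> winding_number g z = - 1"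
    have "winding_number (reversepath g) z = 1" if z: "z \<in> inside C" for z
    proof -
      have "z \<notin> path_image g" using z inside_no_overlap [of C] g(3) by blast
      from winding_number_reversepath [OF simple_path_imp_path [OF g(1)] this] show ?thesis
        using w [of z] z g(3) by simp
    qed
    then show ?thesis using g
      by (intro exI [of _ "reversepath g"]) (auto simp: parametrizes_def simple_path_reversepath)
  qed
  from someI_ex [OF this] show "parametrizes (ccw_param C) C" "z \<in> inside C \<Longrightarrow> winding_number (ccw_param C) z = 1"
    unfolding ccw_param_def by blast+
qed

text \<open>A puncture off the curve lies inside, with winding number 1, or outside, with winding
  number 0; the rounding in the definition is exact.\<close>

lemma homology_class_eq:
  assumes "closed_curve C" "C \<inter> set P = {}" "i < length P"
  shows "homology_class P C i = (if P ! i \<in> inside C then 1 else 0)"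
proof (cases "P ! i \<in> inside C")
  case True
  then show ?thesis using ccw_param(2) [OF assms(1)] assms(3) by (simp add: homology_class_def)
next
  case False
  have c: "simple_path (ccw_param C)" "pathfinish (ccw_param C) = pathstart (ccw_param C)" "path_image (ccw_param C) = C"
    using ccw_param(1) [OF assms(1)] by (simp_all add: parametrizes_def)
  have "P ! i \<notin> C" using assms(2,3) nth_mem by blast
  then have "P ! i \<in> outside C" using False inside_Un_outside [of C] by blast
  then have "winding_number (ccw_param C) (P ! i) = 0"
    using c by (intro winding_number_zero_in_outside) (simp_all add: simple_path_imp_path)
  then show ?thesis using False assms(3) by (simp add: homology_class_def)
qed

text \<open>A homotopy in the punctured disk misses \<open>p\<close>, so it would preserve the
  winding number about \<open>p\<close>; that is 1 or -1 for a circle around \<open>p\<close> and 0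
  for a constant loop.\<close>

lemma trivial_circle_imp_no_puncture:
  assumes "trivial_circle P C" "p \<in> set P" shows "p \<notin> inside C"
proof
  assume p: "p \<in> inside C"
  obtain c a where c: "parametrizes c C" and h: "homotopic_loops (punctured_disk P) c (linepath a a)"
    using assms(1) unfolding trivial_circle_def by blast
  have sub: "punctured_disk P \<subseteq> - {p}" using assms(2) by (auto simp: punctured_disk_def)
  have "a \<in> punctured_disk P" using homotopic_loops_imp_subset [OF h] by auto
  then have "p \<noteq> a" using sub by auto
  have "homotopic_loops (- {p}) c (linepath a a)" by (rule homotopic_loops_subset [OF h sub])
  then have "winding_number c p = winding_number (linepath a a) p" by (rule winding_number_homotopic_loops)
  also have "\<dots> = 0" using \<open>p \<noteq> a\<close> by (simp add: winding_number_trivial)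
  finally have "winding_number c p = 0" .
  moreover have "norm (winding_number c p) = 1"
    using c p by (intro simple_closed_path_norm_winding_number_inside) (auto simp: parametrizes_def)
  ultimately show False by simp
qed

text \<open>Cut the plane along arcs that join the punctures outside the curve to infinity.\<close>
lemma simply_connected_neighbourhood:
  assumes C: "compact C" "connected C" "C \<noteq> {}" "C \<subseteq> cball (0::complex) 1" and P: "finite P" "P \<subseteq> outside C"
  obtains U where "open U" "simply_connected U" "C \<subseteq> U" "U \<inter> P = {}"
proof -
  have bC: "bounded C" using C(1) compact_imp_bounded by blast
  have out: "connected (outside C)" "open (outside C)"
    using connected_outside [OF bC] open_outside [OF compact_imp_closed [OF C(1)]] by auto
  then have pc: "path_connected (outside C)" by (simp add: connected_open_path_connected)
  \<comment> \<open>A common tail for all cuts, outside the unit disk: it makes their union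
    connected and unbounded.\<close>
  define Ray where "Ray = {z::complex. Im z = 0 \<and> 2 \<le> Re z}"
  have big: "- cball 0 1 \<subseteq> outside C" by (rule outside_subset_convex [OF convex_cball C(4)])
  have RayO: "Ray \<subseteq> outside C"
  proof
    fix z assume "z \<in> Ray"
    then have "1 < norm z" using complex_Re_le_cmod [of z] by (simp add: Ray_def)
    then show "z \<in> outside C" using big by auto
  qed
  have two: "2 \<in> Ray" by (simp add: Ray_def)
  have "\<exists>g. path g \<and> path_image g \<subseteq> outside C \<and> pathstart g = p \<and> pathfinish g = 2" if "p \<in> P" for p
    using pc that P(2) RayO two unfolding path_connected_def by blast
  then obtain g where g: "\<And>p. p \<in> P \<Longrightarrow> path (g p) \<and> path_image (g p) \<subseteq> outside C \<and> pathstart (g p) = p \<and> pathfinish (g p) = 2"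
    by metis
  define Y where "Y = Ray \<union> (\<Union>p\<in>P. path_image (g p))"
  have "convex Ray"
  proof -
    have "Ray = {z. Im z \<le> 0} \<inter> {z. 0 \<le> Im z} \<inter> {z. 2 \<le> Re z}" by (auto simp: Ray_def)
    then show ?thesis by (simp add: convex_Int convex_halfspace_Re_ge convex_halfspace_Im_le convex_halfspace_Im_ge)
  qed
  have "closed Ray"
  proof -
    have "Ray = {z. Im z \<le> 0} \<inter> {z. 0 \<le> Im z} \<inter> {z. 2 \<le> Re z}" by (auto simp: Ray_def)
    then show ?thesis by (simp add: closed_Int closed_halfspace_Re_ge closed_halfspace_Im_le closed_halfspace_Im_ge)
  qed
  then have "closed Y" unfolding Y_def
    using P(1) g closed_path_image by (intro closed_Un closed_UN) auto
  have conn: "connected (Ray \<union> path_image (g p))" if "p \<in> P" for p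
  proof (rule connected_Un)
    show "connected Ray" using \<open>convex Ray\<close> by (rule convex_connected)
    show "connected (path_image (g p))" using g [OF that] by (simp add: connected_path_image)
    have "2 \<in> path_image (g p)" using g [OF that] pathfinish_in_path_image by metis
    then show "Ray \<inter> path_image (g p) \<noteq> {}" using two by blast
  qed
  have "connected Y"
  proof -
    have "Y = \<Union>(insert Ray ((\<lambda>p. Ray \<union> path_image (g p)) ` P))" unfolding Y_def by blast
    moreover have "connected (\<Union>(insert Ray ((\<lambda>p. Ray \<union> path_image (g p)) ` P)))"
    proof (rule connected_Union)
      show "connected S" if "S \<in> insert Ray ((\<lambda>p. Ray \<union> path_image (g p)) ` P)" for S
        using that conn convex_connected [OF \<open>convex Ray\<close>] by blast
      show "\<Inter>(insert Ray ((\<lambda>p. Ray \<union> path_image (g p)) ` P)) \<noteq> {}" using two by blast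
    qed
    ultimately show ?thesis by simp
  qed
  have "\<not> bounded Ray"
  proof
    assume "bounded Ray"
    then obtain B where B: "\<And>z. z \<in> Ray \<Longrightarrow> norm z \<le> B" unfolding bounded_iff by blast
    have "complex_of_real (max 2 (B + 1)) \<in> Ray" by (simp add: Ray_def)
    from B [OF this] show False unfolding norm_of_real by simp
  qed
  then have unb: "\<not> bounded Y" unfolding Y_def using bounded_subset by blast
  have "Y \<subseteq> outside C" using RayO g unfolding Y_def by blast
  then have CY: "C \<subseteq> - Y" using outside_no_overlap [of C] by blast
  obtain U where U: "U \<in> components (- Y)" "C \<subseteq> U"
    using exists_component_superset [OF CY _ C(2)] C(3) CY by blast
  have UY: "U \<subseteq> - Y" using U(1) by (rule in_components_subset)
  have "open U" using open_components [OF _ U(1)] \<open>closed Y\<close> by (simp add: open_Compl)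
  moreover have "connected U" using U(1) by (rule in_components_connected)
  \<comment> \<open>The complement of a component of the complement of a connected set is connected;
    here it contains the unbounded set \<open>Y\<close>, so no point of it is cut off by
    \<open>U\<close>.\<close>
  moreover have "inside U = {}"
  proof -
    have "connected (- U)" by (rule component_complement_connected [OF \<open>connected Y\<close> U(1)])
    then have "connected_component_set (- U) z = - U" if "z \<notin> U" for z
      using that by (simp add: connected_component_eq_self)
    moreover have "\<not> bounded (- U)" using bounded_subset [of "- U" Y] UY unb by blast
    ultimately show ?thesis unfolding inside_def by auto
  qed
  ultimately have "simply_connected U" by (simp add: simply_connected_eq_empty_inside)
  moreover have "P \<subseteq> Y" using g pathstart_in_path_image unfolding Y_def by fastforce
  ultimately show ?thesis using that \<open>open U\<close> U(2) UY by blast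
qed

text \<open>The neighbourhood in which a circle contracts may leave the disk; this map brings the
  contraction back. Points outside go to the unit circle, where there are no punctures as these lie
  in the open disk.\<close>

definition radial_retraction :: "complex \<Rightarrow> complex" where
  "radial_retraction z = z / of_real (max 1 (norm z))"

lemma radial_retraction_cball: "norm z \<le> 1 \<Longrightarrow> radial_retraction z = z"
  by (simp add: radial_retraction_def)

lemma norm_radial_retraction: "1 < norm z \<Longrightarrow> norm (radial_retraction z) = 1"
  by (auto simp: radial_retraction_def norm_divide)

lemma continuous_radial_retraction: "continuous_on S radial_retraction"
  unfolding radial_retraction_def by (intro continuous_intros) auto

text \<open>All punctures lie outside \<open>C\<close>, so the curve contracts in a simply connected
  set without punctures; the retraction fixes \<open>C\<close> and moves the contraction into the
  punctured disk.\<close>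

lemma no_puncture_imp_trivial_circle:
  assumes C: "closed_curve C" "C \<subseteq> punctured_disk P" and P: "set P \<subseteq> ball 0 1"
    and no: "\<And>p. p \<in> set P \<Longrightarrow> p \<notin> inside C"
  shows "trivial_circle P C"
proof -
  obtain c where c: "parametrizes c C" using C(1) closed_curve_iff_parametrizes by blast
  have c': "path c" "pathfinish c = pathstart c" "path_image c = C"
    using c by (auto simp: parametrizes_def simple_path_imp_path)
  have Cb: "C \<subseteq> cball 0 1" "C \<inter> set P = {}" using C(2) by (auto simp: punctured_disk_def)
  have "set P \<subseteq> outside C" using no Cb(2) inside_Un_outside [of C] by blast
  then obtain U where U: "open U" "simply_connected U" "C \<subseteq> U" "U \<inter> set P = {}"
    using simply_connected_neighbourhood [OF closed_curveD(2,3,1) [OF C(1)] Cb(1), of "set P"] by auto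
  define a where "a = pathstart c"
  have "a \<in> U" using U(3) c'(3) pathstart_in_path_image unfolding a_def by blast
  then have "homotopic_loops U c (linepath a a)"
    using U(2,3) c' unfolding simply_connected_eq_contractible_loop_any by blast
  then have "homotopic_loops (punctured_disk P) (radial_retraction \<circ> c) (radial_retraction \<circ> linepath a a)"
  proof (rule homotopic_loops_continuous_image)
    show "continuous_on U radial_retraction" by (rule continuous_radial_retraction)
    have "radial_retraction z \<in> punctured_disk P" if "z \<in> U" for z
    proof (cases "norm z \<le> 1")
      case True
      then show ?thesis using that U(4) by (auto simp: radial_retraction_cball punctured_disk_def)
    next
      case False
      then have "norm (radial_retraction z) = 1" by (simp add: norm_radial_retraction)
      moreover from this have "radial_retraction z \<notin> set P" using P by fastforce
      ultimately show ?thesis by (simp add: punctured_disk_def)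
    qed
    then show "radial_retraction \<in> U \<rightarrow> punctured_disk P" by auto
  qed
  moreover have "homotopic_loops (punctured_disk P) c (radial_retraction \<circ> c)"
  proof (rule homotopic_loops_eq)
    show "path_image c \<subseteq> punctured_disk P" using C(2) c'(3) by simp
    show "c t = (radial_retraction \<circ> c) t" if "t \<in> {0..1}" for t
    proof -
      have "c t \<in> cball 0 1" using that Cb(1) c'(3) unfolding path_image_def by blast
      then show ?thesis by (simp add: radial_retraction_cball)
    qed
  qed (use c' in auto)
  moreover have "radial_retraction \<circ> linepath a a = linepath (radial_retraction a) (radial_retraction a)"
    by (auto simp: linepath_def fun_eq_iff simp flip: scaleR_add_left)
  ultimately have "homotopic_loops (punctured_disk P) c (linepath (radial_retraction a) (radial_retraction a))"
    by (metis homotopic_loops_trans)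
  then show ?thesis unfolding trivial_circle_def using c by blast
qed

section \<open>The filtered Khovanov complex\<close>

lemma planar_fusion_imp_fusion: "planar_fusion Q K K' a b \<Longrightarrow> fusion K K' a b"
  unfolding planar_fusion_def fusion_def by (elim exE conjE) (intro exI conjI)

lemma planar_fusionE:
  assumes "planar_fusion Q K K' a b"
  obtains U V W where "U \<noteq> V" "K - K' = {U, V}" "K' - K = {W}"
    "\<forall>p\<in>Q. p \<in> inside W \<longleftrightarrow> (p \<in> inside U) \<noteq> (p \<in> inside V)"
  using assms unfolding planar_fusion_def by (elim exE conjE)

text \<open>
  The three possible decreases of a weighted sum of labels. They are the same for a merge of \<open>U\<close> and
  \<open>V\<close> into \<open>W\<close> and for a split of \<open>W\<close> into \<open>U\<close> and \<open>V\<close>.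
\<close>
definition label_changes :: "('c \<Rightarrow> int) \<Rightarrow> 'c \<Rightarrow> 'c \<Rightarrow> 'c \<Rightarrow> int list" where
  "label_changes f U V W = [f U + f V - f W, f U - f V + f W, - f U + f V + f W]"

text \<open>Weight 1 on every circle gives the label part of the quantum degree,
  \<open>enclosed\<close> gives g and \<open>encloses\<close> gives p, so all three gradings are
  treated by the same computation.\<close>

definition weight :: "complex set set \<Rightarrow> complex set set \<Rightarrow> (complex set \<Rightarrow> int) \<Rightarrow> int" where
  "weight K A f = (\<Sum>C\<in>K. label A C * f C)"

lemma weight_diff:
  assumes "finite K" "finite K'" "A \<inter> (K \<inter> K') = A' \<inter> (K \<inter> K')"
  shows "weight K A f - weight K' A' f = weight (K - K') A f - weight (K' - K) A' f"
proof -
  have "label A C = label A' C" if "C \<in> K \<inter> K'" for C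
    using that assms(3) unfolding label_def by (metis IntE IntI)
  then have "weight (K \<inter> K') A f = weight (K \<inter> K') A' f" by (simp add: weight_def)
  moreover have "weight K A f = weight (K - K') A f + weight (K \<inter> K') A f"
    unfolding weight_def using assms(1) by (subst sum.Int_Diff [of K _ K']) auto
  moreover have "weight K' A' f = weight (K' - K) A' f + weight (K \<inter> K') A' f"
    unfolding weight_def using assms(2) by (subst sum.Int_Diff [of K' _ K]) (auto simp: Int_commute)
  ultimately show ?thesis by simp
qed

text \<open>The row \<open>m\<close> depends on the labels alone and is chosen before
  \<open>f\<close>; this lets the changes of different gradings under the same term be
  compared.\<close>

lemma merge_weight:
  assumes "finite K" "finite K'" "edge_coeff K K' A A' \<noteq> 0" and UVW: "U \<noteq> V" "K - K' = {U, V}" "K' - K = {W}"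
  shows "\<exists>m<3. \<forall>f. weight K A f - weight K' A' f = label_changes f U V W ! m"
proof -
  have e: "A \<inter> (K \<inter> K') = A' \<inter> (K \<inter> K')" "merge_term K K' A A' \<or> split_term K K' A A'"
    using assms(3) by (auto simp: edge_coeff_def split: if_splits)
  have w: "weight K A f - weight K' A' f = label A U * f U + label A V * f V - label A' W * f W" for f
    unfolding weight_diff [OF assms(1,2) e(1)] UVW(2,3) using UVW(1) by (simp add: weight_def)
  from e(2) consider "U \<in> A" "V \<in> A" "W \<in> A'" | "U \<in> A" "V \<notin> A" "W \<notin> A'" | "U \<notin> A" "V \<in> A" "W \<notin> A'"
    unfolding merge_term_iff [OF UVW] by blast
  then show ?thesis
  proof cases
    case 1
    then show ?thesis unfolding w by (intro exI [of _ 0]) (simp add: label_def label_changes_def)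
  next
    case 2
    then show ?thesis unfolding w by (intro exI [of _ 1]) (simp add: label_def label_changes_def)
  next
    case 3
    then show ?thesis unfolding w by (intro exI [of _ 2]) (simp add: label_def label_changes_def numeral_2_eq_2)
  qed
qed

lemma split_weight:
  assumes "finite K" "finite K'" "edge_coeff K K' A A' \<noteq> 0" and UVW: "U \<noteq> V" "K' - K = {U, V}" "K - K' = {W}"
  shows "\<exists>m<3. \<forall>f. weight K A f - weight K' A' f = label_changes f U V W ! m"
proof -
  have e: "A \<inter> (K \<inter> K') = A' \<inter> (K \<inter> K')" "merge_term K K' A A' \<or> split_term K K' A A'"
    using assms(3) by (auto simp: edge_coeff_def split: if_splits)
  have w: "weight K A f - weight K' A' f = label A W * f W - label A' U * f U - label A' V * f V" for f
    unfolding weight_diff [OF assms(1,2) e(1)] UVW(2,3) using UVW(1) by (simp add: weight_def)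
  from e(2) consider "W \<notin> A" "U \<notin> A'" "V \<notin> A'" | "W \<in> A" "U \<notin> A'" "V \<in> A'" | "W \<in> A" "U \<in> A'" "V \<notin> A'"
    unfolding split_term_iff [OF UVW(1,3,2)] by blast
  then show ?thesis
  proof cases
    case 1
    then show ?thesis unfolding w by (intro exI [of _ 0]) (simp add: label_def label_changes_def)
  next
    case 2
    then show ?thesis unfolding w by (intro exI [of _ 1]) (simp add: label_def label_changes_def)
  next
    case 3
    then show ?thesis unfolding w by (intro exI [of _ 2]) (simp add: label_def label_changes_def numeral_2_eq_2)
  qed
qed

definition enclosed :: "complex list \<Rightarrow> complex set \<Rightarrow> int" where
  "enclosed P C = (\<Sum>i<length P. if P ! i \<in> inside C then 1 else 0)"

text \<open>The indicator of nontriviality, stated by punctures; an integer, so that it can serve as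
  a weight.\<close>

definition encloses :: "complex list \<Rightarrow> complex set \<Rightarrow> int" where
  "encloses P C = (if \<exists>p\<in>set P. p \<in> inside C then 1 else 0)"

lemma fusion_label_changes:
  assumes xor: "\<forall>p\<in>set P. p \<in> inside W \<longleftrightarrow> (p \<in> inside U) \<noteq> (p \<in> inside V)" and m: "m < 3"
  shows "0 \<le> label_changes (enclosed P) U V W ! m" "0 \<le> label_changes (encloses P) U V W ! m"
    "label_changes (encloses P) U V W ! m = 0 \<Longrightarrow> label_changes (enclosed P) U V W ! m = 0"
proof -
  have xor': "P ! i \<in> inside W \<longleftrightarrow> (P ! i \<in> inside U) \<noteq> (P ! i \<in> inside V)" if "i < length P" for i
    using xor that by simp
  have le: "enclosed P U \<le> enclosed P V + enclosed P W" "enclosed P V \<le> enclosed P U + enclosed P W"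
    "enclosed P W \<le> enclosed P U + enclosed P V"
    unfolding enclosed_def sum.distrib [symmetric] by (intro sum_mono; use xor' in auto)+
  have les: "encloses P U \<le> encloses P V + encloses P W" "encloses P V \<le> encloses P U + encloses P W"
    "encloses P W \<le> encloses P U + encloses P V"
    unfolding encloses_def using xor by auto
  have same: "enclosed P C = enclosed P C'"
    if "encloses P N = 0" and iff: "\<And>i. i < length P \<Longrightarrow> P ! i \<notin> inside N \<Longrightarrow> P ! i \<in> inside C \<longleftrightarrow> P ! i \<in> inside C'" for N C C'
    unfolding enclosed_def
  proof (rule sum.cong [OF refl])
    fix i assume i: "i \<in> {..<length P}"
    then have "P ! i \<notin> inside N" using that(1) by (auto simp: encloses_def split: if_splits)
    then show "(if P ! i \<in> inside C then 1 else 0) = (if P ! i \<in> inside C' then 1 else 0 :: int)" using iff [of i] i by auto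
  qed
  have z: "encloses P U = 0 \<Longrightarrow> enclosed P V = enclosed P W" "encloses P V = 0 \<Longrightarrow> enclosed P U = enclosed P W"
    "encloses P W = 0 \<Longrightarrow> enclosed P U = enclosed P V"
  proof -
    show "encloses P U = 0 \<Longrightarrow> enclosed P V = enclosed P W" by (rule same [of U]) (use xor' in auto)
    show "encloses P V = 0 \<Longrightarrow> enclosed P U = enclosed P W" by (rule same [of V]) (use xor' in auto)
    show "encloses P W = 0 \<Longrightarrow> enclosed P U = enclosed P V" by (rule same [of W]) (use xor' in auto)
  qed
  have 0: "enclosed P C = 0" if "encloses P C = 0" for C
    unfolding enclosed_def using that by (intro sum.neutral) (auto simp: encloses_def split: if_splits)
  have 01: "encloses P C = 0 \<or> encloses P C = 1" for C by (simp add: encloses_def)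
  consider "m = 0" | "m = 1" | "m = 2" using m by linarith
  then show "0 \<le> label_changes (enclosed P) U V W ! m" "0 \<le> label_changes (encloses P) U V W ! m"
    using le les by (cases; simp add: label_changes_def numeral_2_eq_2)+
  \<comment> \<open>A vanishing row is an equation \<open>x + y = z\<close> between values 0 and 1,
    which forces \<open>x\<close> or \<open>y\<close> to be 0: one circle encloses no
    puncture.\<close>
  assume eq: "label_changes (encloses P) U V W ! m = 0"
  from \<open>m < 3\<close> consider "m = 0" | "m = 1" | "m = 2" by linarith
  then show "label_changes (enclosed P) U V W ! m = 0"
  proof cases
    case 1
    then have "encloses P U + encloses P V = encloses P W" using eq by (simp add: label_changes_def)
    then have "encloses P U = 0 \<or> encloses P V = 0" using 01 [of U] 01 [of V] 01 [of W] by auto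
    then show ?thesis using z 0 1 by (auto simp: label_changes_def)
  next
    case 2
    then have "encloses P U + encloses P W = encloses P V" using eq by (simp add: label_changes_def)
    then have "encloses P U = 0 \<or> encloses P W = 0" using 01 [of U] 01 [of V] 01 [of W] by auto
    then show ?thesis using z 0 2 by (auto simp: label_changes_def)
  next
    case 3
    then have "encloses P V + encloses P W = encloses P U" using eq by (simp add: label_changes_def numeral_2_eq_2)
    then have "encloses P V = 0 \<or> encloses P W = 0" using 01 [of U] 01 [of V] 01 [of W] by auto
    then show ?thesis using z 0 3 by (auto simp: label_changes_def numeral_2_eq_2)
  qed
qed

section \<open>The flattened gradings as weights\<close>

lemma coeff_sum_eq:
  assumes "finite A" "Poly_Mapping.keys a \<subseteq> A"
  shows "coeff_sum a = (\<Sum>c\<in>A. Poly_Mapping.lookup a c)"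
  unfolding coeff_sum_def using assms by (intro sum.mono_neutral_left) (auto simp: in_keys_iff)

lemma coeff_sum_add: "coeff_sum (a + b) = coeff_sum a + coeff_sum b"
proof -
  have "finite (Poly_Mapping.keys a \<union> Poly_Mapping.keys b)" by simp
  note E = coeff_sum_eq [OF this]
  show ?thesis using E [OF Poly_Mapping.keys_add] E [of a] E [of b] by (simp add: lookup_add sum.distrib)
qed

text \<open>Distinct circles may be homotopic, and their coefficients then add up at one key; the
  total is unaffected by such collisions.\<close>

lemma coeff_sum_sum_single: "coeff_sum (\<Sum>C\<in>S. Poly_Mapping.single (h C) (f C)) = sum f S"
proof (induction S rule: infinite_finite_induct)
  case (insert C S)
  then show ?case by (simp add: coeff_sum_add) (simp add: coeff_sum_def)
qed (simp_all add: coeff_sum_def)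

context link_diagram begin

lemma circle_punctures:
  assumes C: "C \<in> circles L X S"
  shows "C \<subseteq> punctured_disk P" "C \<inter> set P = {}"
proof -
  have "C \<subseteq> resolution L X S" using C unfolding circles_def by (rule in_components_subset)
  then show "C \<subseteq> punctured_disk P" using resolution_punctured_disk by blast
  then show "C \<inter> set P = {}" by (auto simp: punctured_disk_def)
qed

lemma coord_sum_g_Sigma: "coord_sum P (g_Sigma P L X (S, A)) = weight (circles L X S) A (enclosed P)"
proof -
  have "(\<Sum>i<length P. homology_class P C i) = enclosed P C" if "C \<in> circles L X S" for C
    unfolding enclosed_def using homology_class_eq [OF circle_closed_curve [OF that] circle_punctures(2) [OF that]]
    by (intro sum.cong) auto
  then have "weight (circles L X S) A (enclosed P) =
      (\<Sum>C\<in>circles L X S. \<Sum>i<length P. label A C * homology_class P C i)"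
    unfolding weight_def by (intro sum.cong) (simp_all flip: sum_distrib_left)
  also have "\<dots> = coord_sum P (g_Sigma P L X (S, A))"
    unfolding coord_sum_def g_Sigma_def by (simp add: sum.swap [of _ "circles L X S"])
  finally show ?thesis by simp
qed

text \<open>After flattening, the homotopy class of a circle matters only through its triviality,
  and a circle is trivial iff it encloses no puncture.\<close>

lemma coeff_sum_Phi:
  assumes "set P \<subseteq> ball 0 1"
  shows "coeff_sum (Phi P L X (S, A)) = weight (circles L X S) A (encloses P)"
proof -
  have t: "trivial_circle P C \<longleftrightarrow> \<not> (\<exists>p\<in>set P. p \<in> inside C)" if "C \<in> circles L X S" for C
    using trivial_circle_imp_no_puncture [of P C]
      no_puncture_imp_trivial_circle [OF circle_closed_curve [OF that] circle_punctures(1) [OF that] assms] by blast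
  have "weight (circles L X S) A (encloses P) = (\<Sum>C\<in>circles L X S. if \<not> trivial_circle P C then label A C else 0)"
    unfolding weight_def by (intro sum.cong) (simp_all add: encloses_def t)
  also have "\<dots> = (\<Sum>C\<in>{C \<in> circles L X S. \<not> trivial_circle P C}. label A C)"
    by (rule sum.inter_filter [symmetric, OF finite_circles])
  finally show ?thesis by (simp add: Phi_def coeff_sum_sum_single)
qed

abbreviation K :: "nat set \<Rightarrow> complex set set" where "K \<equiv> circles L X"

lemma circle_system_K: "circle_system Outer (K S)"
  unfolding circle_system_def
  using finite_circles disjoint_circles Outer_circles circle_meets_Outer by blast

lemma fusion_K:
  assumes "j < n" "j \<notin> S"
  shows "fusion (K S) (K (insert j S)) (ch j 1) (ch j (-1)) \<or> fusion (K (insert j S)) (K S) (ch j 1) (ch j (-1))"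
  using circles_fusion [OF assms] planar_fusion_imp_fusion by blast

section \<open>The boundary squares to zero\<close>

definition emb :: "nat set \<Rightarrow> (complex set set \<Rightarrow>\<^sub>0 rat) \<Rightarrow> chain" where
  "emb S = lin (\<lambda>A. Poly_Mapping.single (S, A) 1)"

definition sign :: "nat set \<Rightarrow> nat \<Rightarrow> rat" where
  "sign S j = (-1) ^ card {i \<in> S. i < j}"

lemma boundary_lin: "boundary L X = lin (boundary_state L X)"
  by (rule ext) (simp add: boundary_def lin_def)

text \<open>Separates sign, vertex and edge map, so that the faces of the cube can be studied on
  labels alone.\<close>

lemma boundary_state_emb:
  "boundary_state L X (S, A) =
     (\<Sum>j\<in>{..<n} - S. scaleQ (sign S j) (emb (insert j S) (edge (K S) (K (insert j S)) (Poly_Mapping.single A 1))))"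
proof -
  have scale_single: "scaleQ a (Poly_Mapping.single x b) = Poly_Mapping.single x (a * b)" for a b :: rat and x :: state
    by (rule poly_mapping_eqI) (simp add: lookup_scaleQ lookup_single when_def)
  show ?thesis
    by (simp add: boundary_state_def edge_def emb_def lin_sum Q.scale_sum_right scale_single sign_def)
qed

lemma boundary_emb:
  "boundary L X (emb S v) =
     (\<Sum>j\<in>{..<n} - S. scaleQ (sign S j) (emb (insert j S) (edge (K S) (K (insert j S)) v)))"
proof -
  have "boundary L X (emb S v) = lin (\<lambda>A. boundary_state L X (S, A)) v"
    by (simp add: boundary_lin emb_def lin_lin)
  also have "\<dots> = (\<Sum>j\<in>{..<n} - S. scaleQ (sign S j) (emb (insert j S) (edge (K S) (K (insert j S)) v)))"
    unfolding boundary_state_emb emb_def edge_def lin_lin lin_single Q.scale_one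
    by (simp add: lin_def [of _ v] Q.scale_sum_right sum.swap [of _ "Poly_Mapping.keys v"] mult.commute)
  finally show ?thesis .
qed

lemma sign_insert:
  assumes "finite S" "i \<notin> S" "j \<notin> S" "i < j"
  shows "sign (insert j S) i = sign S i" "sign (insert i S) j = - sign S j"
proof -
  have "{k \<in> insert j S. k < i} = {k \<in> S. k < i}" using assms(4) by auto
  then show "sign (insert j S) i = sign S i" by (simp add: sign_def)
  have "{k \<in> insert i S. k < j} = insert i {k \<in> S. k < j}" using assms(4) by auto
  then show "sign (insert i S) j = - sign S j" using assms(1,2) by (simp add: sign_def)
qed

text \<open>Adding the smaller index flips the sign of the larger one, while adding the larger index
  does not affect the smaller.\<close>

lemma sign_anticommute:
  assumes "finite S" "i \<notin> S" "j \<notin> S" "i \<noteq> j"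
  shows "sign S j * sign (insert j S) i = - (sign S i * sign (insert i S) j)"
proof (cases "i < j")
  case True
  then show ?thesis using sign_insert [of S i j] assms by simp
next
  case False
  then have "j < i" using assms by simp
  then show ?thesis using sign_insert [of S j i] assms by simp
qed

lemma rat_vector_eq_neg: "x = - x \<Longrightarrow> x = 0" for x :: "'v::rat_vector"
proof -
  assume "x = - x"
  then have "x + x = 0" by (metis add.right_inverse)
  then have "scaleQ 2 x = 0"
    using scaleQ_add_left [of 1 1 x] by (simp add: scaleQ_one)
  then show "x = 0" by simp
qed

text \<open>The sum runs over ordered pairs of distinct crossings. Swapping a pair negates its term,
  since the faces commute and the signs anticommute; so the sum equals its own negative.\<close>

lemma boundary_boundary_emb:
  assumes S: "S \<subseteq> {..<n}" and A: "A \<subseteq> K S"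
  shows "boundary L X (boundary_state L X (S, A)) = 0"
proof -
  let ?v = "Poly_Mapping.single A (1::rat)"
  let ?N = "{..<n} - S"
  define f where "f = (\<lambda>(j, i). scaleQ (sign S j * sign (insert j S) i)
     (emb (insert i (insert j S)) (edge (K (insert j S)) (K (insert i (insert j S))) (edge (K S) (K (insert j S)) ?v))))"
  have finS: "finite S" using S finite_subset by blast
  let ?Pr = "SIGMA j:?N. {..<n} - insert j S"
  have "boundary L X (boundary_state L X (S, A)) = (\<Sum>j\<in>?N. \<Sum>i\<in>{..<n} - insert j S. f (j, i))"
    unfolding boundary_state_emb
    by (simp add: boundary_lin lin_sum lin_scaleQ) (simp add: boundary_emb boundary_lin [symmetric] Q.scale_sum_right f_def)
  also have "\<dots> = sum f ?Pr" by (subst sum.Sigma) auto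
  finally have eq: "boundary L X (boundary_state L X (S, A)) = sum f ?Pr" .
  have "f (i, j) = - f (j, i)" if ji: "(j, i) \<in> ?Pr" for i j
  proof -
    have h: "j < n" "i < n" "j \<notin> S" "i \<notin> S" "i \<noteq> j" using ji by auto
    have com: "insert j (insert i S) = insert i (insert j S)" by blast
    interpret cube_face Outer "K S" "K (insert i S)" "K (insert j S)" "K (insert j (insert i S))"
       "ch i 1" "ch i (-1)" "ch j 1" "ch j (-1)"
    proof
      show "circle_system Outer (K S)" "circle_system Outer (K (insert i S))" "circle_system Outer (K (insert j S))"
        "circle_system Outer (K (insert j (insert i S)))" by (rule circle_system_K)+
      show "ch i 1 \<in> Outer" "ch i (-1) \<in> Outer" "ch j 1 \<in> Outer" "ch j (-1) \<in> Outer"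
        using h by (auto intro!: corner_Outer simp: corners_def)
      show "fusion (K S) (K (insert i S)) (ch i 1) (ch i (-1)) \<or> fusion (K (insert i S)) (K S) (ch i 1) (ch i (-1))"
        using h by (intro fusion_K)
      show "fusion (K S) (K (insert j S)) (ch j 1) (ch j (-1)) \<or> fusion (K (insert j S)) (K S) (ch j 1) (ch j (-1))"
        using h by (intro fusion_K)
      show "fusion (K (insert i S)) (K (insert j (insert i S))) (ch j 1) (ch j (-1)) \<or>
          fusion (K (insert j (insert i S))) (K (insert i S)) (ch j 1) (ch j (-1))"
        using h by (intro fusion_K) auto
      show "fusion (K (insert j S)) (K (insert j (insert i S))) (ch i 1) (ch i (-1)) \<or>
          fusion (K (insert j (insert i S))) (K (insert j S)) (ch i 1) (ch i (-1))"
        unfolding com using h by (intro fusion_K) auto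
    qed
    have s: "sign S i * sign (insert i S) j = - (sign S j * sign (insert j S) i)"
      using sign_anticommute [OF finS h(3,4)] h(5) by simp
    show ?thesis unfolding f_def prod.case s edge_edge_commute [OF A] unfolding com by simp
  qed
  moreover have "sum f ?Pr = (\<Sum>(j, i)\<in>?Pr. f (i, j))"
    by (rule sum.reindex_bij_witness [of _ prod.swap prod.swap]) auto
  ultimately have "sum f ?Pr = (\<Sum>x\<in>?Pr. - f x)" by (auto intro!: sum.cong)
  then have "sum f ?Pr = - sum f ?Pr" by (simp add: sum_negf)
  then show ?thesis unfolding eq by (rule rat_vector_eq_neg)
qed

lemma boundary_state_key:
  assumes "(S', A') \<in> Poly_Mapping.keys (boundary_state L X (S, A))"
  obtains j where "j < n" "j \<notin> S" "S' = insert j S" "A' \<subseteq> K S'" "edge_coeff (K S) (K S') A A' \<noteq> 0"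
proof -
  have "(\<Sum>j\<in>{..<n} - S. \<Sum>B\<in>Pow (K (insert j S)). Poly_Mapping.lookup (Poly_Mapping.single (insert j S, B)
         ((-1) ^ card {i \<in> S. i < j} * edge_coeff (K S) (K (insert j S)) A B)) (S', A')) \<noteq> 0"
    using assms by (simp add: in_keys_iff boundary_state_def lookup_sum_poly_mapping)
  then obtain j where j: "j \<in> {..<n} - S" "(\<Sum>B\<in>Pow (K (insert j S)). Poly_Mapping.lookup (Poly_Mapping.single (insert j S, B)
         ((-1) ^ card {i \<in> S. i < j} * edge_coeff (K S) (K (insert j S)) A B)) (S', A')) \<noteq> 0"
    by (rule sum.not_neutral_contains_not_neutral)
  from j(2) obtain B where "B \<in> Pow (K (insert j S))" "Poly_Mapping.lookup (Poly_Mapping.single (insert j S, B)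
         ((-1) ^ card {i \<in> S. i < j} * edge_coeff (K S) (K (insert j S)) A B)) (S', A') \<noteq> 0"
    by (rule sum.not_neutral_contains_not_neutral)
  then show ?thesis using that [of j] j(1) by (auto simp: lookup_single when_def split: if_splits)
qed

text \<open>All three rows take the value 1 at the constant weight 1: the label sum drops by one,
  which balances the growth of the set of 1-resolved crossings in the quantum degree.\<close>

lemma boundary_weight:
  assumes "j < n" "j \<notin> S" "edge_coeff (K S) (K (insert j S)) A A' \<noteq> 0"
  defines "d \<equiv> \<lambda>f. weight (K S) A f - weight (K (insert j S)) A' f"
  shows "d (\<lambda>_. 1) = 1" "0 \<le> d (enclosed P)" "0 \<le> d (encloses P)" "d (encloses P) = 0 \<Longrightarrow> d (enclosed P) = 0"
proof -
  have "\<exists>U V W m. m < 3 \<and> (\<forall>f. d f = label_changes f U V W ! m) \<and>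
      (\<forall>p\<in>set P. p \<in> inside W \<longleftrightarrow> (p \<in> inside U) \<noteq> (p \<in> inside V))"
    using circles_fusion [OF assms(1,2)]
  proof
    assume "planar_fusion (set P) (K S) (K (insert j S)) (ch j 1) (ch j (-1))"
    then obtain U V W where UVW: "U \<noteq> V" "K S - K (insert j S) = {U, V}" "K (insert j S) - K S = {W}"
      "\<forall>p\<in>set P. p \<in> inside W \<longleftrightarrow> (p \<in> inside U) \<noteq> (p \<in> inside V)"
      by (elim planar_fusionE)
    from merge_weight [OF finite_circles finite_circles assms(3) UVW(1-3)] UVW(4)
    show ?thesis unfolding d_def by blast
  next
    assume "planar_fusion (set P) (K (insert j S)) (K S) (ch j 1) (ch j (-1))"
    then obtain U V W where UVW: "U \<noteq> V" "K (insert j S) - K S = {U, V}" "K S - K (insert j S) = {W}"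
      "\<forall>p\<in>set P. p \<in> inside W \<longleftrightarrow> (p \<in> inside U) \<noteq> (p \<in> inside V)"
      by (elim planar_fusionE)
    from split_weight [OF finite_circles finite_circles assms(3) UVW(1-3)] UVW(4)
    show ?thesis unfolding d_def by blast
  qed
  then obtain U V W m where m: "m < 3" "\<And>f. d f = label_changes f U V W ! m"
     "\<forall>p\<in>set P. p \<in> inside W \<longleftrightarrow> (p \<in> inside U) \<noteq> (p \<in> inside V)" by blast
  note lc = fusion_label_changes [OF m(3,1)]
  show "0 \<le> d (enclosed P)" "0 \<le> d (encloses P)" "d (encloses P) = 0 \<Longrightarrow> d (enclosed P) = 0"
    unfolding m(2) by (fact lc)+
  have "m = 0 \<or> m = 1 \<or> m = 2" using m(1) by linarith
  then show "d (\<lambda>_. 1) = 1" unfolding m(2) by (auto simp: label_changes_def numeral_2_eq_2)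
qed

section \<open>The Khovanov complex as a bifiltered complex\<close>

lemma finite_states: "finite (states L X)"
proof -
  have "states L X = (SIGMA S:Pow {..<n}. Pow (K S))" by (auto simp: states_def)
  then show ?thesis using finite_circles by (simp add: finite_SigmaI)
qed

lemma bifiltered:
  assumes "set P \<subseteq> ball 0 1"
  shows "bifiltered_complex (states L X) (boundary_state L X) (hdeg L X) (qdeg L X)
     (coord_sum P \<circ> g_Sigma P L X) (coeff_sum \<circ> Phi P L X)"
proof
  show "finite (states L X)" by (rule finite_states)
  show "lin (boundary_state L X) (boundary_state L X x) = 0" if "x \<in> states L X" for x
    using that boundary_boundary_emb unfolding boundary_lin by (auto simp: states_def)
  fix x y assume x: "x \<in> states L X" and y: "y \<in> Poly_Mapping.keys (boundary_state L X x)"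
  obtain S A where SA: "x = (S, A)" "S \<subseteq> {..<n}" "A \<subseteq> K S" using x by (auto simp: states_def)
  obtain S' A' where y': "y = (S', A')" by (cases y)
  obtain j where j: "j < n" "j \<notin> S" "S' = insert j S" "A' \<subseteq> K S'" "edge_coeff (K S) (K S') A A' \<noteq> 0"
    using boundary_state_key y unfolding SA(1) y' by metis
  have finS: "finite S" using SA(2) finite_subset by blast
  note w = boundary_weight [OF j(1,2) j(5) [unfolded j(3)]]
  have "y \<in> states L X" using j SA(2) by (auto simp: y' states_def)
  moreover have "hdeg L X y = hdeg L X x + 1" using j(2) finS by (simp add: SA(1) y' j(3) hdeg_def)
  moreover have "qdeg L X y = qdeg L X x"
    using w(1) j(2) finS by (simp add: SA(1) y' j(3) qdeg_def weight_def)
  ultimately show "y \<in> states L X \<and> hdeg L X y = hdeg L X x + 1 \<and> qdeg L X y = qdeg L X x \<and>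
      (coord_sum P \<circ> g_Sigma P L X) y \<le> (coord_sum P \<circ> g_Sigma P L X) x \<and>
      (coeff_sum \<circ> Phi P L X) y \<le> (coeff_sum \<circ> Phi P L X) x \<and>
      ((coeff_sum \<circ> Phi P L X) y = (coeff_sum \<circ> Phi P L X) x \<longrightarrow>
       (coord_sum P \<circ> g_Sigma P L X) y = (coord_sum P \<circ> g_Sigma P L X) x)"
    using w(2-4) by (simp add: SA(1) y' j(3) coord_sum_g_Sigma coeff_sum_Phi [OF assms])
qed

end

theorem theorem1p3:
  fixes P :: "complex list" and L :: link and X :: "(complex \<Rightarrow> complex) list"
  assumes "distinct P" and "set P \<subseteq> ball 0 1"
    and "is_link P L" and "is_diagram P L X"
  shows "\<exists>(E :: chain pages) d.
    spectral_sequence E d \<and>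
    (\<forall>p h q. isomorphic (direct_sum (\<lambda>k. E 1 p h q k)) (APS_flat P L X h q p)) \<and>
    converges_to E d (MKh_flat P L X)"
proof -
  interpret link_diagram P L X by unfold_locales (rule assms)+
  interpret bc: bifiltered_complex "states L X" "boundary_state L X" "hdeg L X" "qdeg L X"
      "coord_sum P \<circ> g_Sigma P L X" "coeff_sum \<circ> Phi P L X"
    by (rule bifiltered [OF assms(2)])
  have filt: "filtration L X deg h q a = supp (bc.T h q (\<lambda>x. deg x \<le> a))" for deg :: "state \<Rightarrow> int" and h q a
    by (simp add: filtration_def span_singles bc.T_def)
  \<comment> \<open>For an integer grading the pieces below \<open>a\<close> are nested and the
    largest is the one at \<open>a - 1\<close>.\<close>
  have filt_less: "Q.span (\<Union>b\<in>{..<a}. filtration L X deg h q b) = supp (bc.T h q (\<lambda>x. deg x < a))"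
    for deg :: "state \<Rightarrow> int" and h q a
  proof
    show "Q.span (\<Union>b\<in>{..<a}. filtration L X deg h q b) \<subseteq> supp (bc.T h q (\<lambda>x. deg x < a))"
      unfolding filt by (intro Q.span_minimal supp_subspace UN_least bc.T_mono) auto
    have "supp (bc.T h q (\<lambda>x. deg x < a)) = filtration L X deg h q (a - 1)" by (simp add: filt)
    also have "\<dots> \<subseteq> Q.span (\<Union>b\<in>{..<a}. filtration L X deg h q b)"
      by (rule order_trans [OF UN_upper Q.span_superset]) simp
    finally show "supp (bc.T h q (\<lambda>x. deg x < a)) \<subseteq> Q.span (\<Union>b\<in>{..<a}. filtration L X deg h q b)" .
  qed
  have GH: "gr_homology L X deg = bc.GH deg" for deg :: "state \<Rightarrow> int"
    by (intro ext, simp add: gr_homology_def bc.GH_def gr_def filt_less boundary_lin, simp add: filt)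
  show ?thesis
  proof (intro exI conjI allI)
    show "spectral_sequence bc.FC.page (\<lambda>_ _ _ _ _. bc.D)" by (rule bc.FC.spectral_sequence_page)
    show "isomorphic (direct_sum (\<lambda>k. bc.FC.page 1 p h q k)) (APS_flat P L X h q p)" for p h q
      unfolding APS_flat_def GH by (rule bc.page_1)
    show "converges_to bc.FC.page (\<lambda>_ _ _ _ _. bc.D) (MKh_flat P L X)"
      unfolding MKh_flat_def GH by (rule bc.converges)
  qed
qed

end
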